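(* Let $K$ be a field, let $G$ be a finite simple graph with $V(G)=\{x_1,\ldots,x_n\}$, and let $H_1,\ldots,H_n$ be finite simple graphs with $V(H_i)=\{z^{(i)}_1,\ldots,z^{(i)}_{r_i}\}$, all these vertex sets being pairwise disjoint. Suppose that each $J_{H_i}$ has a quadratic Gröbner basis with respect to some monomial order. Then each power of the vertex cover ideal $I_{G(H_1,\ldots,H_n)}$ possesses an order of linear quotients on its minimal monomial generating set, and hence it is componentwise linear.
   Context: The graph $G(H_1,\ldots,H_n)$ has vertex set $V(G)\cup V(H_1)\cup\cdots\cup V(H_n)$ and edge set $E(G)\cup E(H_1)\cup\cdots\cup E(H_n)\cup\bigcup_{1\le i\le n,\,1\le j\le r_i}\{\{x_i,z^{(i)}_j\}\}$ (each $x_i$ is joined to all vertices of $H_i$). For a finite simple graph $\Gamma$ with vertices $v_1,\ldots,v_N$, let $S=K[v_1,\ldots,v_N]$. A vertex cover of $\Gamma$ is a subset of $V(\Gamma)$ meeting every edge; it is minimal if no proper subset is a vertex cover. For $C\subseteq V(\Gamma)$ put $u_C=\prod_{v\in C}v$. If $C_1,\ldots,C_q$ are the minimal vertex covers of $\Gamma$, the (vertex) cover ideal is $I_\Gamma=(u_{C_1},\ldots,u_{C_q})\subset S$, its Rees algebra is $\mathcal{R}(I_\Gamma)=K[v_1,\ldots,v_N,u_{C_1}t,\ldots,u_{C_q}t]\subset S[t]$, and $J_\Gamma\subset T=S[y_1,\ldots,y_q]$ is the kernel of the surjective $K$-algebra map $\pi:T\to\mathcal{R}(I_\Gamma)$,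 $\pi(v_i)=v_i$, $\pi(y_j)=u_{C_j}t$. $J_\Gamma$ has a quadratic Gröbner basis with respect to a monomial order $<$ on $T$ if $\mathrm{in}_<(J_\Gamma)$ is generated by monomials of total degree two (every variable $v_i,y_j$ having degree one). A monomial ideal possesses an order of linear quotients on its minimal monomial generating set if these generators can be ordered $g_1,\ldots,g_s$ so that each colon ideal $(g_1,\ldots,g_{j-1}):g_j$ is generated by linear forms (equivalently, by variables). A graded ideal $I\subset S$ is componentwise linear if for each integer $j$ the ideal generated by all homogeneous elements of degree $j$ in $I$ has a linear resolution. *)

theory Defs
  imports
    "HOL-Library.Poly_Mapping"
    "HOL-Algebra.Ideal_Product"
    "HOL-Algebra.Generated_Rings"
begin

section \<open>Polynomial rings over a set of variables\<close>

text \<open>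
  A polynomial with variables in a type \<open>'v\<close> and coefficients in \<open>'k\<close> is a finitely
  supported function from monomials (exponent vectors) to coefficients. For a set \<open>V\<close> of
  variables, \<open>mpoly_ring V\<close> is the ring \<open>K[V]\<close> of the polynomials in which only variables
  from \<open>V\<close> occur; all ideals below are ideals of such a ring.
\<close>

type_synonym 'v mon = "'v \<Rightarrow>\<^sub>0 nat"
type_synonym ('v, 'k) mpoly = "'v mon \<Rightarrow>\<^sub>0 'k"

definition mons :: "'v set \<Rightarrow> 'v mon set" where
  "mons V = {m. Poly_Mapping.keys m \<subseteq> V}"

definition mpoly_ring :: "'v set \<Rightarrow> ('v, 'k::field) mpoly ring" where
  "mpoly_ring V = \<lparr>carrier = {p. Poly_Mapping.keys p \<subseteq> mons V}, monoid.mult = (*), one = 1,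
                   ring.zero = 0, add = (+)\<rparr>"

definition mpoly_of_mon :: "'v mon \<Rightarrow> ('v, 'k::field) mpoly" where
  "mpoly_of_mon m = Poly_Mapping.single m 1"

definition var :: "'v \<Rightarrow> ('v, 'k::field) mpoly" where
  "var v = mpoly_of_mon (Poly_Mapping.single v 1)"

definition const :: "'k \<Rightarrow> ('v, 'k::field) mpoly" where
  "const c = Poly_Mapping.single 0 c"

definition subst :: "('v \<Rightarrow> ('w, 'k) mpoly) \<Rightarrow> ('v, 'k::field) mpoly \<Rightarrow> ('w, 'k) mpoly" where
  "subst f p =
     (\<Sum>m\<in>Poly_Mapping.keys p. const (Poly_Mapping.lookup p m) *
        (\<Prod>v\<in>Poly_Mapping.keys m. f v ^ Poly_Mapping.lookup m v))"

definition mdeg :: "'v mon \<Rightarrow> nat" where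
  "mdeg m = (\<Sum>v\<in>Poly_Mapping.keys m. Poly_Mapping.lookup m v)"

text \<open>The zero polynomial is homogeneous of every degree.\<close>

definition homogeneous :: "nat \<Rightarrow> ('v, 'k::field) mpoly \<Rightarrow> bool" where
  "homogeneous d p \<longleftrightarrow> (\<forall>m\<in>Poly_Mapping.keys p. mdeg m = d)"

definition hom_component :: "nat \<Rightarrow> ('v, 'k::field) mpoly \<Rightarrow> ('v, 'k) mpoly" where
  "hom_component d p =
     (\<Sum>m\<in>{m \<in> Poly_Mapping.keys p. mdeg m = d}. Poly_Mapping.single m (Poly_Mapping.lookup p m))"

text \<open>
  The generated ideal \<open>Idl\<close> is an intersection over all ideals, which is meaningful only
  because \<open>mpoly_ring V\<close> is indeed a ring.
\<close>

lemma mons_0: "0 \<in> mons V"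
  by (simp add: mons_def)

lemma mons_add: "a \<in> mons V \<Longrightarrow> b \<in> mons V \<Longrightarrow> a + b \<in> mons V"
  using Poly_Mapping.keys_add[of a b] by (auto simp: mons_def)

lemma mpoly_ring_cring: "cring (mpoly_ring V :: ('v, 'k::field) mpoly ring)"
proof -
  let ?P = "{p :: ('v, 'k) mpoly. Poly_Mapping.keys p \<subseteq> mons V}"
  have add: "p + q \<in> ?P" if "p \<in> ?P" "q \<in> ?P" for p q
    using that Poly_Mapping.keys_add[of p q] by auto
  have mult: "p * q \<in> ?P" if "p \<in> ?P" "q \<in> ?P" for p q
    using that keys_mult[of p q] mons_add by fastforce
  have one: "1 \<in> ?P"
    by (simp add: mons_0)
  have neg: "- p \<in> ?P" if "p \<in> ?P" for p
    using that by simp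
  show ?thesis
  proof (rule cringI)
    show "abelian_group (mpoly_ring V :: ('v, 'k) mpoly ring)"
    proof (rule abelian_groupI)
      fix p :: "('v, 'k) mpoly"
      assume "p \<in> carrier (mpoly_ring V)"
      then show "\<exists>q\<in>carrier (mpoly_ring V). q \<oplus>\<^bsub>mpoly_ring V\<^esub> p = \<zero>\<^bsub>mpoly_ring V\<^esub>"
        using neg[of p] by (intro bexI[of _ "- p"]) (auto simp: mpoly_ring_def)
    qed (use add in \<open>auto simp: mpoly_ring_def ac_simps\<close>)
    show "Group.comm_monoid (mpoly_ring V :: ('v, 'k) mpoly ring)"
      by (rule comm_monoidI) (use mult one in \<open>auto simp: mpoly_ring_def ac_simps\<close>)
  qed (auto simp: mpoly_ring_def algebra_simps)
qed


section \<open>Monomial orders and quadratic Groebner bases\<close>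

definition monomial_order :: "'v set \<Rightarrow> ('v mon \<times> 'v mon) set \<Rightarrow> bool" where
  "monomial_order V r \<longleftrightarrow>
     strict_linear_order_on (mons V) r \<and>
     (\<forall>a\<in>mons V. a \<noteq> 0 \<longrightarrow> (0, a) \<in> r) \<and>
     (\<forall>a\<in>mons V. \<forall>b\<in>mons V. \<forall>c\<in>mons V. (a, b) \<in> r \<longrightarrow> (a + c, b + c) \<in> r)"

definition initial_mon :: "('v mon \<times> 'v mon) set \<Rightarrow> ('v, 'k::field) mpoly \<Rightarrow> 'v mon" where
  "initial_mon r p =
     (THE m. m \<in> Poly_Mapping.keys p \<and>
        (\<forall>m'\<in>Poly_Mapping.keys p. m' \<noteq> m \<longrightarrow> (m', m) \<in> r))"

definition initial_ideal ::
    "'v set \<Rightarrow> ('v mon \<times> 'v mon) set \<Rightarrow> ('v, 'k::field) mpoly set \<Rightarrow> ('v, 'k) mpoly set" where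
  "initial_ideal V r J = Idl\<^bsub>mpoly_ring V\<^esub> {mpoly_of_mon (initial_mon r f) | f. f \<in> J \<and> f \<noteq> 0}"

definition has_quadratic_groebner_basis ::
    "'v set \<Rightarrow> ('v mon \<times> 'v mon) set \<Rightarrow> ('v, 'k::field) mpoly set \<Rightarrow> bool" where
  "has_quadratic_groebner_basis V r J \<longleftrightarrow>
     (\<exists>M \<subseteq> {m \<in> mons V. mdeg m = 2}.
        initial_ideal V r J = Idl\<^bsub>mpoly_ring V\<^esub> (mpoly_of_mon ` M))"


section \<open>Graphs and vertex covers\<close>

record 'a ugraph =
  verts :: "'a set"
  edges :: "'a set set"

definition finite_simple_graph :: "'a ugraph \<Rightarrow> bool" where
  "finite_simple_graph G \<longleftrightarrow> finite (verts G) \<and> (\<forall>e\<in>edges G. e \<subseteq> verts G \<and> card e = 2)"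

text \<open>\<open>attach n x G H\<close> is the graph $G(H_1,\ldots,H_n)$, where \<open>x i\<close> is the vertex $x_i$ of $G$.\<close>

definition attach :: "nat \<Rightarrow> (nat \<Rightarrow> 'a) \<Rightarrow> 'a ugraph \<Rightarrow> (nat \<Rightarrow> 'a ugraph) \<Rightarrow> 'a ugraph" where
  "attach n x G H =
     \<lparr>verts = verts G \<union> (\<Union>i\<in>{1..n}. verts (H i)),
      edges = edges G \<union> (\<Union>i\<in>{1..n}. edges (H i)) \<union>
              {{x i, z} | i z. i \<in> {1..n} \<and> z \<in> verts (H i)}\<rparr>"

definition vertex_cover :: "'a ugraph \<Rightarrow> 'a set \<Rightarrow> bool" where
  "vertex_cover G C \<longleftrightarrow> C \<subseteq> verts G \<and> (\<forall>e\<in>edges G. e \<inter> C \<noteq> {})"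

definition minimal_vertex_covers :: "'a ugraph \<Rightarrow> 'a set set" where
  "minimal_vertex_covers G = {C. vertex_cover G C \<and> (\<forall>D. D \<subset> C \<longrightarrow> \<not> vertex_cover G D)}"

definition cover_ideal :: "'a ugraph \<Rightarrow> ('a, 'k::field) mpoly set" where
  "cover_ideal G = Idl\<^bsub>mpoly_ring (verts G)\<^esub> ((\<lambda>C. \<Prod>v\<in>C. var v) ` minimal_vertex_covers G)"


section \<open>The Rees algebra of the cover ideal and its defining ideal\<close>

text \<open>
  In $S[t]$ the vertex \<open>v\<close> is the variable \<open>Some v\<close> and $t$ is the variable \<open>None\<close>. In
  $T = S[y_1,\ldots,y_q]$ the vertex \<open>v\<close> is the variable \<open>Inl v\<close>, and the variable $y_j$
  belonging to the minimal vertex cover $C_j$ is \<open>Inr\<close> $C_j$.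
\<close>

definition St_vars :: "'a ugraph \<Rightarrow> 'a option set" where
  "St_vars G = insert None (Some ` verts G)"

definition T_vars :: "'a ugraph \<Rightarrow> ('a + 'a set) set" where
  "T_vars G = Inl ` verts G \<union> Inr ` minimal_vertex_covers G"

definition rees_gen :: "'a + 'a set \<Rightarrow> ('a option, 'k::field) mpoly" where
  "rees_gen y = (case y of Inl v \<Rightarrow> var (Some v) | Inr C \<Rightarrow> (\<Prod>v\<in>C. var (Some v)) * var None)"

definition rees_algebra :: "'a ugraph \<Rightarrow> ('a option, 'k::field) mpoly ring" where
  "rees_algebra G =
     (mpoly_ring (St_vars G))
       \<lparr>carrier := generate_ring (mpoly_ring (St_vars G)) (range const \<union> rees_gen ` T_vars G)\<rparr>"

definition rees_ideal :: "'a ugraph \<Rightarrow> ('a + 'a set, 'k::field) mpoly set" where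
  "rees_ideal G = a_kernel (mpoly_ring (T_vars G)) (rees_algebra G) (subst rees_gen)"


section \<open>Linear quotients\<close>

definition is_min_mon_gens :: "'v set \<Rightarrow> ('v, 'k::field) mpoly set \<Rightarrow> 'v mon set \<Rightarrow> bool" where
  "is_min_mon_gens V I M \<longleftrightarrow>
     M \<subseteq> mons V \<and> I = Idl\<^bsub>mpoly_ring V\<^esub> (mpoly_of_mon ` M) \<and>
     (\<forall>M'. M' \<subset> M \<longrightarrow> I \<noteq> Idl\<^bsub>mpoly_ring V\<^esub> (mpoly_of_mon ` M'))"

definition colon_ideal ::
    "'v set \<Rightarrow> ('v, 'k::field) mpoly set \<Rightarrow> ('v, 'k) mpoly \<Rightarrow> ('v, 'k) mpoly set" where
  "colon_ideal V I g = {f \<in> carrier (mpoly_ring V). f * g \<in> I}"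

definition has_linear_quotients :: "'v set \<Rightarrow> ('v, 'k::field) mpoly set \<Rightarrow> bool" where
  "has_linear_quotients V I \<longleftrightarrow>
     (\<exists>gs. distinct gs \<and> is_min_mon_gens V I (set gs) \<and>
       (\<forall>j<length gs. \<exists>L \<subseteq> {l :: ('v, 'k) mpoly. l \<in> carrier (mpoly_ring V) \<and> homogeneous 1 l}.
          colon_ideal V (Idl\<^bsub>mpoly_ring V\<^esub> (mpoly_of_mon ` set (take j gs))) (mpoly_of_mon (gs ! j))
            = Idl\<^bsub>mpoly_ring V\<^esub> L))"


section \<open>Graded free resolutions and componentwise linearity\<close>

text \<open>
  An element of the free module $S^b$ over $S = K[V]$ is a sequence of polynomials that vanishes
  from index \<open>b\<close> on, and a map $S^c \to S^b$ is given by a \<open>b\<close> by \<open>c\<close> matrix.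
\<close>

definition free_module :: "'v set \<Rightarrow> nat \<Rightarrow> (nat \<Rightarrow> ('v, 'k::field) mpoly) set" where
  "free_module V b = {f. (\<forall>k<b. f k \<in> carrier (mpoly_ring V)) \<and> (\<forall>k\<ge>b. f k = 0)}"

definition mat_apply :: "nat \<Rightarrow> nat \<Rightarrow> (nat \<Rightarrow> nat \<Rightarrow> ('v, 'k::field) mpoly) \<Rightarrow>
    (nat \<Rightarrow> ('v, 'k) mpoly) \<Rightarrow> nat \<Rightarrow> ('v, 'k) mpoly" where
  "mat_apply b c A f k = (if k < b then \<Sum>l<c. A k l * f l else 0)"

text \<open>
  A graded free resolution $\cdots \to F_1 \to F_0 \to I \to 0$ over $K[V]$ with
  $F_i = \bigoplus_{k < b_i} S(-d_{i,k})$. The augmentation $F_0 \to I$ sends the basis elements to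
  \<open>g\<close>, and \<open>A i\<close> is the matrix of $F_{i+1} \to F_i$; its \<open>k\<close>,\<open>l\<close> entry is homogeneous of degree
  $d_{i+1,l} - d_{i,k}$, and zero if this difference is negative.
\<close>

definition graded_free_resolution :: "'v set \<Rightarrow> ('v, 'k::field) mpoly set \<Rightarrow> (nat \<Rightarrow> nat) \<Rightarrow>
    (nat \<Rightarrow> nat \<Rightarrow> nat) \<Rightarrow> (nat \<Rightarrow> ('v, 'k) mpoly) \<Rightarrow> (nat \<Rightarrow> nat \<Rightarrow> nat \<Rightarrow> ('v, 'k) mpoly) \<Rightarrow> bool" where
  "graded_free_resolution V I b d g A \<longleftrightarrow>
     (\<forall>k<b 0. g k \<in> carrier (mpoly_ring V) \<and> homogeneous (d 0 k) (g k)) \<and>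
     (\<forall>i. \<forall>k<b i. \<forall>l<b (Suc i). A i k l \<in> carrier (mpoly_ring V) \<and>
        (\<forall>m\<in>Poly_Mapping.keys (A i k l). mdeg m + d i k = d (Suc i) l)) \<and>
     (\<lambda>f. \<Sum>k<b 0. g k * f k) ` free_module V (b 0) = I \<and>
     {f \<in> free_module V (b 0). (\<Sum>k<b 0. g k * f k) = 0}
       = mat_apply (b 0) (b 1) (A 0) ` free_module V (b 1) \<and>
     (\<forall>i. {f \<in> free_module V (b (Suc i)). mat_apply (b i) (b (Suc i)) (A i) f = (\<lambda>_. 0)}
       = mat_apply (b (Suc i)) (b (Suc (Suc i))) (A (Suc i)) ` free_module V (b (Suc (Suc i))))"

text \<open>
  Minimality: no matrix entry has a nonzero constant term. For the resolution of an ideal generated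
  in degree \<open>j\<close>, linearity means $F_i = S(-j-i)^{b_i}$ for all $i$.
\<close>

definition has_linear_resolution :: "'v set \<Rightarrow> ('v, 'k::field) mpoly set \<Rightarrow> bool" where
  "has_linear_resolution V I \<longleftrightarrow>
     (\<exists>b d g A. graded_free_resolution V I b d g A \<and>
        (\<forall>i. \<forall>k<b i. \<forall>l<b (Suc i). Poly_Mapping.lookup (A i k l) 0 = 0) \<and>
        (\<exists>j. \<forall>i. \<forall>k<b i. d i k = j + i))"

definition graded_ideal :: "'v set \<Rightarrow> ('v, 'k::field) mpoly set \<Rightarrow> bool" where
  "graded_ideal V I \<longleftrightarrow> ideal I (mpoly_ring V) \<and> (\<forall>f\<in>I. \<forall>d. hom_component d f \<in> I)"

definition componentwise_linear :: "'v set \<Rightarrow> ('v, 'k::field) mpoly set \<Rightarrow> bool" where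
  "componentwise_linear V I \<longleftrightarrow>
     graded_ideal V I \<and>
     (\<forall>j. has_linear_resolution V (Idl\<^bsub>mpoly_ring V\<^esub> {f \<in> I. homogeneous j f}))"

end

theory Submission
  imports Defs "HOL-Library.Product_Lexorder"
begin

text \<open>
  Everything is expressed through decompositions of monomial ideals. An \<open>lq_system\<close> consists of
  finitely many monomials $u_i$ with sets of variables $Q_i$ and ranks such that the pieces
  $u_i K[V \setminus Q_i]$ are disjoint, and for $z \in Q_i$ the monomial $z u_i$ equals
  $g u_j$ with $g \neq 1$ and $u_j$ of smaller rank. Replacing $z u_i$ by $g u_j$ moves a monomial
  of the ideal into its piece; since $g \neq 1$, the degree of the generator does not grow. With
  the generators sorted by degree and then by rank, the colon ideal at $u_i$ is therefore generated
  by the variables of $Q_i$, which gives linear quotients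
  (\<open>lq_system_linear_quotients\<close>).

  Componentwise linearity follows in two steps. The monomials of degree $d$ in the ideal again
  carry such a system (\<open>lq_system_component\<close>), because the monomials of a fixed degree of a
  polynomial ring do. And a system in a single degree yields a linear resolution: for a submodule of
  a free module, having generators of one degree whose successive colon ideals are generated by
  variables is inherited by the syzygy module, with linear syzygies
  (\<open>lq_module_syzygies\<close>). So the resolution can be continued forever.

  For a single graph $H$, the map $\pi$ partitions the monomials of $T$ into fibres, and a monomial
  lies in the initial ideal exactly if it is not the smallest of its fibre. If the initial ideal is
  generated in degree two, each nonstandard monomial has a nonstandard divisor $y_C y_D$ or $z y_C$.
  The standard monomials $w$ of degree $c$ in the $y$'s then index an \<open>lq_system\<close> for
  $I_H^c$ (\<open>cover_powers_lq_system\<close>): $Q_w$ consists of the $z$ for which $z w$ is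
  nonstandard, disjointness of the pieces is uniqueness of the standard monomial of a fibre, and
  $z y_C$ is equivalent to a smaller $g y_D$, where $g \neq 1$ by minimality of the covers. The
  rank comes from the relation ``$f w > g w'$ in a common fibre for some $f, g$''; it is a strict
  order for any monomial order, as multiplying two such inequalities shows.

  A minimal vertex cover of $G(H_1,\ldots,H_n)$ is a vertex cover $W$ of $G$ together with a
  minimal cover of $H_i$ for $x_i \in W$ and all of $V(H_i)$ for $x_i \notin W$. Hence a product of
  $k$ of them is given by the numbers $a_i$ of factors that contain $x_i$ and by independent
  products $w_i$ of $a_i$ minimal covers of $H_i$:
  \[ \prod_i x_i^{a_i} \, w_i \, u_{V(H_i)}^{k-a_i}. \]
  The systems of the $I_{H_i}^{a_i}$ combine to one for the power of the cover ideal
  (\<open>cover_powers_GH_lq_system\<close>). The only additional variables are the $x_i$ with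
  $a_i < k$: multiplying by $x_i$ allows one factor $u_{V(H_i)}$ to be exchanged for $x_i u_C$ with
  $C$ a minimal cover of $H_i$, which leaves the nontrivial monomial $u_{V(H_i) \setminus C}$.
\<close>

abbreviation "keys \<equiv> Poly_Mapping.keys"
abbreviation "lookup \<equiv> Poly_Mapping.lookup"
abbreviation "single \<equiv> Poly_Mapping.single"

section \<open>Exponent vectors\<close>

lemma keys_add_mon: "keys (a + b :: 'v mon) = keys a \<union> keys b"
  by (auto simp: in_keys_iff lookup_add)

lemma mons_add_iff: "a + b \<in> mons V \<longleftrightarrow> a \<in> mons V \<and> b \<in> mons V"
  by (auto simp: mons_def keys_add_mon)

lemma mons_single: "n \<noteq> 0 \<Longrightarrow> single v (n::nat) \<in> mons V \<longleftrightarrow> v \<in> V"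
  by (simp add: mons_def)

lemma add_diff_mon:
  fixes a b :: "'v mon"
  assumes "\<And>v. lookup a v \<le> lookup b v"
  shows "a + (b - a) = b"
  by (rule poly_mapping_eqI) (simp add: lookup_add lookup_minus assms)

lemma single_split: "v \<in> keys (m :: 'v mon) \<Longrightarrow> single v 1 + (m - single v 1) = m"
  by (rule add_diff_mon) (auto simp: lookup_single in_keys_iff when_def)

lemma add_eq_0_mon: "(a + b :: 'v mon) = 0 \<longleftrightarrow> a = 0 \<and> b = 0"
  by (metis Un_empty keys_add_mon keys_eq_empty)

lemma mdeg_superset:
  assumes "finite X" "keys m \<subseteq> X"
  shows "mdeg m = (\<Sum>v\<in>X. lookup m v)"
  unfolding mdeg_def using assms by (intro sum.mono_neutral_left) (auto simp: in_keys_iff)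

lemma mdeg_add: "mdeg (a + b) = mdeg a + mdeg b"
proof -
  let ?X = "keys a \<union> keys b"
  have "mdeg (a + b) = (\<Sum>v\<in>?X. lookup (a + b) v)"
    by (rule mdeg_superset) (auto simp: keys_add_mon)
  also have "\<dots> = mdeg a + mdeg b"
    by (simp add: lookup_add sum.distrib mdeg_superset[of ?X a] mdeg_superset[of ?X b])
  finally show ?thesis .
qed

lemma mdeg_0 [simp]: "mdeg 0 = 0"
  by (simp add: mdeg_def)

lemma mdeg_single [simp]: "mdeg (single v (n::nat)) = n"
  by (simp add: mdeg_def)

lemma mdeg_eq_0_iff: "mdeg m = 0 \<longleftrightarrow> m = 0"
proof
  assume "mdeg m = 0"
  then have "keys m = {}"
    by (auto simp: mdeg_def in_keys_iff simp del: keys_eq_empty)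
  then show "m = 0" by simp
qed simp

lemma lookup_le_mdeg: "lookup m v \<le> mdeg m"
  by (cases "v \<in> keys m") (auto simp: mdeg_def in_keys_iff intro: member_le_sum)

lemma finite_bounded_mons:
  assumes "finite V"
  shows "finite {m \<in> mons V. \<forall>v. lookup m v \<le> d}"
proof (rule finite_imageD)
  show "inj_on lookup {m \<in> mons V. \<forall>v. lookup m v \<le> d}"
    by (auto simp: inj_on_def intro: poly_mapping_eqI)
  have "finite {f. \<forall>v. (v \<in> V \<longrightarrow> f v \<in> {..d}) \<and> (v \<notin> V \<longrightarrow> f v = (0::nat))}"
    using assms by (intro finite_set_of_finite_funs) auto
  then show "finite (lookup ` {m \<in> mons V. \<forall>v. lookup m v \<le> d})"
    by (rule rev_finite_subset) (auto simp: mons_def in_keys_iff)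
qed

lemma finite_mons_of_mdeg: "finite V \<Longrightarrow> finite {m \<in> mons V. mdeg m = d}"
  by (rule finite_subset[OF _ finite_bounded_mons[of V d]]) (auto simp: lookup_le_mdeg)

definition set_mon :: "'v set \<Rightarrow> 'v mon" where
  "set_mon C = (\<Sum>v\<in>C. single v 1)"

lemma lookup_set_mon: "finite C \<Longrightarrow> lookup (set_mon C) v = (if v \<in> C then 1 else 0)"
  by (auto simp: set_mon_def lookup_sum lookup_single when_def)

lemma keys_set_mon: "finite C \<Longrightarrow> keys (set_mon C) = C"
  by (auto simp: in_keys_iff lookup_set_mon split: if_splits)

definition restrict_mon :: "'v set \<Rightarrow> 'v mon \<Rightarrow> 'v mon" where
  "restrict_mon X m = (\<Sum>v\<in>keys m \<inter> X. single v (lookup m v))"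

lemma lookup_restrict_mon: "lookup (restrict_mon X m) v = (if v \<in> X then lookup m v else 0)"
  by (auto simp: restrict_mon_def lookup_sum lookup_single when_def in_keys_iff)

lemma keys_restrict_mon: "keys (restrict_mon X m) = keys m \<inter> X"
  by (auto simp: in_keys_iff lookup_restrict_mon split: if_splits)

fun sums_of :: "'v mon set \<Rightarrow> nat \<Rightarrow> 'v mon set" where
  "sums_of U 0 = {0}"
| "sums_of U (Suc k) = {a + b | a b. a \<in> sums_of U k \<and> b \<in> U}"

lemma sums_of_mons: "U \<subseteq> mons V \<Longrightarrow> sums_of U k \<subseteq> mons V"
  by (induction k) (auto simp: mons_0 intro!: mons_add)


section \<open>Monomial ideals\<close>

definition multiples :: "'v mon set \<Rightarrow> 'v mon set" where
  "multiples U = {m. \<exists>u\<in>U. \<exists>s. m = s + u}"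

definition mon_ideal :: "'v set \<Rightarrow> 'v mon set \<Rightarrow> ('v, 'k::field) mpoly set" where
  "mon_ideal V U = {p. keys p \<subseteq> mons V \<inter> multiples U}"

lemma multiples_I: "u \<in> U \<Longrightarrow> s + u \<in> multiples U"
  by (auto simp: multiples_def)

lemma subset_multiples: "U \<subseteq> multiples U"
  using multiples_I[of _ U 0] by auto

lemma multiples_add: "m \<in> multiples U \<Longrightarrow> s + m \<in> multiples U"
  unfolding multiples_def by (auto simp: add.assoc[symmetric]) (metis add.assoc)

lemma multiples_subsetI: "U \<subseteq> multiples W \<Longrightarrow> multiples U \<subseteq> multiples W"
  using multiples_add by (fastforce simp: multiples_def[of U])

lemma carrier_mpoly: "p \<in> carrier (mpoly_ring V) \<longleftrightarrow> keys p \<subseteq> mons V"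
  by (simp add: mpoly_ring_def)

lemma mpoly_ring_simps [simp]:
  "p \<otimes>\<^bsub>mpoly_ring V\<^esub> q = p * q" "p \<oplus>\<^bsub>mpoly_ring V\<^esub> q = p + q"
  "\<zero>\<^bsub>mpoly_ring V\<^esub> = 0" "\<one>\<^bsub>mpoly_ring V\<^esub> = 1"
  by (simp_all add: mpoly_ring_def)

lemma mpoly_ring_ring: "ring (mpoly_ring V :: ('v, 'k::field) mpoly ring)"
  using mpoly_ring_cring by (rule cring.axioms)

lemma mpoly_carrier_closed:
  fixes p q :: "('v, 'k::field) mpoly"
  assumes "p \<in> carrier (mpoly_ring V)" "q \<in> carrier (mpoly_ring V)"
  shows "p + q \<in> carrier (mpoly_ring V)" "p * q \<in> carrier (mpoly_ring V)"
    "- p \<in> carrier (mpoly_ring V)" "p - q \<in> carrier (mpoly_ring V)"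
proof -
  interpret ring "mpoly_ring V :: ('v, 'k) mpoly ring" by (rule mpoly_ring_ring)
  show "p + q \<in> carrier (mpoly_ring V)" "p * q \<in> carrier (mpoly_ring V)"
    using a_closed[OF assms] m_closed[OF assms] by simp_all
  show neg: "- p \<in> carrier (mpoly_ring V)"
    using assms by (simp add: carrier_mpoly)
  show "p - q \<in> carrier (mpoly_ring V)"
    using assms keys_diff[of p q] by (auto simp: carrier_mpoly)
qed

lemma mpoly_carrier_0: "0 \<in> carrier (mpoly_ring V)"
  by (simp add: carrier_mpoly)

lemma mpoly_carrier_sum:
  "(\<And>i. i \<in> A \<Longrightarrow> f i \<in> carrier (mpoly_ring V)) \<Longrightarrow>
    (\<Sum>i\<in>A. f i :: ('v, 'k::field) mpoly) \<in> carrier (mpoly_ring V)"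
  by (induction A rule: infinite_finite_induct)
    (auto intro!: mpoly_carrier_closed(1) mpoly_carrier_0)

lemma mpoly_carrier_single: "m \<in> mons V \<Longrightarrow> single m c \<in> carrier (mpoly_ring V)"
  by (cases "c = 0") (auto simp: carrier_mpoly)

lemma mpoly_carrier_mon: "m \<in> mons V \<Longrightarrow> mpoly_of_mon m \<in> carrier (mpoly_ring V)"
  by (simp add: mpoly_of_mon_def mpoly_carrier_single)

lemma mpoly_carrier_var: "v \<in> V \<Longrightarrow> var v \<in> carrier (mpoly_ring V)"
  by (simp add: var_def mpoly_carrier_mon mons_single)

lemma keys_mpoly_of_mon [simp]: "keys (mpoly_of_mon m :: ('v, 'k::field) mpoly) = {m}"
  by (simp add: mpoly_of_mon_def)

lemma mpoly_of_mon_add: "mpoly_of_mon (a + b) = mpoly_of_mon a * mpoly_of_mon b"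
  by (simp add: mpoly_of_mon_def mult_single)

lemma mpoly_of_mon_0: "mpoly_of_mon 0 = 1"
  by (simp add: mpoly_of_mon_def)

lemma sum_single_keys:
  "p = (\<Sum>m\<in>keys p. single m (lookup p m))"
  by (rule poly_mapping_eqI) (auto simp: lookup_sum lookup_single when_def in_keys_iff)

lemma ideal_mpolyD:
  fixes I :: "('v, 'k::field) mpoly set"
  assumes "ideal I (mpoly_ring V)"
  shows "0 \<in> I" "p \<in> I \<Longrightarrow> q \<in> I \<Longrightarrow> p + q \<in> I"
    "r \<in> carrier (mpoly_ring V) \<Longrightarrow> p \<in> I \<Longrightarrow> r * p \<in> I"
  using additive_subgroup.zero_closed[OF ideal.axioms(1)[OF assms]]
    additive_subgroup.a_closed[OF ideal.axioms(1)[OF assms]] ideal.I_l_closed[OF assms]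
  by simp_all

lemma ideal_sum:
  assumes "ideal I (mpoly_ring V :: ('v, 'k::field) mpoly ring)" "\<And>a. a \<in> A \<Longrightarrow> f a \<in> I"
  shows "sum f A \<in> I"
  using assms(2)
  by (induction A rule: infinite_finite_induct) (auto intro: ideal_mpolyD[OF assms(1)])

lemma ideal_mpolyI:
  fixes I :: "('v, 'k::field) mpoly set"
  assumes "I \<subseteq> carrier (mpoly_ring V)" "0 \<in> I" "\<And>p q. p \<in> I \<Longrightarrow> q \<in> I \<Longrightarrow> p + q \<in> I"
    "\<And>p q. p \<in> carrier (mpoly_ring V) \<Longrightarrow> q \<in> I \<Longrightarrow> p * q \<in> I"
  shows "ideal I (mpoly_ring V)"
proof -
  interpret ring "mpoly_ring V :: ('v, 'k) mpoly ring" by (rule mpoly_ring_ring)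
  show ?thesis
  proof (rule idealI)
    show "ring (mpoly_ring V :: ('v, 'k) mpoly ring)" by (rule mpoly_ring_ring)
    show "subgroup I (add_monoid (mpoly_ring V))"
    proof (rule add.subgroupI)
      fix p assume p: "p \<in> I"
      have pc: "p \<in> carrier (mpoly_ring V)" using p assms(1) by auto
      have "- 1 \<in> carrier (mpoly_ring V :: ('v, 'k) mpoly ring)"
        using one_closed mpoly_carrier_closed(3)[of 1 V] by simp
      from assms(4)[OF this p] have "- p \<in> I" by simp
      moreover have "\<ominus>\<^bsub>mpoly_ring V\<^esub> p = - p"
        by (rule minus_equality) (use pc mpoly_carrier_closed(3) in auto)
      ultimately show "\<ominus>\<^bsub>mpoly_ring V\<^esub> p \<in> I" by simp
    qed (use assms in auto)
  next
    fix a x :: "('v, 'k) mpoly" assume "a \<in> I" "x \<in> carrier (mpoly_ring V)"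
    then show "x \<otimes>\<^bsub>mpoly_ring V\<^esub> a \<in> I" "a \<otimes>\<^bsub>mpoly_ring V\<^esub> x \<in> I"
      using assms(4)[of x a] by (simp_all add: mult.commute)
  qed
qed

lemma keys_mult_mons: "m \<in> keys (p * q) \<Longrightarrow> \<exists>a\<in>keys p. \<exists>b\<in>keys q. m = a + b"
  using keys_mult[of p q] by blast

lemma mon_ideal_ideal: "ideal (mon_ideal V U :: ('v, 'k::field) mpoly set) (mpoly_ring V)"
proof (rule ideal_mpolyI)
  fix p q :: "('v, 'k) mpoly"
  assume "p \<in> carrier (mpoly_ring V)" "q \<in> mon_ideal V U"
  then show "p * q \<in> mon_ideal V U"
    by (fastforce simp: mon_ideal_def carrier_mpoly mons_add dest!: keys_mult_mons intro: multiples_add)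
next
  fix p q :: "('v, 'k) mpoly"
  assume "p \<in> mon_ideal V U" "q \<in> mon_ideal V U"
  then show "p + q \<in> mon_ideal V U"
    using Poly_Mapping.keys_add[of p q] by (auto simp: mon_ideal_def)
qed (auto simp: mon_ideal_def carrier_mpoly)

lemma mon_ideal_minimal:
  fixes I :: "('v, 'k::field) mpoly set"
  assumes "ideal I (mpoly_ring V)" "mpoly_of_mon ` U \<subseteq> I"
  shows "mon_ideal V U \<subseteq> I"
proof
  fix p :: "('v, 'k) mpoly" assume p: "p \<in> mon_ideal V U"
  have "(\<Sum>m\<in>keys p. single m (lookup p m)) \<in> I"
  proof (rule ideal_sum[OF assms(1)])
    fix m assume "m \<in> keys p"
    with p obtain u s where us: "u \<in> U" "m = s + u" "m \<in> mons V"
      by (fastforce simp: mon_ideal_def multiples_def)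
    then have "single s (lookup p m) \<in> carrier (mpoly_ring V)"
      by (intro mpoly_carrier_single) (simp add: mons_add_iff)
    from ideal_mpolyD(3)[OF assms(1) this] assms(2) us(1)
    have "single s (lookup p m) * mpoly_of_mon u \<in> I" by auto
    then show "single m (lookup p m) \<in> I"
      by (simp add: us(2) mpoly_of_mon_def mult_single)
  qed
  then show "p \<in> I" by (simp add: sum_single_keys[symmetric])
qed

lemma Idl_mon_ideal:
  assumes "U \<subseteq> mons V"
  shows "Idl\<^bsub>mpoly_ring V\<^esub> (mpoly_of_mon ` U) = (mon_ideal V U :: ('v, 'k::field) mpoly set)"
proof -
  interpret ring "mpoly_ring V :: ('v, 'k) mpoly ring" by (rule mpoly_ring_ring)
  have gens: "mpoly_of_mon ` U \<subseteq> (mon_ideal V U :: ('v, 'k) mpoly set)"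
    using assms subset_multiples[of U] by (auto simp: mon_ideal_def)
  show ?thesis
  proof
    show "Idl\<^bsub>mpoly_ring V\<^esub> (mpoly_of_mon ` U) \<subseteq> (mon_ideal V U :: ('v, 'k) mpoly set)"
      by (rule genideal_minimal[OF mon_ideal_ideal gens])
    show "(mon_ideal V U :: ('v, 'k) mpoly set) \<subseteq> Idl\<^bsub>mpoly_ring V\<^esub> (mpoly_of_mon ` U)"
      using assms mpoly_carrier_mon
      by (intro mon_ideal_minimal genideal_ideal genideal_self) blast+
  qed
qed

lemma mpoly_of_mon_in_mon_ideal:
  "(mpoly_of_mon m :: ('v, 'k::field) mpoly) \<in> mon_ideal V U \<longleftrightarrow> m \<in> mons V \<and> m \<in> multiples U"
  by (simp add: mon_ideal_def)

lemma mon_ideal_cong: "multiples U = multiples W \<Longrightarrow> mon_ideal V U = mon_ideal V W"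
  by (simp add: mon_ideal_def)

lemma mon_ideal_prod:
  assumes "U \<subseteq> mons V" "W \<subseteq> mons V"
  shows "ideal_prod (mpoly_ring V) (mon_ideal V U) (mon_ideal V W)
    = (mon_ideal V {a + b | a b. a \<in> U \<and> b \<in> W} :: ('v, 'k::field) mpoly set)"
proof
  let ?P = "mon_ideal V {a + b | a b. a \<in> U \<and> b \<in> W} :: ('v, 'k) mpoly set"
  interpret ring "mpoly_ring V :: ('v, 'k) mpoly ring" by (rule mpoly_ring_ring)
  show "ideal_prod (mpoly_ring V) (mon_ideal V U) (mon_ideal V W) \<subseteq> ?P"
  proof
    fix p :: "('v, 'k) mpoly"
    assume "p \<in> ideal_prod (mpoly_ring V) (mon_ideal V U) (mon_ideal V W)"
    then show "p \<in> ?P"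
    proof induction
      case (prod i j)
      show ?case unfolding mon_ideal_def
      proof safe
        fix m assume "m \<in> keys (i \<otimes>\<^bsub>mpoly_ring V\<^esub> j)"
        then obtain a b where ab: "m = a + b" "a \<in> keys i" "b \<in> keys j"
          using keys_mult_mons[of m i j] by auto
        with prod obtain s u t w where *: "a = s + u" "b = t + w" "u \<in> U" "w \<in> W"
          "a \<in> mons V" "b \<in> mons V"
          by (fastforce simp: mon_ideal_def multiples_def)
        then show "m \<in> mons V"
          using ab by (simp add: mons_add)
        have "(s + t) + (u + w) \<in> multiples {a + b | a b. a \<in> U \<and> b \<in> W}"
          using * by (intro multiples_I) blast
        then show "m \<in> multiples {a + b | a b. a \<in> U \<and> b \<in> W}"
          using ab * by (simp add: ac_simps)
      qed
    next
      case (sum s1 s2)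
      then show ?case using ideal_mpolyD(2)[OF mon_ideal_ideal] by simp
    qed
  qed
  show "?P \<subseteq> ideal_prod (mpoly_ring V) (mon_ideal V U) (mon_ideal V W)"
  proof (rule mon_ideal_minimal)
    show "ideal (ideal_prod (mpoly_ring V) (mon_ideal V U) (mon_ideal V W))
       (mpoly_ring V :: ('v, 'k) mpoly ring)"
      by (intro ideal_prod_is_ideal mon_ideal_ideal)
    have "mpoly_of_mon (a + b) \<in>
      ideal_prod (mpoly_ring V :: ('v, 'k) mpoly ring) (mon_ideal V U) (mon_ideal V W)"
      if "a \<in> U" "b \<in> W" for a b
    proof -
      have "mpoly_of_mon a \<in> (mon_ideal V U :: ('v, 'k) mpoly set)"
        "mpoly_of_mon b \<in> (mon_ideal V W :: ('v, 'k) mpoly set)"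
        using that assms subset_multiples by (auto simp: mpoly_of_mon_in_mon_ideal)
      from ideal_prod.prod[OF this, of "mpoly_ring V"] show ?thesis
        by (simp add: mpoly_of_mon_add)
    qed
    then show "mpoly_of_mon ` {a + b | a b. a \<in> U \<and> b \<in> W} \<subseteq>
      ideal_prod (mpoly_ring V :: ('v, 'k) mpoly ring) (mon_ideal V U) (mon_ideal V W)"
      by auto
  qed
qed

lemma mon_ideal_power:
  assumes "U \<subseteq> mons V"
  shows "(mon_ideal V U :: ('v, 'k::field) mpoly set) [^]\<^bsub>ideals_set (mpoly_ring V)\<^esub> k
    = mon_ideal V (sums_of U k)"
proof (induction k)
  case 0
  have "multiples {0 :: 'v mon} = UNIV"
    using multiples_I[of 0 "{0}"] by auto
  then show ?case
    by (auto simp: nat_pow_def ideals_set_def mon_ideal_def carrier_mpoly)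
next
  case (Suc k)
  have "(mon_ideal V U :: ('v, 'k) mpoly set) [^]\<^bsub>ideals_set (mpoly_ring V)\<^esub> Suc k
    = ideal_prod (mpoly_ring V) (mon_ideal V U [^]\<^bsub>ideals_set (mpoly_ring V)\<^esub> k) (mon_ideal V U)"
    by (simp add: nat_pow_def ideals_set_def)
  then show ?case
    by (simp add: Suc mon_ideal_prod sums_of_mons assms)
qed

text \<open>Multiplication by a monomial only shifts the support, so membership in a colon ideal by a
  monomial can be decided on the exponents.\<close>

lemma lookup_mult_mpoly_of_mon:
  fixes f :: "('v, 'k::field) mpoly"
  shows "lookup (f * mpoly_of_mon u) (m + u) = lookup f m"
proof -
  have "f * mpoly_of_mon u = (\<Sum>a\<in>keys f. single a (lookup f a)) * mpoly_of_mon u"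
    using sum_single_keys[of f] by simp
  also have "\<dots> = (\<Sum>a\<in>keys f. single (a + u) (lookup f a))"
    by (simp add: sum_distrib_right mpoly_of_mon_def mult_single)
  finally show ?thesis
    by (auto simp: lookup_sum lookup_single when_def in_keys_iff)
qed

lemma keys_mult_mpoly_of_mon:
  fixes f :: "('v, 'k::field) mpoly"
  shows "keys (f * mpoly_of_mon u) = (\<lambda>m. m + u) ` keys f"
proof safe
  fix m assume "m \<in> keys (f * mpoly_of_mon u)"
  then show "m \<in> (\<lambda>m. m + u) ` keys f"
    by (auto dest!: keys_mult_mons)
qed (simp add: in_keys_iff lookup_mult_mpoly_of_mon)

lemma colon_mon_ideal:
  assumes "u \<in> mons V"
  shows "colon_ideal V (mon_ideal V U) (mpoly_of_mon u :: ('v, 'k::field) mpoly)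
    = {f. \<forall>m\<in>keys f. m \<in> mons V \<and> m + u \<in> multiples U}"
  using assms
  by (auto simp: colon_ideal_def mon_ideal_def carrier_mpoly keys_mult_mpoly_of_mon mons_add)

lemma mon_ideal_of_vars:
  "mon_ideal V ((\<lambda>z. single z 1) ` Q) = {f. \<forall>m\<in>keys f. m \<in> mons V \<and> keys m \<inter> Q \<noteq> {}}"
proof -
  have "m \<in> multiples ((\<lambda>z. single z 1) ` Q) \<longleftrightarrow> keys m \<inter> Q \<noteq> {}" for m
  proof
    assume "m \<in> multiples ((\<lambda>z. single z 1) ` Q)"
    then show "keys m \<inter> Q \<noteq> {}" by (auto simp: multiples_def keys_add_mon)
  next
    assume "keys m \<inter> Q \<noteq> {}"
    then obtain z where z: "z \<in> keys m" "z \<in> Q" by auto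
    have "(m - single z 1) + single z 1 \<in> multiples ((\<lambda>z. single z 1) ` Q)"
      using z(2) by (intro multiples_I) auto
    then show "m \<in> multiples ((\<lambda>z. single z 1) ` Q)"
      using single_split[OF z(1)] by (simp add: add.commute)
  qed
  then show ?thesis by (auto simp: mon_ideal_def)
qed

lemma Idl_vars:
  assumes "Q \<subseteq> V"
  shows "Idl\<^bsub>mpoly_ring V\<^esub> (var ` Q)
    = {f :: ('v, 'k::field) mpoly. \<forall>m\<in>keys f. m \<in> mons V \<and> keys m \<inter> Q \<noteq> {}}"
proof -
  have "(var ` Q :: ('v, 'k) mpoly set) = mpoly_of_mon ` (\<lambda>z. single z 1) ` Q"
    by (auto simp: var_def image_image)
  moreover have "(\<lambda>z. single z (1::nat)) ` Q \<subseteq> mons V"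
    using assms by (auto simp: mons_def)
  ultimately show ?thesis
    using mon_ideal_of_vars[of V Q] by (simp add: Idl_mon_ideal)
qed

section \<open>Linear quotients from decompositions\<close>

text \<open>
  The pieces \<open>u i\<close> $K[V \setminus Q_i]$ are disjoint (last conjunct), and the other
  multiples of \<open>u i\<close> can be rewritten to generators of smaller rank. The index set is kept
  apart from the monomials because the natural indices are products of covers. In the rewriting
  rule, \<open>g \<noteq> 0\<close> prevents the degree of the generator from growing.
\<close>

definition lq_system ::
    "'v set \<Rightarrow> 'i set \<Rightarrow> ('i \<Rightarrow> 'v mon) \<Rightarrow> ('i \<Rightarrow> 'v set) \<Rightarrow> ('i \<Rightarrow> 'r::wellorder) \<Rightarrow> bool" where
  "lq_system V N u Q \<rho> \<longleftrightarrow>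
     finite N \<and> (\<forall>i\<in>N. u i \<in> mons V \<and> Q i \<subseteq> V) \<and>
     (\<forall>i\<in>N. \<forall>z\<in>Q i. \<exists>j\<in>N. \<exists>g. g \<noteq> 0 \<and> single z 1 + u i = g + u j \<and> \<rho> j < \<rho> i) \<and>
     (\<forall>i\<in>N. \<forall>j\<in>N. \<forall>f h. f + u i = h + u j \<and> keys f \<inter> Q i = {} \<and> keys h \<inter> Q j = {} \<longrightarrow> i = j)"

lemma lq_systemD:
  assumes "lq_system V N u Q \<rho>"
  shows "finite N" "i \<in> N \<Longrightarrow> u i \<in> mons V" "i \<in> N \<Longrightarrow> Q i \<subseteq> V"
    "i \<in> N \<Longrightarrow> j \<in> N \<Longrightarrow> f + u i = h + u j \<Longrightarrow> keys f \<inter> Q i = {} \<Longrightarrow> keys h \<inter> Q j = {} \<Longrightarrow> i = j"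
  using assms unfolding lq_system_def by blast+

lemma lq_system_move:
  assumes "lq_system V N u Q \<rho>" "i \<in> N" "z \<in> Q i"
  obtains j g where "j \<in> N" "g \<noteq> 0" "single z 1 + u i = g + u j" "\<rho> j < \<rho> i" "mdeg (u j) \<le> mdeg (u i)"
proof -
  obtain j g where *: "j \<in> N" "g \<noteq> 0" "single z 1 + u i = g + u j" "\<rho> j < \<rho> i"
    using assms unfolding lq_system_def by blast
  have "1 + mdeg (u i) = mdeg g + mdeg (u j)"
    using arg_cong[OF *(3), of mdeg] by (simp add: mdeg_add)
  moreover have "mdeg g \<noteq> 0" using *(2) by (simp add: mdeg_eq_0_iff)
  ultimately show thesis using * by (intro that[of j g]) auto
qed

text \<open>Rewriting terminates because the rank drops; together the pieces exhaust the ideal.\<close>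

lemma lq_system_piece:
  assumes "lq_system V N u Q \<rho>" "i \<in> N"
  shows "\<exists>j\<in>N. \<exists>h. f + u i = h + u j \<and> keys h \<inter> Q j = {} \<and>
    (j = i \<or> mdeg (u j) \<le> mdeg (u i) \<and> \<rho> j < \<rho> i)"
  using assms(2)
proof (induction "\<rho> i" arbitrary: i f rule: less_induct)
  case less
  show ?case
  proof (cases "keys f \<inter> Q i = {}")
    case False
    then obtain z where z: "z \<in> keys f" "z \<in> Q i" by auto
    obtain j g where j: "j \<in> N" "single z 1 + u i = g + u j" "\<rho> j < \<rho> i" "mdeg (u j) \<le> mdeg (u i)"
      using lq_system_move[OF assms(1) less.prems z(2)] by metis
    have "f + u i = (f - single z 1) + (single z 1 + u i)"
      using single_split[OF z(1)] by (metis add.assoc add.commute)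
    also have "\<dots> = (f - single z 1 + g) + u j"
      by (simp only: j(2) add.assoc)
    finally have eq: "f + u i = (f - single z 1 + g) + u j" .
    obtain l h where "l \<in> N" "(f - single z 1 + g) + u j = h + u l" "keys h \<inter> Q l = {}"
      "l = j \<or> mdeg (u l) \<le> mdeg (u j) \<and> \<rho> l < \<rho> j"
      using less.hyps[OF j(3,1), of "f - single z 1 + g"] by blast
    then show ?thesis using eq j by (intro bexI[of _ l] exI[of _ h]) auto
  qed (use less.prems in blast)
qed

text \<open>A proper multiple of a generator is rewritten into the piece of a generator of smaller
  degree than itself, whereas a generator lies in its own piece.\<close>

lemma lq_system_antichain:
  assumes lq: "lq_system V N u Q \<rho>" and "i \<in> N" "j \<in> N" "u i = s + u j"
  shows "i = j"
proof -
  obtain l h where l: "l \<in> N" "s + u j = h + u l" "keys h \<inter> Q l = {}"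
    "l = j \<or> mdeg (u l) \<le> mdeg (u j) \<and> \<rho> l < \<rho> j"
    using lq_system_piece[OF lq assms(3), of s] by blast
  have "i = l"
    using lq_systemD(4)[OF lq assms(2) l(1), of 0 h] l(2,3) assms(4) by simp
  then have "mdeg s + mdeg (u j) = mdeg (u l)"
    using assms(4) by (metis mdeg_add)
  with l(4) have "l = j \<or> mdeg s = 0" by auto
  then show ?thesis
  proof
    assume "mdeg s = 0"
    then have "u i = u j" using assms(4) by (simp add: mdeg_eq_0_iff)
    then show ?thesis using lq_systemD(4)[OF lq assms(2,3), of 0 0] by simp
  qed (use \<open>i = l\<close> in simp)
qed

lemma lq_system_inj: "lq_system V N u Q \<rho> \<Longrightarrow> inj_on u N"
  by (rule inj_onI) (metis lq_system_antichain add_0)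

text \<open>Disjointness needs to be checked only for cofactors in the variables $V$: the generators
  do not involve other variables, so these can be deleted from an equation between multiples.\<close>

lemma lq_systemI:
  assumes "finite N" "\<And>i. i \<in> N \<Longrightarrow> u i \<in> mons V" "\<And>i. i \<in> N \<Longrightarrow> Q i \<subseteq> V"
    and move: "\<And>i z. i \<in> N \<Longrightarrow> z \<in> Q i \<Longrightarrow>
      \<exists>j\<in>N. \<exists>g. g \<noteq> 0 \<and> single z 1 + u i = g + u j \<and> \<rho> j < \<rho> i"
    and uniq: "\<And>i j f h. i \<in> N \<Longrightarrow> j \<in> N \<Longrightarrow> f \<in> mons V \<Longrightarrow> h \<in> mons V \<Longrightarrow> f + u i = h + u j \<Longrightarrow>
      keys f \<inter> Q i = {} \<Longrightarrow> keys h \<inter> Q j = {} \<Longrightarrow> i = j"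
  shows "lq_system V N u Q \<rho>"
  unfolding lq_system_def
proof (intro conjI ballI allI impI)
  fix i j f h
  assume ij: "i \<in> N" "j \<in> N" and *: "f + u i = h + u j \<and> keys f \<inter> Q i = {} \<and> keys h \<inter> Q j = {}"
  have 0: "lookup (u i) v = 0" "lookup (u j) v = 0" if "v \<notin> V" for v
  proof -
    have "v \<notin> keys (u i)" "v \<notin> keys (u j)"
      using assms(2)[OF ij(1)] assms(2)[OF ij(2)] that by (auto simp: mons_def)
    then show "lookup (u i) v = 0" "lookup (u j) v = 0" by (simp_all add: in_keys_iff)
  qed
  have "lookup f v + lookup (u i) v = lookup h v + lookup (u j) v" for v
    using arg_cong[OF conjunct1[OF *], of "\<lambda>m. lookup m v"] by (simp add: lookup_add)
  then have "restrict_mon V f + u i = restrict_mon V h + u j"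
    using 0 by (intro poly_mapping_eqI) (auto simp: lookup_add lookup_restrict_mon)
  then show "i = j"
    using * by (intro uniq[OF ij, of "restrict_mon V f" "restrict_mon V h"])
      (auto simp: mons_def keys_restrict_mon)
qed (use assms in auto)

lemma lq_system_reindex:
  assumes lq: "lq_system V N u Q \<rho>"
  shows "lq_system V (u ` N) (\<lambda>m. m) (Q \<circ> inv_into N u) (\<rho> \<circ> inv_into N u)"
proof -
  have inv: "inv_into N u (u i) = i" if "i \<in> N" for i
    using lq_system_inj[OF lq] that by simp
  show ?thesis
  proof (rule lq_systemI)
    fix m z assume "m \<in> u ` N" "z \<in> (Q \<circ> inv_into N u) m"
    then obtain i where i: "i \<in> N" "m = u i" "z \<in> Q i" using inv by auto
    then obtain j g where "j \<in> N" "g \<noteq> 0" "single z 1 + u i = g + u j" "\<rho> j < \<rho> i"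
      using lq_system_move[OF lq] by metis
    with i show "\<exists>m'\<in>u ` N. \<exists>g. g \<noteq> 0 \<and> single z 1 + m = g + m' \<and>
        (\<rho> \<circ> inv_into N u) m' < (\<rho> \<circ> inv_into N u) m"
      by (intro bexI[of _ "u j"] exI[of _ g]) (auto simp: inv)
  next
    fix m m' f h
    assume "m \<in> u ` N" "m' \<in> u ` N" "f + m = h + m'" "keys f \<inter> (Q \<circ> inv_into N u) m = {}"
      "keys h \<inter> (Q \<circ> inv_into N u) m' = {}"
    then show "m = m'"
      using lq_systemD(4)[OF lq, of "inv_into N u m" "inv_into N u m'" f h] inv by auto
  next
    fix m assume "m \<in> u ` N"
    then obtain i where i: "i \<in> N" "m = u i" by auto
    then show "m \<in> mons V" "(Q \<circ> inv_into N u) m \<subseteq> V"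
      using lq_systemD(2,3)[OF lq i(1)] by (simp_all add: inv)
  qed (use lq_systemD(1)[OF lq] in simp)
qed

text \<open>Rewriting never leads to a generator of larger degree, so the linear quotients can be arranged
  with nondecreasing degrees.\<close>

definition lq_list :: "'i set \<Rightarrow> ('i \<Rightarrow> 'v mon) \<Rightarrow> ('i \<Rightarrow> 'r::wellorder) \<Rightarrow> 'i list \<Rightarrow> bool" where
  "lq_list N u \<rho> xs \<longleftrightarrow> distinct xs \<and> set xs = N \<and> sorted (map (\<lambda>i. (mdeg (u i), \<rho> i)) xs)"

lemma lq_list_exists: "finite N \<Longrightarrow> \<exists>xs. lq_list N u \<rho> xs"
proof -
  assume "finite N"
  then obtain xs where "set xs = N" "distinct xs" using finite_distinct_list by blast
  then show ?thesis unfolding lq_list_def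
    by (intro exI[of _ "sort_key (\<lambda>i. (mdeg (u i), \<rho> i)) xs"]) simp
qed

text \<open>
  If \<open>f\<close> avoids the variables of its piece, then \<open>f + u (xs ! j)\<close> lies in piece $j$.
  Being a multiple of an earlier generator, it would also be rewritten into the piece of an earlier
  generator, against disjointness. Conversely, the rewriting rules lead to earlier generators.
\<close>

lemma lq_list_colon:
  assumes lq: "lq_system V N u Q \<rho>" and xs: "lq_list N u \<rho> xs" and j: "j < length xs"
  shows "f + u (xs ! j) \<in> multiples (u ` set (take j xs)) \<longleftrightarrow> keys f \<inter> Q (xs ! j) \<noteq> {}"
proof -
  let ?key = "\<lambda>i. (mdeg (u i), \<rho> i)"
  have N: "\<And>l. l < length xs \<Longrightarrow> xs ! l \<in> N" using xs by (auto simp: lq_list_def)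
  have mono: "?key (xs ! l) \<le> ?key (xs ! l')" if "l \<le> l'" "l' < length xs" for l l'
    using xs that sorted_nth_mono[of "map ?key xs" l l'] by (simp add: lq_list_def)
  have take: "set (take j xs) = {xs ! l | l. l < j}"
    unfolding nth_image[OF less_imp_le[OF j], symmetric] by auto
  show ?thesis
  proof
    assume "f + u (xs ! j) \<in> multiples (u ` set (take j xs))"
    then obtain l s where l: "l < j" "f + u (xs ! j) = s + u (xs ! l)"
      by (auto simp: multiples_def take)
    have lN: "xs ! l \<in> N" using l j N by simp
    obtain i h where i: "i \<in> N" "s + u (xs ! l) = h + u i" "keys h \<inter> Q i = {}"
      "i = xs ! l \<or> mdeg (u i) \<le> mdeg (u (xs ! l)) \<and> \<rho> i < \<rho> (xs ! l)"
      using lq_system_piece[OF lq lN, of s] by blast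
    show "keys f \<inter> Q (xs ! j) \<noteq> {}"
    proof
      assume "keys f \<inter> Q (xs ! j) = {}"
      then have ij: "xs ! j = i"
        using lq_systemD(4)[OF lq N[OF j] i(1), of f h] l i by simp
      moreover have "xs ! j \<noteq> xs ! l"
        using xs l(1) j by (simp add: lq_list_def nth_eq_iff_index_eq)
      ultimately have "?key (xs ! j) < ?key (xs ! l)"
        using i(4) by (auto simp: less_prod_def)
      moreover have "?key (xs ! l) \<le> ?key (xs ! j)" using mono[of l j] l(1) j by simp
      ultimately show False by (meson leD)
    qed
  next
    assume "keys f \<inter> Q (xs ! j) \<noteq> {}"
    then obtain z where z: "z \<in> keys f" "z \<in> Q (xs ! j)" by auto
    obtain i g where i: "i \<in> N" "single z 1 + u (xs ! j) = g + u i" "\<rho> i < \<rho> (xs ! j)"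
      "mdeg (u i) \<le> mdeg (u (xs ! j))"
      using lq_system_move[OF lq N[OF j] z(2)] by metis
    obtain l where l: "l < length xs" "i = xs ! l"
      using i(1) xs by (auto simp: lq_list_def in_set_conv_nth)
    have "?key i < ?key (xs ! j)" using i(3,4) by (auto simp: less_prod_def)
    then have "l < j" using mono[of j l] l by (meson leD leI)
    have "f + u (xs ! j) = (f - single z 1) + (single z 1 + u (xs ! j))"
      using single_split[OF z(1)] by (metis add.assoc add.commute)
    also have "\<dots> = (f - single z 1 + g) + u (xs ! l)"
      by (simp only: i(2) l(2) add.assoc)
    finally show "f + u (xs ! j) \<in> multiples (u ` set (take j xs))"
      using \<open>l < j\<close> by (auto simp: take intro!: multiples_I)
  qed
qed

lemma homogeneous_var: "homogeneous 1 (var v)"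
  by (simp add: homogeneous_def var_def)

theorem lq_system_linear_quotients:
  assumes lq: "lq_system V N u Q \<rho>"
  shows "has_linear_quotients V (mon_ideal V (u ` N) :: ('v, 'k::field) mpoly set)"
proof -
  obtain xs where xs: "lq_list N u \<rho> xs"
    using lq_list_exists lq_systemD(1)[OF lq] by blast
  have set_xs: "set xs = N" using xs by (simp add: lq_list_def)
  have mons: "u ` N \<subseteq> mons V" using lq_systemD(2)[OF lq] by auto
  have "is_min_mon_gens V (mon_ideal V (u ` N) :: ('v, 'k) mpoly set) (u ` N)"
    unfolding is_min_mon_gens_def
  proof (intro conjI allI impI)
    fix M assume M: "M \<subset> u ` N"
    then obtain i where i: "i \<in> N" "u i \<notin> M" by auto
    have Mm: "M \<subseteq> mons V" using M mons by auto
    have "u i \<notin> multiples M"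
    proof
      assume "u i \<in> multiples M"
      then obtain s w where "w \<in> M" "u i = s + w"
        by (auto simp: multiples_def)
      moreover from this M obtain j where "j \<in> N" "w = u j" by blast
      ultimately have "j \<in> N" "u j \<in> M" "u i = s + u j" by auto
      with lq_system_antichain[OF lq i(1)] i(2) show False by blast
    qed
    then have "(mpoly_of_mon (u i) :: ('v, 'k) mpoly) \<notin> mon_ideal V M"
      by (simp add: mpoly_of_mon_in_mon_ideal)
    moreover have "(mpoly_of_mon (u i) :: ('v, 'k) mpoly) \<in> mon_ideal V (u ` N)"
      using i mons subset_multiples[of "u ` N"] by (auto simp: mpoly_of_mon_in_mon_ideal)
    ultimately show "(mon_ideal V (u ` N) :: ('v, 'k) mpoly set)
        \<noteq> Idl\<^bsub>mpoly_ring V\<^esub> (mpoly_of_mon ` M)"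
      using Idl_mon_ideal[OF Mm] by metis
  qed (use mons Idl_mon_ideal[OF mons] in auto)
  moreover have "\<exists>L \<subseteq> {l :: ('v, 'k) mpoly. l \<in> carrier (mpoly_ring V) \<and> homogeneous 1 l}.
      colon_ideal V (Idl\<^bsub>mpoly_ring V\<^esub> (mpoly_of_mon ` set (take j (map u xs))))
        (mpoly_of_mon (map u xs ! j)) = Idl\<^bsub>mpoly_ring V\<^esub> L" if j: "j < length (map u xs)" for j
  proof (intro exI[of _ "var ` Q (xs ! j)"] conjI)
    have jN: "xs ! j \<in> N" using j set_xs by auto
    note QV = lq_systemD(3)[OF lq jN]
    show "var ` Q (xs ! j) \<subseteq> {l :: ('v, 'k) mpoly. l \<in> carrier (mpoly_ring V) \<and> homogeneous 1 l}"
      by (intro image_subsetI CollectI conjI homogeneous_var mpoly_carrier_var subsetD[OF QV])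
    have take: "set (take j (map u xs)) = u ` set (take j xs)"
      by (simp add: take_map)
    have sub: "u ` set (take j xs) \<subseteq> mons V"
      using mons set_xs set_take_subset[of j xs] by auto
    show "colon_ideal V (Idl\<^bsub>mpoly_ring V\<^esub> (mpoly_of_mon ` set (take j (map u xs))))
        (mpoly_of_mon (map u xs ! j)) = (Idl\<^bsub>mpoly_ring V\<^esub> (var ` Q (xs ! j)) :: ('v, 'k) mpoly set)"
      using j lq_list_colon[OF lq xs, of j] lq_systemD(2)[OF lq jN]
      by (simp add: take Idl_mon_ideal[OF sub] colon_mon_ideal Idl_vars[OF QV])
  qed
  ultimately show ?thesis
    unfolding has_linear_quotients_def
    using xs set_xs lq_system_inj[OF lq]
    by (intro exI[of _ "map u xs"]) (auto simp: lq_list_def distinct_map)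
qed


section \<open>Graded components\<close>

text \<open>The rank for the monomials of one degree: the weight drops when a variable is replaced by one
  of smaller index.\<close>

definition weight :: "('v \<Rightarrow> nat) \<Rightarrow> 'v mon \<Rightarrow> nat" where
  "weight idx m = (\<Sum>v\<in>keys m. lookup m v * idx v)"

lemma weight_add: "weight idx (a + b) = weight idx a + weight idx b"
proof -
  have sup: "weight idx m = (\<Sum>v\<in>X. lookup m v * idx v)" if "finite X" "keys m \<subseteq> X" for X m
    unfolding weight_def using that by (intro sum.mono_neutral_left) (auto simp: in_keys_iff)
  let ?X = "keys a \<union> keys b"
  show ?thesis
    by (simp add: sup[of ?X] keys_add_mon lookup_add add_mult_distrib sum.distrib)
qed

lemma weight_single: "weight idx (single v 1) = idx v"
  by (simp add: weight_def)

text \<open>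
  The monomials of degree $d$ decompose the monomials of degree at least $d$: \<open>f\<close> consists of
  the $d$ variables of smallest index in \<open>h + f\<close>, and is therefore determined by the product.
\<close>

lemma prefix_monomial_unique:
  fixes f f' h h' :: "'v mon"
  assumes eq: "h + f = h' + f'" and deg: "mdeg f = mdeg f'"
    and inj: "inj_on idx V" and V: "f \<in> mons V" "f' \<in> mons V"
    and h: "\<And>z v. z \<in> keys h \<Longrightarrow> z \<in> V \<Longrightarrow> v \<in> keys f \<Longrightarrow> idx v \<le> (idx z :: nat)"
    and h': "\<And>z v. z \<in> keys h' \<Longrightarrow> z \<in> V \<Longrightarrow> v \<in> keys f' \<Longrightarrow> idx v \<le> idx z"
  shows "f = f'"
proof (rule ccontr)
  assume ne: "f \<noteq> f'"
  have lk: "lookup h v + lookup f v = lookup h' v + lookup f' v" for v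
    using arg_cong[OF eq, of "\<lambda>m. lookup m v"] by (simp add: lookup_add)
  have ex: "\<exists>v. lookup b v < lookup a v" if "mdeg a = mdeg b" "a \<noteq> b" for a b :: "'v mon"
  proof (rule ccontr)
    assume "\<nexists>v. lookup b v < lookup a v"
    then have "a + (b - a) = b" by (intro add_diff_mon) (auto simp: not_less)
    then have "mdeg a + mdeg (b - a) = mdeg b" by (metis mdeg_add)
    then have "b - a = 0" using that by (simp add: mdeg_eq_0_iff)
    with \<open>a + (b - a) = b\<close> that show False by simp
  qed
  obtain v where v: "lookup f' v < lookup f v" using ex[OF deg ne] by auto
  obtain w where w: "lookup f w < lookup f' w" using ex[of f' f] deg ne by auto
  have k: "v \<in> keys f" "w \<in> keys f'" "v \<in> keys h'" "w \<in> keys h"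
    using v w lk[of v] lk[of w] by (auto simp: in_keys_iff)
  then have "v \<in> V" "w \<in> V" using V by (auto simp: mons_def)
  with k have "idx v = idx w" "v \<in> V" "w \<in> V"
    using h[of w v] h'[of v w] by auto
  then have "v = w" using inj by (auto simp: inj_on_def)
  with v w show False by simp
qed

text \<open>
  A monomial $m$ of degree $d$ lies in a unique piece, $m = f u_i$. Besides $Q_i$, its new set
  contains the variables that precede some variable $v$ of $f$. Multiplying by such a variable $z$
  allows $v$ to be traded for $z$ inside the piece, which lowers the weight. Multiplying by
  $z \in Q_i$ leads to a piece of smaller rank, and there is room to cancel a variable, because
  the generators do not gain degree.
\<close>

theorem lq_system_component:
  fixes \<rho> :: "'i \<Rightarrow> 'r::wellorder"
  assumes lq: "lq_system V N u Q \<rho>" and V: "finite V"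
  shows "\<exists>Q' (\<rho>' :: 'v mon \<Rightarrow> 'r \<times> nat).
    lq_system V {m \<in> mons V \<inter> multiples (u ` N). mdeg m = d} (\<lambda>m. m) Q' \<rho>'"
proof -
  obtain idx :: "'v \<Rightarrow> nat" where inj: "inj_on idx V"
    using finite_imp_inj_to_nat_seg[OF V] by blast
  let ?M = "{m \<in> mons V \<inter> multiples (u ` N). mdeg m = d}"
  define is_piece where "is_piece m i f \<longleftrightarrow> i \<in> N \<and> m = f + u i \<and> keys f \<inter> Q i = {}" for m i f
  define I where "I m = (SOME i. \<exists>f. is_piece m i f)" for m
  define F where "F m = (SOME f. is_piece m (I m) f)" for m
  have pieceD: "I m = i \<and> F m = f" if "is_piece m i f" for m i f
  proof -
    have "\<exists>f. is_piece m (I m) f" unfolding I_def using that by (intro someI[of "\<lambda>i. \<exists>f. is_piece m i f"]) blast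
    then have p: "is_piece m (I m) (F m)" unfolding F_def by (rule someI_ex)
    then have "I m = i"
      using that lq_systemD(4)[OF lq, of "I m" i "F m" f] by (auto simp: is_piece_def)
    with p that show ?thesis by (auto simp: is_piece_def)
  qed
  have piece: "is_piece m (I m) (F m)" if "m \<in> ?M" for m
  proof -
    obtain i s where "i \<in> N" "m = s + u i" using \<open>m \<in> ?M\<close> by (auto simp: multiples_def)
    then obtain j h where "is_piece m j h"
      using lq_system_piece[OF lq, of i s] by (auto simp: is_piece_def)
    with pieceD[OF this] show ?thesis by simp
  qed
  define Q' where "Q' m = Q (I m) \<union> {z \<in> V. \<exists>v\<in>keys (F m). idx z < idx v}" for m
  define \<rho>' where "\<rho>' m = (\<rho> (I m), weight idx (F m))" for m
  have "lq_system V ?M (\<lambda>m. m) Q' \<rho>'"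
    unfolding lq_system_def
  proof (intro conjI ballI allI impI)
    show "finite ?M" by (rule finite_subset[OF _ finite_mons_of_mdeg[OF V, of d]]) auto
  next
    fix m assume m: "m \<in> ?M"
    then show "m \<in> mons V" by simp
    have "I m \<in> N" using piece[OF m] by (simp add: is_piece_def)
    then show "Q' m \<subseteq> V" using lq_systemD(3)[OF lq] by (auto simp: Q'_def)
  next
    fix m z assume m: "m \<in> ?M" and z: "z \<in> Q' m"
    have p: "I m \<in> N" "m = F m + u (I m)" "keys (F m) \<inter> Q (I m) = {}"
      using piece[OF m] by (auto simp: is_piece_def)
    have zV: "z \<in> V" using z lq_systemD(3)[OF lq p(1)] by (auto simp: Q'_def)
    have deg_m: "mdeg (F m) + mdeg (u (I m)) = d" using m p(2) by (metis (mono_tags, lifting) mdeg_add mem_Collect_eq)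
    have goal: "\<exists>j\<in>?M. \<exists>g. g \<noteq> 0 \<and> single z 1 + m = g + j \<and> \<rho>' j < \<rho>' m"
      if "is_piece m' i f" "single z 1 + m = single v 1 + m'" "(\<rho> i, weight idx f) < \<rho>' m"
      for m' i f v
    proof (intro bexI[of _ m'] exI[of _ "single v 1"] conjI)
      show "\<rho>' m' < \<rho>' m" using that(3) pieceD[OF that(1)] by (simp add: \<rho>'_def)
      have "mdeg m' = mdeg m" using arg_cong[OF that(2), of mdeg] by (simp add: mdeg_add)
      moreover have "single z 1 + m \<in> mons V" using zV m by (simp add: mons_add mons_single)
      then have "m' \<in> mons V" unfolding that(2) mons_add_iff by simp
      ultimately show "m' \<in> ?M"
        using m that(1) by (auto simp: is_piece_def intro!: multiples_I)
      show "single v (1::nat) \<noteq> 0" by (simp flip: mdeg_eq_0_iff)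
    qed (use that in simp)
    show "\<exists>j\<in>?M. \<exists>g. g \<noteq> 0 \<and> single z 1 + m = g + j \<and> \<rho>' j < \<rho>' m"
    proof (cases "z \<in> Q (I m)")
      case True
      obtain j g where j: "j \<in> N" "single z 1 + u (I m) = g + u j" "\<rho> j < \<rho> (I m)"
        "mdeg (u j) \<le> mdeg (u (I m))"
        using lq_system_move[OF lq p(1) True] by metis
      obtain l h where l: "l \<in> N" "(F m + g) + u j = h + u l" "keys h \<inter> Q l = {}"
        "l = j \<or> mdeg (u l) \<le> mdeg (u j) \<and> \<rho> l < \<rho> j"
        using lq_system_piece[OF lq j(1), of "F m + g"] by blast
      have "single z 1 + m = F m + (single z 1 + u (I m))"
        using p(2) by (metis add.left_commute)
      also have "\<dots> = h + u l" by (simp only: j(2) l(2)[symmetric] add.assoc)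
      finally have eq: "single z 1 + m = h + u l" .
      have "mdeg h + mdeg (u l) = Suc d"
        using arg_cong[OF eq, of mdeg] m by (simp add: mdeg_add)
      moreover have "mdeg (u l) \<le> d" using l(4) j(4) deg_m by auto
      ultimately have "mdeg h \<noteq> 0" by auto
      then obtain v where v: "v \<in> keys h" by (metis ex_in_conv keys_eq_empty mdeg_eq_0_iff)
      show ?thesis
      proof (rule goal)
        show "is_piece ((h - single v 1) + u l) l (h - single v 1)"
          using l(1,3) single_split[OF v] keys_add_mon[of "single v 1" "h - single v 1"]
          by (auto simp: is_piece_def)
        show "single z 1 + m = single v 1 + (h - single v 1 + u l)"
          using eq single_split[OF v] by (simp add: add.assoc[symmetric])
        show "(\<rho> l, weight idx (h - single v 1)) < \<rho>' m"
          using l(4) j(3) by (auto simp: \<rho>'_def less_prod_def)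
      qed
    next
      case False
      then obtain v where v: "v \<in> keys (F m)" "idx z < idx v" using z by (auto simp: Q'_def)
      let ?f = "single z 1 + (F m - single v 1)"
      show ?thesis
      proof (rule goal)
        show "is_piece (?f + u (I m)) (I m) ?f"
          using p False single_split[OF v(1)] keys_add_mon[of "single v 1" "F m - single v 1"]
          by (auto simp: is_piece_def keys_add_mon)
        have "single z 1 + m = single z 1 + (single v 1 + (F m - single v 1)) + u (I m)"
          using p(2) single_split[OF v(1)] by (simp add: add.assoc)
        then show "single z 1 + m = single v 1 + (?f + u (I m))"
          by (simp add: ac_simps)
        have "weight idx (F m) = idx v + weight idx (F m - single v 1)"
          using single_split[OF v(1)] by (metis weight_add weight_single)
        then have "weight idx ?f < weight idx (F m)"
          using v(2) by (simp only: weight_add weight_single)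
        then show "(\<rho> (I m), weight idx ?f) < \<rho>' m"
          by (simp add: \<rho>'_def less_prod_def)
      qed
    qed
  next
    fix m m' f f' assume m: "m \<in> ?M" and m': "m' \<in> ?M"
      and *: "f + m = f' + m' \<and> keys f \<inter> Q' m = {} \<and> keys f' \<inter> Q' m' = {}"
    have p: "I m \<in> N" "m = F m + u (I m)" "keys (F m) \<inter> Q (I m) = {}"
      using piece[OF m] by (auto simp: is_piece_def)
    have p': "I m' \<in> N" "m' = F m' + u (I m')" "keys (F m') \<inter> Q (I m') = {}"
      using piece[OF m'] by (auto simp: is_piece_def)
    have eq: "(f + F m) + u (I m) = (f' + F m') + u (I m')"
      using * p(2) p'(2) by (simp add: add.assoc)
    have I: "I m = I m'"
      by (rule lq_systemD(4)[OF lq p(1) p'(1) eq]) (use * p p' in \<open>auto simp: keys_add_mon Q'_def\<close>)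
    have "F m = F m'"
    proof (rule prefix_monomial_unique[OF _ _ inj])
      show "f + F m = f' + F m'" using eq I by simp
      have "mdeg (F m) + mdeg (u (I m)) = mdeg (F m') + mdeg (u (I m'))"
        using m m' p(2) p'(2) by (metis (mono_tags, lifting) mdeg_add mem_Collect_eq)
      then show "mdeg (F m) = mdeg (F m')" using I by simp
      show "F m \<in> mons V" "F m' \<in> mons V"
        using m m' p(2) p'(2) by (metis (mono_tags, lifting) IntD1 mem_Collect_eq mons_add_iff)+
      show "idx v \<le> idx z" if "z \<in> keys f" "z \<in> V" "v \<in> keys (F m)" for z v
        using * that by (fastforce simp: Q'_def not_less[symmetric])
      show "idx v \<le> idx z" if "z \<in> keys f'" "z \<in> V" "v \<in> keys (F m')" for z v
        using * that by (fastforce simp: Q'_def not_less[symmetric])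
    qed
    then show "m = m'" using I p(2) p'(2) by simp
  qed
  then show ?thesis by blast
qed

section \<open>Linear resolutions\<close>

lemma lookup_hom_component: "lookup (hom_component d p) m = (if mdeg m = d then lookup p m else 0)"
  by (auto simp: hom_component_def lookup_sum lookup_single when_def in_keys_iff)

lemma keys_hom_component: "keys (hom_component d p) = {m \<in> keys p. mdeg m = d}"
  by (auto simp: in_keys_iff lookup_hom_component split: if_splits)

lemma homogeneous_hom_component: "homogeneous d (hom_component d p)"
  by (simp add: homogeneous_def keys_hom_component)

lemma hom_component_carrier:
  "p \<in> carrier (mpoly_ring V) \<Longrightarrow> hom_component d p \<in> carrier (mpoly_ring V)"
  by (auto simp: carrier_mpoly keys_hom_component)

lemma hom_component_add: "hom_component d (p + q) = hom_component d p + hom_component d q"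
  by (rule poly_mapping_eqI) (simp add: lookup_hom_component lookup_add)

lemma hom_component_sum: "hom_component d (sum f A) = (\<Sum>i\<in>A. hom_component d (f i))"
  by (rule poly_mapping_eqI) (simp add: lookup_hom_component lookup_sum)

lemma hom_component_homogeneous: "homogeneous d p \<Longrightarrow> hom_component d p = p"
  by (rule poly_mapping_eqI)
    (auto simp: lookup_hom_component homogeneous_def in_keys_iff)

lemma homogeneous_mult: "homogeneous a p \<Longrightarrow> homogeneous b q \<Longrightarrow> homogeneous (a + b) (p * q)"
  by (fastforce simp: homogeneous_def mdeg_add dest!: keys_mult_mons)

lemma hom_component_mult:
  assumes q: "homogeneous e q"
  shows "hom_component (d + e) (p * q) = hom_component d p * q"
proof -
  define r where "r = p - hom_component d p"
  have r: "mdeg m \<noteq> d" if "m \<in> keys r" for m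
    using that by (auto simp: r_def in_keys_iff lookup_minus lookup_hom_component)
  have "hom_component (d + e) (r * q) = 0"
  proof (rule poly_mapping_eqI)
    fix m
    have "m \<notin> keys (r * q)" if "mdeg m = d + e"
      using that q r by (auto simp: homogeneous_def mdeg_add dest!: keys_mult_mons)
    then show "lookup (hom_component (d + e) (r * q)) m = lookup 0 m"
      by (auto simp: lookup_hom_component in_keys_iff)
  qed
  moreover have "p * q = hom_component d p * q + r * q"
    by (simp add: r_def algebra_simps)
  ultimately show ?thesis
    using homogeneous_mult[OF homogeneous_hom_component q]
    by (simp add: hom_component_add hom_component_homogeneous)
qed

text \<open>The part of a polynomial whose support is divisible by \<open>u\<close> can be split off as a multiple
  of \<open>u\<close>.\<close>

lemma mon_ideal_insert:
  fixes p :: "('v, 'k::field) mpoly"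
  assumes "p \<in> mon_ideal V (insert u U)"
  shows "\<exists>h\<in>carrier (mpoly_ring V). p - h * mpoly_of_mon u \<in> mon_ideal V U"
proof -
  define h where "h = (\<Sum>m\<in>{m \<in> keys p. m \<in> multiples {u}}. single (m - u) (lookup p m))"
  have hc: "h \<in> carrier (mpoly_ring V)" unfolding h_def
    using assms
    by (intro mpoly_carrier_sum mpoly_carrier_single)
      (auto simp: mon_ideal_def multiples_def mons_add_iff)
  have "h * mpoly_of_mon u = (\<Sum>m\<in>{m \<in> keys p. m \<in> multiples {u}}. single m (lookup p m))"
    by (auto simp: h_def sum_distrib_right mpoly_of_mon_def mult_single multiples_def intro!: sum.cong)
  then have "lookup (h * mpoly_of_mon u) m = (if m \<in> multiples {u} then lookup p m else 0)" for m
    by (auto simp: lookup_sum lookup_single when_def in_keys_iff)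
  then have "keys (p - h * mpoly_of_mon u) = {m \<in> keys p. m \<notin> multiples {u}}"
    by (auto simp: in_keys_iff lookup_minus split: if_splits)
  then have "p - h * mpoly_of_mon u \<in> mon_ideal V U"
    using assms by (auto simp: mon_ideal_def multiples_def)
  with hc show ?thesis by blast
qed

text \<open>
  Vectors of polynomials are functions on \<open>nat\<close>. A generator of a submodule is stored together
  with the list of the variables that generate the colon ideal of the preceding generators.
\<close>

type_synonym ('v, 'k) gens = "((nat \<Rightarrow> ('v, 'k) mpoly) \<times> 'v list) list"

definition lincomb :: "('v, 'k::field) gens \<Rightarrow> (nat \<Rightarrow> ('v, 'k) mpoly) \<Rightarrow> nat \<Rightarrow> ('v, 'k) mpoly" where
  "lincomb xs c = (\<lambda>m. \<Sum>k<length xs. c k * fst (xs ! k) m)"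

definition span :: "'v set \<Rightarrow> ('v, 'k::field) gens \<Rightarrow> (nat \<Rightarrow> ('v, 'k) mpoly) set" where
  "span V xs = {lincomb xs c | c. \<forall>k. c k \<in> carrier (mpoly_ring V)}"

definition syzygies :: "'v set \<Rightarrow> ('v, 'k::field) gens \<Rightarrow> (nat \<Rightarrow> ('v, 'k) mpoly) set" where
  "syzygies V xs = {c \<in> free_module V (length xs). lincomb xs c = (\<lambda>_. 0)}"

definition var_ideal :: "'v set \<Rightarrow> 'v set \<Rightarrow> ('v, 'k::field) mpoly set" where
  "var_ideal V Q = mon_ideal V ((\<lambda>z. single z 1) ` Q)"

text \<open>
  Generators of degree \<open>d\<close> of a submodule of a free module whose successive colon ideals are
  generated by sets of variables. The list is built from the left, so that the syzygies can be
  found by induction on it.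
\<close>

inductive lq_module :: "'v set \<Rightarrow> nat \<Rightarrow> ('v, 'k::field) gens \<Rightarrow> bool" for V d where
  Nil: "lq_module V d []"
| snoc: "lq_module V d xs \<Longrightarrow> \<forall>m. e m \<in> carrier (mpoly_ring V) \<and> homogeneous d (e m) \<Longrightarrow>
    distinct zs \<Longrightarrow> set zs \<subseteq> V \<Longrightarrow> \<forall>z\<in>set zs. (\<lambda>m. var z * e m) \<in> span V xs \<Longrightarrow>
    \<forall>f\<in>carrier (mpoly_ring V). (\<lambda>m. f * e m) \<in> span V xs \<longrightarrow> f \<in> var_ideal V (set zs) \<Longrightarrow>
    lq_module V d (xs @ [(e, zs)])"

lemma lq_moduleD:
  "lq_module V d xs \<Longrightarrow> k < length xs \<Longrightarrow>
    fst (xs ! k) m \<in> carrier (mpoly_ring V) \<and> homogeneous d (fst (xs ! k) m)"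
  by (induction rule: lq_module.induct) (auto simp: nth_append less_Suc_eq)

lemma lincomb_snoc: "lincomb (xs @ [(e, zs)]) c = (\<lambda>m. lincomb xs c m + c (length xs) * e m)"
  by (rule ext) (simp add: lincomb_def nth_append)

lemma lincomb_cong: "(\<And>k. k < length xs \<Longrightarrow> c k = c' k) \<Longrightarrow> lincomb xs c = lincomb xs c'"
  by (simp add: lincomb_def)

lemma lincomb_diff: "lincomb xs (\<lambda>k. c k - c' k) = (\<lambda>m. lincomb xs c m - lincomb xs c' m)"
  by (simp add: lincomb_def left_diff_distrib sum_subtractf)

lemma lincomb_add: "lincomb xs (\<lambda>k. c k + c' k) = (\<lambda>m. lincomb xs c m + lincomb xs c' m)"
  by (simp add: lincomb_def distrib_right sum.distrib)

lemma lincomb_scale: "lincomb xs (\<lambda>k. f * c k) = (\<lambda>m. f * lincomb xs c m)"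
  by (simp add: lincomb_def sum_distrib_left mult.assoc)

lemma span_snoc:
  "v \<in> span V (xs @ [(e, zs)]) \<longleftrightarrow>
    (\<exists>w\<in>span V xs. \<exists>f\<in>carrier (mpoly_ring V). v = (\<lambda>m. w m + f * e m))" (is "?L = ?R")
proof
  assume ?L
  then obtain c where "\<forall>k. c k \<in> carrier (mpoly_ring V)" "v = lincomb (xs @ [(e, zs)]) c"
    by (auto simp: span_def)
  then show ?R unfolding span_def lincomb_snoc by blast
next
  assume ?R
  then obtain c f where c: "\<forall>k. c k \<in> carrier (mpoly_ring V)" "f \<in> carrier (mpoly_ring V)"
    "v = (\<lambda>m. lincomb xs c m + f * e m)"
    by (auto simp: span_def)
  have "v = lincomb (xs @ [(e, zs)]) (c(length xs := f))"
    unfolding lincomb_snoc c(3) using lincomb_cong[of xs c "c(length xs := f)"] by simp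
  with c show ?L unfolding span_def by (intro CollectI exI[of _ "c(length xs := f)"]) auto
qed

lemma span_Nil: "span V [] = {\<lambda>_. 0}"
  by (auto simp: span_def lincomb_def intro!: exI[of _ "\<lambda>_. 0"] mpoly_carrier_0)

lemma span_uminus:
  assumes "v \<in> span V xs"
  shows "(\<lambda>m. - v m) \<in> span V xs"
proof -
  obtain c where c: "\<forall>k. c k \<in> carrier (mpoly_ring V)" "v = lincomb xs c"
    using assms by (auto simp: span_def)
  have "(\<lambda>m. - v m) = lincomb xs (\<lambda>k. - c k)"
    by (simp add: c(2) lincomb_def sum_negf)
  with c show ?thesis by (auto simp: span_def intro!: mpoly_carrier_closed)
qed

lemma free_module_iff:
  "c \<in> free_module V n \<longleftrightarrow> (\<forall>k. c k \<in> carrier (mpoly_ring V)) \<and> (\<forall>k\<ge>n. c k = 0)"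
proof -
  have "c k \<in> carrier (mpoly_ring V)" if "\<forall>k<n. c k \<in> carrier (mpoly_ring V)" "\<forall>k\<ge>n. c k = 0" for k
    using that mpoly_carrier_0[of V] by (cases "k < n") auto
  then show ?thesis unfolding free_module_def by blast
qed

lemma free_module_diff_scale:
  assumes "c \<in> free_module V n" "s \<in> free_module V n" "h \<in> carrier (mpoly_ring V)"
  shows "(\<lambda>k. c k - h * s k) \<in> free_module V n" "(\<lambda>k. c k + h * s k) \<in> free_module V n"
    "(\<lambda>k. h * s k) \<in> free_module V n"
  using assms by (auto simp: free_module_iff intro!: mpoly_carrier_closed)

text \<open>A variable outside \<open>Q\<close> is a nonzerodivisor modulo the ideal generated by \<open>Q\<close>.\<close>

lemma var_times_var_ideal:
  fixes f :: "('v, 'k::field) mpoly"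
  assumes "f \<in> carrier (mpoly_ring V)" "z \<notin> Q" "f * var z \<in> var_ideal V Q"
  shows "f \<in> var_ideal V Q"
  using assms
  by (auto simp: var_ideal_def mon_ideal_of_vars[unfolded One_nat_def] var_def keys_mult_mpoly_of_mon keys_add_mon
      carrier_mpoly)

text \<open>
  That \<open>var z * e\<close> is a combination of the preceding generators is a syzygy. Its coefficients can
  be replaced by their components of degree one, as all generators have the same degree.
\<close>

lemma linear_syzygy:
  assumes lq: "lq_module V d xs" and e: "\<forall>m. homogeneous d (e m)"
    and z: "z \<in> V" "(\<lambda>m. var z * e m) \<in> span V xs"
  obtains s where "s \<in> syzygies V (xs @ [(e, zs)])" "s (length xs) = var z" "\<And>k. homogeneous 1 (s k)"
proof -
  obtain b where b: "\<forall>k. b k \<in> carrier (mpoly_ring V)" "(\<lambda>m. var z * e m) = lincomb xs b"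
    using z(2) by (auto simp: span_def)
  define b' where "b' k = hom_component 1 (b k)" for k
  have b'c: "b' k \<in> carrier (mpoly_ring V)" for k
    using b(1) by (simp add: b'_def hom_component_carrier)
  have lin: "lincomb xs b' m = var z * e m" for m
  proof -
    have "lincomb xs b' m = hom_component (1 + d) (lincomb xs b m)"
      unfolding lincomb_def hom_component_sum b'_def
      by (intro sum.cong refl hom_component_mult[symmetric]) (use lq_moduleD[OF lq] in auto)
    also have "\<dots> = hom_component (1 + d) (var z * e m)"
      using fun_cong[OF b(2), of m] by simp
    also have "\<dots> = var z * e m"
      by (rule hom_component_homogeneous[OF homogeneous_mult[OF homogeneous_var]]) (use e in simp)
    finally show ?thesis .
  qed
  define s where "s k = (if k < length xs then - b' k else if k = length xs then var z else 0)" for k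
  have "lincomb xs s = (\<lambda>m. - lincomb xs b' m)"
    by (simp add: lincomb_def s_def sum_negf)
  then have "lincomb (xs @ [(e, zs)]) s = (\<lambda>_. 0)"
    by (simp add: lincomb_snoc lin) (simp add: s_def)
  moreover have "s \<in> free_module V (Suc (length xs))"
    using b'c z(1) by (auto simp: free_module_iff s_def mpoly_carrier_0 mpoly_carrier_var
        intro: mpoly_carrier_closed)
  ultimately have "s \<in> syzygies V (xs @ [(e, zs)])"
    by (simp add: syzygies_def)
  moreover have "homogeneous 1 (s k)" for k
    using homogeneous_hom_component[of 1 "b k"] homogeneous_var[of z]
    by (auto simp: s_def b'_def homogeneous_def)
  ultimately show thesis by (intro that[of s]) (auto simp: s_def)
qed

text \<open>
  Adding a generator $e$ with colon ideal $(z_1,\ldots,z_t)$ adds to the syzygies those with last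
  coefficient in this ideal. They are generated by one linear syzygy for each $z_s$ over the old
  ones, and the colon ideal at the $s$-th new syzygy is $(z_1,\ldots,z_{s-1})$, since only last
  coefficients matter.
\<close>

theorem lq_module_syzygies:
  fixes xs :: "('v, 'k::field) gens"
  assumes "lq_module V d xs"
  shows "\<exists>ss. lq_module V 1 ss \<and> span V ss = syzygies V xs"
  using assms
proof induction
  case Nil
  have "syzygies V [] = {\<lambda>_. 0}"
    by (auto simp: syzygies_def lincomb_def free_module_iff mpoly_carrier_0)
  then show ?case using span_Nil lq_module.Nil by blast
next
  case (snoc xs e zs)
  have e_hom: "\<forall>m. homogeneous d (e m)" and e_span: "\<And>z. z \<in> set zs \<Longrightarrow> (\<lambda>m. var z * e m) \<in> span V xs"
    using snoc.hyps by auto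
  have e_colon: "f \<in> var_ideal V (set zs)"
    if "f \<in> carrier (mpoly_ring V)" "(\<lambda>m. f * e m) \<in> span V xs" for f
    using snoc.hyps that by blast
  obtain ss0 where ss0: "lq_module V 1 ss0" "span V ss0 = syzygies V xs"
    using snoc.IH by blast
  let ?r = "length xs"
  let ?S = "syzygies V (xs @ [(e, zs)])"
  have S_closed: "(\<lambda>k. c k - h * s k) \<in> ?S" "(\<lambda>k. c k + h * s k) \<in> ?S" "(\<lambda>k. h * s k) \<in> ?S"
    if "c \<in> ?S" "s \<in> ?S" "h \<in> carrier (mpoly_ring V)" for c s h
  proof -
    let ?xs = "xs @ [(e, zs)]"
    have m: "c \<in> free_module V (length ?xs)" "s \<in> free_module V (length ?xs)"
      "lincomb ?xs c = (\<lambda>_. 0)" "lincomb ?xs s = (\<lambda>_. 0)"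
      using that by (auto simp: syzygies_def)
    note fm = free_module_diff_scale[OF m(1,2) that(3)]
    show "(\<lambda>k. c k - h * s k) \<in> ?S" "(\<lambda>k. c k + h * s k) \<in> ?S" "(\<lambda>k. h * s k) \<in> ?S"
      unfolding syzygies_def using fm
      by (simp_all add: lincomb_diff lincomb_add lincomb_scale m(3,4))
  qed
  have "\<exists>ss. lq_module V 1 ss \<and> span V ss = {c \<in> ?S. c ?r \<in> var_ideal V (set ys)}"
    if "set ys \<subseteq> set zs" "distinct ys" for ys
    using that
  proof (induction ys rule: rev_induct)
    case Nil
    have var0: "c ?r \<in> var_ideal V {} \<longleftrightarrow> c ?r = 0" for c :: "nat \<Rightarrow> ('v, 'k) mpoly"
      by (auto simp: var_ideal_def mon_ideal_def multiples_def)
    have "c \<in> ?S \<and> c ?r \<in> var_ideal V {} \<longleftrightarrow> c \<in> syzygies V xs" for c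
    proof -
      have fm: "c \<in> free_module V (Suc ?r) \<and> c ?r = 0 \<longleftrightarrow> c \<in> free_module V ?r"
        unfolding free_module_iff by (metis Suc_leD le_eq_less_or_eq less_eq_Suc_le)
      show ?thesis
      proof (cases "c ?r = 0")
        case True
        then show ?thesis using fm var0[of c] by (auto simp: syzygies_def lincomb_snoc)
      next
        case False
        then show ?thesis using fm by (simp add: syzygies_def var0)
      qed
    qed
    then have "{c \<in> ?S. c ?r \<in> var_ideal V (set [])} = syzygies V xs" by simp
    with ss0 show ?case by auto
  next
    case (snoc z ys)
    then obtain ss where ss: "lq_module V 1 ss" "span V ss = {c \<in> ?S. c ?r \<in> var_ideal V (set ys)}"
      by auto
    have z: "z \<in> set zs" "z \<notin> set ys" "z \<in> V" using snoc.prems \<open>set zs \<subseteq> V\<close> by auto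
    have ysV: "set ys \<subseteq> V" using snoc.prems \<open>set zs \<subseteq> V\<close> by auto
    obtain s where s: "s \<in> ?S" "s ?r = var z" "\<And>k. homogeneous 1 (s k)"
      using linear_syzygy[OF \<open>lq_module V d xs\<close> e_hom z(3) e_span[OF z(1)], of zs] by blast
    have sc: "s k \<in> carrier (mpoly_ring V)" for k
      using s(1) by (simp add: syzygies_def free_module_iff)
    have ideal: "ideal (var_ideal V Q :: ('v, 'k) mpoly set) (mpoly_ring V)" for Q
      unfolding var_ideal_def by (rule mon_ideal_ideal)
    have var_in: "(var w :: ('v, 'k) mpoly) \<in> var_ideal V Q" if "w \<in> Q" "Q \<subseteq> V" for w Q
      using that subset_multiples[of "(\<lambda>z. single z 1) ` Q"]
      by (auto simp: var_ideal_def var_def mpoly_of_mon_in_mon_ideal mons_single)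
    have "lq_module V 1 (ss @ [(s, ys)])"
    proof (rule lq_module.snoc[OF ss(1)])
      show "\<forall>w\<in>set ys. (\<lambda>m. var w * s m) \<in> span V ss"
      proof
        fix w assume w: "w \<in> set ys"
        then have wc: "var w \<in> carrier (mpoly_ring V :: ('v, 'k) mpoly ring)"
          using ysV by (intro mpoly_carrier_var) auto
        have "var z * var w \<in> (var_ideal V (set ys) :: ('v, 'k) mpoly set)"
          by (rule ideal_mpolyD(3)[OF ideal mpoly_carrier_var[OF z(3)] var_in[OF w ysV]])
        then show "(\<lambda>m. var w * s m) \<in> span V ss"
          using S_closed(3)[OF s(1) s(1) wc] s(2) by (simp add: ss(2) mult.commute)
      qed
      show "\<forall>f\<in>carrier (mpoly_ring V). (\<lambda>m. f * s m) \<in> span V ss \<longrightarrow> f \<in> var_ideal V (set ys)"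
        using var_times_var_ideal[OF _ z(2)] s(2) by (auto simp: ss(2))
      show "\<forall>m. s m \<in> carrier (mpoly_ring V) \<and> homogeneous 1 (s m)"
        using s(3) sc by blast
      show "distinct ys" using snoc.prems by simp
    qed (rule ysV)
    moreover have "span V (ss @ [(s, ys)]) = {c \<in> ?S. c ?r \<in> var_ideal V (set (ys @ [z]))}"
    proof (intro Set.set_eqI iffI)
      fix c assume "c \<in> span V (ss @ [(s, ys)])"
      then obtain w f where w: "w \<in> ?S" "w ?r \<in> var_ideal V (set ys)" "f \<in> carrier (mpoly_ring V)"
        "c = (\<lambda>m. w m + f * s m)"
        by (auto simp: span_snoc ss(2))
      have "w ?r \<in> var_ideal V (set (ys @ [z]))"
        using w(2) by (auto simp: var_ideal_def mon_ideal_def multiples_def)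
      moreover have "f * s ?r \<in> var_ideal V (set (ys @ [z]))"
        unfolding s(2) by (rule ideal_mpolyD(3)[OF ideal w(3) var_in]) (use z ysV in auto)
      ultimately have "c ?r \<in> var_ideal V (set (ys @ [z]))"
        unfolding w(4) by (rule ideal_mpolyD(2)[OF ideal])
      then show "c \<in> {c \<in> ?S. c ?r \<in> var_ideal V (set (ys @ [z]))}"
        using S_closed(2)[OF w(1) s(1) w(3)] w(4) by simp
    next
      fix c assume c: "c \<in> {c \<in> ?S. c ?r \<in> var_ideal V (set (ys @ [z]))}"
      then obtain h where h: "h \<in> carrier (mpoly_ring V)" "c ?r - h * var z \<in> var_ideal V (set ys)"
        using mon_ideal_insert[of "c ?r" V "single z 1" "(\<lambda>z. single z 1) ` set ys"]
        by (auto simp: var_ideal_def var_def)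
      then have "(\<lambda>k. c k - h * s k) \<in> span V ss"
        using S_closed(1)[OF _ s(1) h(1), of c] c s(2) by (simp add: ss(2))
      then show "c \<in> span V (ss @ [(s, ys)])"
        unfolding span_snoc using h(1) by (intro bexI[of _ "\<lambda>k. c k - h * s k"] bexI[of _ h]) auto
    qed
    ultimately show ?case by blast
  qed
  from this[of zs] \<open>distinct zs\<close> obtain ss where
    ss: "lq_module V 1 ss" "span V ss = {c \<in> ?S. c ?r \<in> var_ideal V (set zs)}" by blast
  have "c ?r \<in> var_ideal V (set zs)" if "c \<in> ?S" for c
  proof -
    have cc: "\<And>k. c k \<in> carrier (mpoly_ring V)" and "lincomb (xs @ [(e, zs)]) c = (\<lambda>_. 0)"
      using that by (auto simp: syzygies_def free_module_iff)
    then have "c ?r * e m = - lincomb xs c m" for m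
      using fun_cong[of _ _ m] by (simp add: lincomb_snoc fun_eq_iff add_eq_0_iff2)
    then have "(\<lambda>m. c ?r * e m) \<in> span V xs"
      using span_uminus[of "lincomb xs c" V xs] cc by (auto simp: span_def)
    then show ?thesis using e_colon[OF cc] by blast
  qed
  with ss show ?case by auto
qed

text \<open>The matrix of the resolution has the generators of the syzygy module as columns.\<close>

lemma mat_apply_lincomb:
  assumes "span V ss = syzygies V ys" "\<forall>k. f k \<in> carrier (mpoly_ring V)"
  shows "mat_apply (length ys) (length ss) (\<lambda>k l. fst (ss ! l) k) f = lincomb ss f"
proof
  fix k
  have "lincomb ss f \<in> syzygies V ys" using assms by (auto simp: span_def)
  then have "k \<ge> length ys \<Longrightarrow> lincomb ss f k = 0"
    by (simp add: syzygies_def free_module_iff)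
  then show "mat_apply (length ys) (length ss) (\<lambda>k l. fst (ss ! l) k) f k = lincomb ss f k"
    by (auto simp: mat_apply_def lincomb_def mult.commute)
qed

lemma span_free_module: "span V xs = lincomb xs ` free_module V (length xs)"
proof
  show "span V xs \<subseteq> lincomb xs ` free_module V (length xs)"
  proof
    fix v assume "v \<in> span V xs"
    then obtain c where c: "\<forall>k. c k \<in> carrier (mpoly_ring V)" "v = lincomb xs c"
      by (auto simp: span_def)
    let ?c = "\<lambda>k. if k < length xs then c k else 0"
    have "v = lincomb xs ?c" unfolding c(2) by (rule lincomb_cong) simp
    moreover have "?c \<in> free_module V (length xs)"
      using c(1) by (simp add: free_module_def)
    ultimately show "v \<in> lincomb xs ` free_module V (length xs)" by blast
  qed
qed (auto simp: span_def free_module_iff)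

text \<open>The ideal \<open>I\<close> is regarded as a submodule of the free module of rank one, in coordinate 0.
  Iterating the passage to the syzygies gives all maps of the resolution; after the first step every
  entry is a linear form.\<close>

theorem lq_module_linear_resolution:
  assumes lq: "lq_module V j xs"
    and I: "span V xs = {v. v 0 \<in> I \<and> (\<forall>k>0. v k = 0)}"
  shows "has_linear_resolution V I"
proof -
  define S where "S = rec_nat xs (\<lambda>_ ys. SOME ss. lq_module V 1 ss \<and> span V ss = syzygies V ys)"
  have S0: "S 0 = xs" by (simp add: S_def)
  have step: "lq_module V 1 (S (Suc i)) \<and> span V (S (Suc i)) = syzygies V (S i)" for i
  proof (induction i)
    case 0
    show ?case unfolding S_def using someI_ex[OF lq_module_syzygies[OF lq]] by simp
  next
    case (Suc i)
    show ?case
      using someI_ex[OF lq_module_syzygies[OF conjunct1[OF Suc]]] by (simp add: S_def)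
  qed
  define b where "b i = length (S i)" for i
  define A where "A i k l = fst (S (Suc i) ! l) k" for i k l
  define g where "g k = fst (xs ! k) 0" for k
  have A_hom: "A i k l \<in> carrier (mpoly_ring V) \<and> homogeneous 1 (A i k l)" if "l < b (Suc i)" for i k l
    using that lq_moduleD[OF conjunct1[OF step]] by (simp add: A_def b_def)
  have b0: "b 0 = length xs" by (simp add: b_def S0)
  have xs0: "fst (xs ! l) k = 0" if l: "l < length xs" and k: "k > 0" for k l
  proof -
    let ?c = "\<lambda>i. if i = l then 1 else 0"
    have "1 \<in> carrier (mpoly_ring V :: ('a, 'b) mpoly ring)"
      by (simp add: carrier_mpoly mons_0)
    then have "lincomb xs ?c \<in> span V xs"
      by (auto simp: span_def mpoly_carrier_0)
    then have "lincomb xs ?c k = 0" using I k by auto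
    moreover have "lincomb xs ?c k = fst (xs ! l) k"
      using l by (simp add: lincomb_def if_distrib[of "\<lambda>x. x * _"] sum.delta cong: if_cong)
    ultimately show ?thesis by simp
  qed
  have lin0: "lincomb xs f = (\<lambda>m. if m = 0 then \<Sum>k<b 0. g k * f k else 0)" for f
    using xs0 by (auto simp: lincomb_def b0 g_def mult.commute intro!: ext)
  have mat_apply: "mat_apply (b i) (b (Suc i)) (A i) f = lincomb (S (Suc i)) f"
    if "f \<in> free_module V (b (Suc i))" for i f
    using mat_apply_lincomb[OF conjunct2[OF step], of f i] that
    unfolding b_def A_def free_module_iff by blast
  have image: "mat_apply (b i) (b (Suc i)) (A i) ` free_module V (b (Suc i)) = syzygies V (S i)" for i
  proof -
    have "mat_apply (b i) (b (Suc i)) (A i) ` free_module V (b (Suc i))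
      = lincomb (S (Suc i)) ` free_module V (b (Suc i))"
      by (rule image_cong[OF refl mat_apply])
    then show ?thesis using step[of i] by (simp add: span_free_module b_def)
  qed
  have "graded_free_resolution V I b (\<lambda>i k. j + i) g A"
    unfolding graded_free_resolution_def
  proof (intro conjI allI impI ballI)
    fix k assume "k < b 0"
    then show "g k \<in> carrier (mpoly_ring V)" "homogeneous (j + 0) (g k)"
      using lq_moduleD[OF lq] by (auto simp: g_def b0)
  next
    fix i k l assume "l < b (Suc i)"
    with A_hom show "A i k l \<in> carrier (mpoly_ring V)" by blast
  next
    fix i k l m assume "l < b (Suc i)" "m \<in> keys (A i k l)"
    with A_hom show "mdeg m + (j + i) = j + Suc i" by (fastforce simp: homogeneous_def)
  next
    show "(\<lambda>f. \<Sum>k<b 0. g k * f k) ` free_module V (b 0) = I"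
    proof -
      have "(\<lambda>f. \<Sum>k<b 0. g k * f k) ` free_module V (b 0) = (\<lambda>v. v 0) ` span V xs"
        by (simp add: span_free_module image_image lin0 b0)
      also have "\<dots> = I"
      proof
        show "I \<subseteq> (\<lambda>v. v 0) ` span V xs"
        proof
          fix p assume "p \<in> I"
          then have "(\<lambda>k::nat. if k = 0 then p else 0) \<in> span V xs" by (simp add: I)
          then show "p \<in> (\<lambda>v. v 0) ` span V xs" by (rule rev_image_eqI) simp
        qed
      qed (auto simp: I)
      finally show ?thesis .
    qed
    have "{f \<in> free_module V (b 0). (\<Sum>k<b 0. g k * f k) = 0} = syzygies V (S 0)"
      by (auto simp: syzygies_def S0 lin0 b0 fun_eq_iff)
    then show "{f \<in> free_module V (b 0). (\<Sum>k<b 0. g k * f k) = 0}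
       = mat_apply (b 0) (b 1) (A 0) ` free_module V (b 1)"
      using image[of 0] by simp
  next
    fix i
    have "{f \<in> free_module V (b (Suc i)). mat_apply (b i) (b (Suc i)) (A i) f = (\<lambda>_. 0)}
        = syzygies V (S (Suc i))"
      using mat_apply by (auto simp: syzygies_def b_def)
    then show "{f \<in> free_module V (b (Suc i)). mat_apply (b i) (b (Suc i)) (A i) f = (\<lambda>_. 0)}
       = mat_apply (b (Suc i)) (b (Suc (Suc i))) (A (Suc i)) ` free_module V (b (Suc (Suc i)))"
      by (simp add: image)
  qed
  moreover have "lookup (A i k l) 0 = 0" if "l < b (Suc i)" for i k l
  proof -
    have "0 \<notin> keys (A i k l)" using A_hom[OF that, of k] by (fastforce simp: homogeneous_def)
    then show ?thesis by (simp add: in_keys_iff)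
  qed
  ultimately show ?thesis unfolding has_linear_resolution_def by blast
qed

text \<open>A sorted system in one degree is an \<open>lq_module\<close> by the description of its colon ideals.
  Initial segments of the list have to be treated together with the ideals that they generate.\<close>

theorem lq_system_linear_resolution:
  assumes lq: "lq_system V N u Q \<rho>" and V: "finite V" and deg: "\<And>i. i \<in> N \<Longrightarrow> mdeg (u i) = d"
  shows "has_linear_resolution V (mon_ideal V (u ` N) :: ('v, 'k::field) mpoly set)"
proof -
  obtain xs where xs: "lq_list N u \<rho> xs"
    using lq_list_exists lq_systemD(1)[OF lq] by blast
  have set_xs: "set xs = N" using xs by (simp add: lq_list_def)
  have "\<exists>zs. set zs = Q i \<and> distinct zs" if "i \<in> N" for i
    using finite_distinct_list[OF finite_subset[OF lq_systemD(3)[OF lq that] V]] by blast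
  then obtain zs where zs: "\<And>i. i \<in> N \<Longrightarrow> set (zs i) = Q i \<and> distinct (zs i)" by metis
  define vec :: "('v, 'k) mpoly \<Rightarrow> nat \<Rightarrow> ('v, 'k) mpoly" where "vec p = (\<lambda>k. if k = 0 then p else 0)" for p
  let ?gens = "\<lambda>n. map (\<lambda>i. (vec (mpoly_of_mon (u i)), zs i)) (take n xs)"
  have "lq_module V d (?gens n) \<and>
      span V (?gens n) = {v. v 0 \<in> mon_ideal V (u ` set (take n xs)) \<and> (\<forall>k>0. v k = 0)}"
    if "n \<le> length xs" for n
    using that
  proof (induction n)
    case 0
    have "(mon_ideal V {} :: ('v, 'k) mpoly set) = {0}" by (auto simp: mon_ideal_def multiples_def)
    then show ?case by (auto simp: lq_module.Nil span_Nil fun_eq_iff) (metis gr_zeroI)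
  next
    case (Suc n)
    let ?i = "xs ! n" and ?U = "u ` set (take n xs)"
    have n: "n < length xs" and iN: "?i \<in> N" using Suc.prems set_xs by auto
    have IH: "lq_module V d (?gens n)"
      "span V (?gens n) = {v. v 0 \<in> mon_ideal V ?U \<and> (\<forall>k>0. v k = 0)}"
      using Suc by auto
    have gens: "?gens (Suc n) = ?gens n @ [(vec (mpoly_of_mon (u ?i)), zs ?i)]"
      using n by (simp add: take_Suc_conv_app_nth)
    have uV: "u ?i \<in> mons V" by (rule lq_systemD(2)[OF lq iN])
    have colon: "f * mpoly_of_mon (u ?i) \<in> mon_ideal V ?U \<longleftrightarrow> f \<in> var_ideal V (Q ?i)"
      if "f \<in> carrier (mpoly_ring V)" for f :: "('v, 'k) mpoly"
      using that uV lq_list_colon[OF lq xs n]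
      by (auto simp: mon_ideal_def[of _ ?U] var_ideal_def mon_ideal_of_vars[unfolded One_nat_def]
          carrier_mpoly keys_mult_mpoly_of_mon mons_add)
    have vec_mult: "(\<lambda>m. f * vec p m) = vec (f * p)" for f p
      by (auto simp: vec_def)
    have "lq_module V d (?gens (Suc n))"
      unfolding gens
    proof (rule lq_module.snoc[OF IH(1)])
      show "\<forall>m. vec (mpoly_of_mon (u ?i)) m \<in> carrier (mpoly_ring V) \<and>
          homogeneous d (vec (mpoly_of_mon (u ?i)) m)"
        using deg[OF iN] uV by (auto simp: vec_def mpoly_carrier_mon mpoly_carrier_0 homogeneous_def)
      show "\<forall>z\<in>set (zs ?i). (\<lambda>m. var z * vec (mpoly_of_mon (u ?i)) m) \<in> span V (?gens n)"
      proof
        fix z assume "z \<in> set (zs ?i)"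
        then have z: "z \<in> Q ?i" "z \<in> V" using zs[OF iN] lq_systemD(3)[OF lq iN] by auto
        have "(var z :: ('v, 'k) mpoly) \<in> var_ideal V (Q ?i)"
          using z subset_multiples[of "(\<lambda>z. single z 1) ` Q ?i"]
          by (auto simp: var_ideal_def var_def mpoly_of_mon_in_mon_ideal mons_single)
        then have "var z * mpoly_of_mon (u ?i) \<in> (mon_ideal V ?U :: ('v, 'k) mpoly set)"
          using colon mpoly_carrier_var[OF z(2)] by blast
        then show "(\<lambda>m. var z * vec (mpoly_of_mon (u ?i)) m) \<in> span V (?gens n)"
          unfolding vec_mult IH(2) by (simp add: vec_def)
      qed
      show "\<forall>f\<in>carrier (mpoly_ring V).
          (\<lambda>m. f * vec (mpoly_of_mon (u ?i)) m) \<in> span V (?gens n) \<longrightarrow> f \<in> var_ideal V (set (zs ?i))"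
        unfolding vec_mult IH(2) using colon zs[OF iN] by (simp add: vec_def)
    qed (use zs[OF iN] lq_systemD(3)[OF lq iN] in auto)
    moreover have "span V (?gens (Suc n))
      = {v. v 0 \<in> mon_ideal V (u ` set (take (Suc n) xs)) \<and> (\<forall>k>0. v k = 0)}"
    proof -
      have set_Suc: "u ` set (take (Suc n) xs) = insert (u ?i) ?U"
        using n by (simp add: take_Suc_conv_app_nth)
      have mon_in: "(mpoly_of_mon (u ?i) :: ('v, 'k) mpoly) \<in> mon_ideal V (insert (u ?i) ?U)"
        using uV subset_multiples[of "insert (u ?i) ?U"] by (auto simp: mpoly_of_mon_in_mon_ideal)
      have sub: "mon_ideal V ?U \<subseteq> (mon_ideal V (insert (u ?i) ?U) :: ('v, 'k) mpoly set)"
        by (auto simp: mon_ideal_def multiples_def)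
      show ?thesis
        unfolding gens set_Suc
      proof (intro Set.set_eqI iffI)
        fix v assume "v \<in> span V (?gens n @ [(vec (mpoly_of_mon (u ?i)), zs ?i)])"
        then obtain w f where w: "w \<in> span V (?gens n)" "f \<in> carrier (mpoly_ring V)"
          "v = (\<lambda>m. w m + f * vec (mpoly_of_mon (u ?i)) m)"
          unfolding span_snoc by blast
        have "w 0 + f * mpoly_of_mon (u ?i) \<in> mon_ideal V (insert (u ?i) ?U)"
          using w(1) IH(2) sub
          by (intro ideal_mpolyD(2)[OF mon_ideal_ideal] ideal_mpolyD(3)[OF mon_ideal_ideal w(2) mon_in]) auto
        then show "v \<in> {v. v 0 \<in> mon_ideal V (insert (u ?i) ?U) \<and> (\<forall>k>0. v k = 0)}"
          using w IH(2) by (simp add: vec_def)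
      next
        fix v :: "nat \<Rightarrow> ('v, 'k) mpoly"
        assume v: "v \<in> {v. v 0 \<in> mon_ideal V (insert (u ?i) ?U) \<and> (\<forall>k>0. v k = 0)}"
        then obtain h where h: "h \<in> carrier (mpoly_ring V)" "v 0 - h * mpoly_of_mon (u ?i) \<in> mon_ideal V ?U"
          using mon_ideal_insert[of "v 0" V "u ?i" ?U] by auto
        then have "vec (v 0 - h * mpoly_of_mon (u ?i)) \<in> span V (?gens n)"
          unfolding IH(2) by (simp add: vec_def)
        moreover have "v = (\<lambda>m. vec (v 0 - h * mpoly_of_mon (u ?i)) m + h * vec (mpoly_of_mon (u ?i)) m)"
          using v by (auto simp: vec_def fun_eq_iff)
        ultimately show "v \<in> span V (?gens n @ [(vec (mpoly_of_mon (u ?i)), zs ?i)])"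
          unfolding span_snoc using h(1) by blast
      qed
    qed
    ultimately show ?case by blast
  qed
  from this[of "length xs"] show ?thesis
    using lq_module_linear_resolution set_xs by auto
qed

theorem lq_system_componentwise_linear:
  fixes \<rho> :: "'i \<Rightarrow> 'r::wellorder"
  assumes lq: "lq_system V N u Q \<rho>" and V: "finite V"
  shows "componentwise_linear V (mon_ideal V (u ` N) :: ('v, 'k::field) mpoly set)"
proof -
  let ?I = "mon_ideal V (u ` N) :: ('v, 'k) mpoly set"
  interpret ring "mpoly_ring V :: ('v, 'k) mpoly ring" by (rule mpoly_ring_ring)
  have "has_linear_resolution V (Idl\<^bsub>mpoly_ring V\<^esub> {f \<in> ?I. homogeneous d f})" for d
  proof -
    let ?M = "{m \<in> mons V \<inter> multiples (u ` N). mdeg m = d}"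
    obtain Q' and \<rho>' :: "'v mon \<Rightarrow> 'r \<times> nat" where "lq_system V ?M (\<lambda>m. m) Q' \<rho>'"
      using lq_system_component[OF lq V] by blast
    then have "has_linear_resolution V (mon_ideal V ((\<lambda>m. m) ` ?M) :: ('v, 'k) mpoly set)"
      by (rule lq_system_linear_resolution[OF _ V]) simp
    moreover have "Idl\<^bsub>mpoly_ring V\<^esub> {f \<in> ?I. homogeneous d f} = mon_ideal V ?M"
    proof
      show "Idl\<^bsub>mpoly_ring V\<^esub> {f \<in> ?I. homogeneous d f} \<subseteq> mon_ideal V ?M"
        using subset_multiples[of ?M]
        by (intro genideal_minimal[OF mon_ideal_ideal]) (auto simp: mon_ideal_def homogeneous_def)
      have "mpoly_of_mon ` ?M \<subseteq> {f \<in> ?I. homogeneous d f}"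
        by (auto simp: mpoly_of_mon_in_mon_ideal homogeneous_def)
      moreover have "{f \<in> ?I. homogeneous d f} \<subseteq> carrier (mpoly_ring V)"
        by (auto simp: mon_ideal_def carrier_mpoly)
      ultimately show "mon_ideal V ?M \<subseteq> Idl\<^bsub>mpoly_ring V\<^esub> {f \<in> ?I. homogeneous d f}"
        by (intro mon_ideal_minimal genideal_ideal) (use genideal_self in auto)
    qed
    ultimately show ?thesis by simp
  qed
  moreover have "graded_ideal V ?I"
    unfolding graded_ideal_def
    using mon_ideal_ideal by (auto simp: mon_ideal_def keys_hom_component)
  ultimately show ?thesis by (simp add: componentwise_linear_def)
qed

section \<open>Initial ideals of the defining ideal of the Rees algebra\<close>

lemma finite_linear_order_max:
  assumes r: "strict_linear_order_on A r" and X: "finite X" "X \<noteq> {}" "X \<subseteq> A"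
  shows "\<exists>!m. m \<in> X \<and> (\<forall>m'\<in>X. m' \<noteq> m \<longrightarrow> (m', m) \<in> r)"
proof -
  have tr: "trans r" and irr: "irrefl r" and tot: "total_on A r"
    using r by (auto simp: strict_linear_order_on_def)
  have "\<exists>m. m \<in> X \<and> (\<forall>m'\<in>X. m' \<noteq> m \<longrightarrow> (m', m) \<in> r)"
    using X
  proof (induction rule: finite_ne_induct)
    case (insert a F)
    then obtain m where m: "m \<in> F" "\<forall>m'\<in>F. m' \<noteq> m \<longrightarrow> (m', m) \<in> r" by auto
    have "a \<noteq> m" using insert.hyps m by auto
    then consider "(a, m) \<in> r" | "(m, a) \<in> r"
      using tot insert.prems m by (auto simp: total_on_def)
    then show ?case
    proof cases
      case 1
      then show ?thesis using m by auto
    next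
      case 2
      have "(m', a) \<in> r" if "m' \<in> F" for m'
        using m(2) that 2 tr by (metis transD)
      then show ?thesis by blast
    qed
  qed simp
  then obtain m where m: "m \<in> X" "\<forall>m'\<in>X. m' \<noteq> m \<longrightarrow> (m', m) \<in> r" by blast
  show ?thesis
  proof (intro ex1I[of _ m] conjI m)
    fix m' assume m': "m' \<in> X \<and> (\<forall>m''\<in>X. m'' \<noteq> m' \<longrightarrow> (m'', m') \<in> r)"
    show "m' = m"
    proof (rule ccontr)
      assume "m' \<noteq> m"
      with m m' have "(m', m) \<in> r" "(m, m') \<in> r" by auto
      then show False using tr irr by (meson irreflD transD)
    qed
  qed
qed

lemma initial_mon_props:
  fixes p :: "('v, 'k::field) mpoly"
  assumes "monomial_order V r" "p \<in> carrier (mpoly_ring V)" "p \<noteq> 0"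
  shows "initial_mon r p \<in> keys p" "m' \<in> keys p \<Longrightarrow> m' \<noteq> initial_mon r p \<Longrightarrow> (m', initial_mon r p) \<in> r"
proof -
  have "\<exists>!m. m \<in> keys p \<and> (\<forall>m'\<in>keys p. m' \<noteq> m \<longrightarrow> (m', m) \<in> r)"
    using assms by (intro finite_linear_order_max[of "mons V"])
      (auto simp: monomial_order_def carrier_mpoly)
  from theI'[OF this] show "initial_mon r p \<in> keys p"
    "m' \<in> keys p \<Longrightarrow> m' \<noteq> initial_mon r p \<Longrightarrow> (m', initial_mon r p) \<in> r"
    unfolding initial_mon_def by auto
qed

definition additive_ext :: "('y \<Rightarrow> 'm::comm_monoid_add) \<Rightarrow> 'y mon \<Rightarrow> 'm" where
  "additive_ext g t = (\<Sum>y\<in>keys t. \<Sum>i<lookup t y. g y)"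

lemma additive_ext_superset:
  "finite X \<Longrightarrow> keys t \<subseteq> X \<Longrightarrow> additive_ext g t = (\<Sum>y\<in>X. \<Sum>i<lookup t y. g y)"
  unfolding additive_ext_def by (intro sum.mono_neutral_left) (auto simp: in_keys_iff)

lemma additive_ext_add:
  fixes g :: "'y \<Rightarrow> 'a::comm_monoid_add"
  shows "additive_ext g (a + b) = additive_ext g a + additive_ext g b"
proof -
  have const: "(\<Sum>i<k + l. c) = (\<Sum>i<k. c) + (\<Sum>i<l. c)" for k l :: nat and c :: "'a :: comm_monoid_add"
    by (induction l) (auto simp: add.assoc)
  let ?X = "keys a \<union> keys b"
  have X: "finite ?X" "keys (a + b) \<subseteq> ?X" "keys a \<subseteq> ?X" "keys b \<subseteq> ?X"
    by (auto simp: keys_add_mon)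
  show ?thesis
    by (simp add: additive_ext_superset[OF X(1,2)] additive_ext_superset[OF X(1,3)]
        additive_ext_superset[OF X(1,4)] lookup_add const sum.distrib)
qed

lemma additive_ext_0 [simp]: "additive_ext g 0 = 0"
  by (simp add: additive_ext_def)

lemma additive_ext_single: "additive_ext g (single y 1) = g y"
  by (simp add: additive_ext_def)

lemma lookup_additive_ext: "lookup (additive_ext g t) v = additive_ext (\<lambda>y. lookup (g y) v) t"
  by (simp add: additive_ext_def lookup_sum)

text \<open>The exponent of the image of a variable of $T$ in $S[t]$.\<close>

definition rees_exp :: "'a + 'a set \<Rightarrow> 'a option mon" where
  "rees_exp y = (case y of Inl v \<Rightarrow> single (Some v) 1
     | Inr C \<Rightarrow> (\<Sum>v\<in>C. single (Some v) 1) + single None 1)"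

lemma prod_var: "(\<Prod>v\<in>C. var (f v)) = mpoly_of_mon (\<Sum>v\<in>C. single (f v) 1)"
  by (induction C rule: infinite_finite_induct) (auto simp: mpoly_of_mon_0 mpoly_of_mon_add var_def)

lemma prod_mpoly_of_mon: "(\<Prod>v\<in>C. mpoly_of_mon (f v)) = mpoly_of_mon (\<Sum>v\<in>C. f v)"
  by (induction C rule: infinite_finite_induct) (auto simp: mpoly_of_mon_0 mpoly_of_mon_add)

lemma power_mpoly_of_mon: "mpoly_of_mon m ^ n = mpoly_of_mon (\<Sum>i<n. m)"
  by (induction n) (auto simp: mpoly_of_mon_0 mpoly_of_mon_add mult.commute)

lemma rees_gen_eq: "rees_gen y = mpoly_of_mon (rees_exp y)"
  by (cases y) (simp_all only: rees_gen_def sum.case prod_var,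
      simp_all only: var_def rees_exp_def sum.case mpoly_of_mon_add)

lemma subst_rees_gen:
  "subst rees_gen p = (\<Sum>m\<in>keys p. single (additive_ext rees_exp m) (lookup p m))"
  unfolding subst_def
  by (simp add: rees_gen_eq power_mpoly_of_mon prod_mpoly_of_mon additive_ext_def[symmetric])
    (simp add: const_def mpoly_of_mon_def mult_single)

lemma rees_ideal_eq:
  "rees_ideal H = {p \<in> carrier (mpoly_ring (T_vars H)). subst rees_gen p = (0 :: (_, 'k::field) mpoly)}"
  by (auto simp: rees_ideal_def a_kernel_def' rees_algebra_def)

text \<open>The image of a monomial is recorded by its part in $S$ (\<open>vmon\<close>) and its degree in $t$
  (\<open>ydeg\<close>).\<close>

definition vertex_exp :: "'a + 'a set \<Rightarrow> 'a mon" where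
  "vertex_exp y = (case y of Inl v \<Rightarrow> single v 1 | Inr C \<Rightarrow> set_mon C)"

abbreviation vmon :: "('a + 'a set) mon \<Rightarrow> 'a mon" where
  "vmon \<equiv> additive_ext vertex_exp"

definition y_count :: "'a + 'a set \<Rightarrow> nat" where
  "y_count y = (case y of Inl _ \<Rightarrow> 0 | Inr _ \<Rightarrow> 1)"

abbreviation ydeg :: "('a + 'a set) mon \<Rightarrow> nat" where
  "ydeg \<equiv> additive_ext y_count"

lemma rees_exp_eq_iff:
  "additive_ext rees_exp s = additive_ext rees_exp t \<longleftrightarrow> vmon s = vmon t \<and> ydeg s = ydeg t"
proof -
  have "(\<lambda>y. lookup (rees_exp y) (Some v)) = (\<lambda>y. lookup (vertex_exp y) v)" for v :: 'a
    by (rule ext)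
      (auto simp: rees_exp_def vertex_exp_def lookup_add lookup_sum lookup_single set_mon_def when_def
        split: sum.split)
  then have v: "lookup (additive_ext rees_exp t) (Some v) = lookup (vmon t) v" for t :: "('a + 'a set) mon" and v
    by (simp add: lookup_additive_ext)
  have "(\<lambda>y :: 'a + 'a set. lookup (rees_exp y) None) = y_count"
    by (rule ext)
      (auto simp: rees_exp_def y_count_def lookup_add lookup_sum lookup_single split: sum.split)
  then have y: "lookup (additive_ext rees_exp t) None = ydeg t" for t :: "('a + 'a set) mon"
    by (simp add: lookup_additive_ext)
  show ?thesis
  proof
    assume "vmon s = vmon t \<and> ydeg s = ydeg t"
    then show "additive_ext rees_exp s = additive_ext rees_exp t"
      by (intro poly_mapping_eqI, case_tac k) (simp_all add: v y)
  qed (auto simp: v[symmetric] y[symmetric] intro: poly_mapping_eqI)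
qed

text \<open>These are the monomials of the initial ideal of the defining ideal of the Rees algebra, but the
  description by fibres does not involve the field.\<close>

definition nonstandard :: "'a ugraph \<Rightarrow> (('a + 'a set) mon \<times> ('a + 'a set) mon) set \<Rightarrow> ('a + 'a set) mon \<Rightarrow> bool" where
  "nonstandard H r t \<longleftrightarrow> t \<in> mons (T_vars H) \<and>
     (\<exists>s\<in>mons (T_vars H). vmon s = vmon t \<and> ydeg s = ydeg t \<and> (s, t) \<in> r)"

lemma nonstandard_add:
  assumes "monomial_order (T_vars H) r" "nonstandard H r t" "s \<in> mons (T_vars H)"
  shows "nonstandard H r (s + t)"
proof -
  obtain t' where "t' \<in> mons (T_vars H)" "vmon t' = vmon t" "ydeg t' = ydeg t" "(t', t) \<in> r"
    "t \<in> mons (T_vars H)"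
    using assms(2) by (auto simp: nonstandard_def)
  then show ?thesis using assms(1,3) unfolding nonstandard_def
    by (intro conjI bexI[of _ "s + t'"])
      (auto simp: additive_ext_add mons_add monomial_order_def add.commute[of s])
qed

text \<open>In the image of an element of the kernel, the contribution of the initial monomial has to
  cancel. This requires a second, smaller monomial in the same fibre.\<close>

lemma initial_mon_nonstandard:
  fixes f :: "(_, 'k::field) mpoly"
  assumes ord: "monomial_order (T_vars H) r" and f: "f \<in> rees_ideal H" "f \<noteq> 0"
  shows "nonstandard H r (initial_mon r f)"
proof -
  have fc: "f \<in> carrier (mpoly_ring (T_vars H))" and f0: "subst rees_gen f = 0"
    using f by (auto simp: rees_ideal_eq)
  let ?m = "initial_mon r f" and ?e = "additive_ext rees_exp"
  note m = initial_mon_props[OF ord fc f(2)]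
  have "\<exists>m'\<in>keys f. m' \<noteq> ?m \<and> ?e m' = ?e ?m"
  proof (rule ccontr)
    assume "\<not> ?thesis"
    then have "lookup (subst rees_gen f) (?e ?m) = (\<Sum>m'\<in>keys f. if m' = ?m then lookup f m' else 0)"
      unfolding subst_rees_gen lookup_sum
      by (intro sum.cong refl) (auto simp: lookup_single when_def)
    also have "\<dots> = lookup f ?m" using m(1) by simp
    finally show False using f0 m(1) by (simp add: in_keys_iff)
  qed
  then obtain m' where "m' \<in> keys f" "m' \<noteq> ?m" "?e m' = ?e ?m" by blast
  with m fc show ?thesis
    by (auto simp: nonstandard_def rees_exp_eq_iff carrier_mpoly)
qed

text \<open>
  The difference of two monomials in a fibre lies in the defining ideal, so that a nonstandard
  monomial is an initial monomial, hence a multiple of a quadratic generator of the initial ideal.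
  Conversely, this generator is a multiple of some initial monomial, and therefore nonstandard.
\<close>

lemma quadratic_nonstandard:
  assumes ord: "monomial_order (T_vars H) r"
    and quad: "has_quadratic_groebner_basis (T_vars H) r (rees_ideal H :: (_, 'k::field) mpoly set)"
    and t: "nonstandard H r t"
  shows "\<exists>s m. t = s + m \<and> mdeg m = 2 \<and> nonstandard H r m"
proof -
  let ?T = "T_vars H" and ?J = "rees_ideal H :: (_, 'k) mpoly set"
  obtain M where M: "M \<subseteq> {m \<in> mons ?T. mdeg m = 2}"
    "initial_ideal ?T r ?J = Idl\<^bsub>mpoly_ring ?T\<^esub> (mpoly_of_mon ` M)"
    using quad by (auto simp: has_quadratic_groebner_basis_def)
  have MT: "M \<subseteq> mons ?T" using M(1) by auto
  define L where "L = {initial_mon r f | f. f \<in> ?J \<and> f \<noteq> 0}"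
  have L: "nonstandard H r m" if "m \<in> L" for m
    using that initial_mon_nonstandard[OF ord] by (auto simp: L_def)
  then have LT: "L \<subseteq> mons ?T" by (auto simp: nonstandard_def)
  have gens: "{mpoly_of_mon (initial_mon r f) | f. f \<in> ?J \<and> f \<noteq> 0} = (mpoly_of_mon ` L :: (_, 'k) mpoly set)"
    unfolding L_def by blast
  have "mon_ideal ?T L = (mon_ideal ?T M :: (_, 'k) mpoly set)"
    using M(2) unfolding initial_ideal_def gens Idl_mon_ideal[OF MT] Idl_mon_ideal[OF LT] .
  then have in_iff: "m \<in> multiples L \<longleftrightarrow> m \<in> multiples M" if "m \<in> mons ?T" for m
    using mpoly_of_mon_in_mon_ideal[where 'k = 'k, of m ?T L]
      mpoly_of_mon_in_mon_ideal[where 'k = 'k, of m ?T M] that by simp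
  have tT: "t \<in> mons ?T" using t by (simp add: nonstandard_def)
  have "t \<in> L"
  proof -
    obtain s where s: "s \<in> mons ?T" "vmon s = vmon t" "ydeg s = ydeg t" "(s, t) \<in> r"
      using t by (auto simp: nonstandard_def)
    have st: "s \<noteq> t" "(t, s) \<notin> r" using ord s(4)
      by (auto simp: monomial_order_def strict_linear_order_on_def irrefl_def trans_def)
    define f where "f = mpoly_of_mon t - (mpoly_of_mon s :: (_, 'k) mpoly)"
    have keys_f: "keys f = {s, t}"
      using st by (auto simp: f_def in_keys_iff lookup_minus mpoly_of_mon_def lookup_single when_def
          split: if_splits)
    have f0: "f \<noteq> 0" using keys_f by auto
    have fc: "f \<in> carrier (mpoly_ring ?T)" using keys_f s(1) tT by (simp add: carrier_mpoly)
    have "lookup f s = - 1" "lookup f t = 1"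
      using st(1) by (auto simp: f_def lookup_minus mpoly_of_mon_def lookup_single)
    moreover have "additive_ext rees_exp s = additive_ext rees_exp t"
      using s(2,3) by (simp add: rees_exp_eq_iff)
    ultimately have "subst rees_gen f = 0"
      using st(1) by (simp add: subst_rees_gen keys_f single_uminus)
    then have "f \<in> ?J" using fc by (simp add: rees_ideal_eq)
    moreover have "initial_mon r f = t"
      using initial_mon_props[OF ord fc f0] keys_f st by auto
    ultimately show ?thesis using f0 by (auto simp: L_def)
  qed
  then have "t \<in> multiples M" using subset_multiples in_iff[OF tT] by blast
  then obtain s m where m: "m \<in> M" "t = s + m" by (auto simp: multiples_def)
  have mT: "m \<in> mons ?T" using m MT by auto
  have "m \<in> multiples L" using subset_multiples m(1) in_iff[OF mT] by blast
  then obtain s' l where l: "l \<in> L" "m = s' + l" by (auto simp: multiples_def)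
  then have "nonstandard H r m"
    using nonstandard_add[OF ord L[OF l(1)], of s'] mT by (simp add: mons_add_iff)
  with m M(1) show ?thesis by blast
qed

section \<open>Powers of a cover ideal with a quadratic Groebner basis\<close>

text \<open>A monomial of $T$ is a product of a monomial in the vertices and one in the cover variables.\<close>

definition x_mon :: "'a mon \<Rightarrow> ('a + 'a set) mon" where
  "x_mon = additive_ext (\<lambda>v. single (Inl v) 1)"

definition x_part :: "('a + 'a set) mon \<Rightarrow> 'a mon" where
  "x_part = additive_ext (\<lambda>y. case y of Inl v \<Rightarrow> single v 1 | Inr _ \<Rightarrow> 0)"

definition y_part :: "('a + 'a set) mon \<Rightarrow> ('a + 'a set) mon" where
  "y_part = restrict_mon (range Inr)"

lemma additive_ext_delta:
  assumes "\<And>y. g y = (if y = z then c else (0::nat))"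
  shows "additive_ext g t = lookup t z * c"
proof -
  have "additive_ext g t = (\<Sum>y\<in>keys t. if y = z then lookup t z * c else 0)"
    unfolding additive_ext_def by (intro sum.cong refl) (auto simp: assms)
  then show ?thesis by (auto simp: in_keys_iff)
qed

lemma additive_ext_cong: "(\<And>y. y \<in> keys t \<Longrightarrow> g y = h y) \<Longrightarrow> additive_ext g t = additive_ext h t"
  by (simp add: additive_ext_def)

lemma additive_ext_zero: "(\<And>y. y \<in> keys t \<Longrightarrow> g y = 0) \<Longrightarrow> additive_ext g t = 0"
  by (simp add: additive_ext_def)

lemma lookup_x_mon [simp]: "lookup (x_mon f) (Inl v) = lookup f v" "lookup (x_mon f) (Inr C) = 0"
  unfolding x_mon_def lookup_additive_ext
  by (subst additive_ext_delta[of _ v 1]; simp add: lookup_single when_def)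
    (simp add: lookup_single additive_ext_zero)

lemma lookup_x_part [simp]: "lookup (x_part t) v = lookup t (Inl v)"
  unfolding x_part_def lookup_additive_ext
  by (subst additive_ext_delta[of _ "Inl v" 1]) (auto simp: lookup_single when_def split: sum.split)

lemma lookup_y_part [simp]: "lookup (y_part t) (Inl v) = 0" "lookup (y_part t) (Inr C) = lookup t (Inr C)"
  by (auto simp: y_part_def lookup_restrict_mon)

lemma sum_mon_eqI:
  "(\<And>v. lookup s (Inl v) = lookup t (Inl v)) \<Longrightarrow> (\<And>C. lookup s (Inr C) = lookup t (Inr C)) \<Longrightarrow> s = t"
  by (rule poly_mapping_eqI) (metis sumE)

lemma xy_decomp: "x_mon (x_part t) + y_part t = t"
  by (rule sum_mon_eqI) (simp_all add: lookup_add)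

lemma x_mon_add: "x_mon (f + g) = x_mon f + x_mon g"
  by (simp add: x_mon_def additive_ext_add)

lemma x_mon_single: "x_mon (single v 1) = single (Inl v) 1"
  unfolding x_mon_def by (rule additive_ext_single)

lemma keys_x_mon: "keys (x_mon f) = Inl ` keys f"
proof -
  have "y \<in> keys (x_mon f) \<longleftrightarrow> y \<in> Inl ` keys f" for y :: "'a + 'a set"
    by (cases y) (auto simp: in_keys_iff)
  then show ?thesis by blast
qed

definition y_mons :: "'a ugraph \<Rightarrow> nat \<Rightarrow> ('a + 'a set) mon set" where
  "y_mons H c = {w. keys w \<subseteq> Inr ` minimal_vertex_covers H \<and> mdeg w = c}"

lemma mdeg_additive_ext: "mdeg t = additive_ext (\<lambda>_. 1) t"
  by (simp add: mdeg_def additive_ext_def)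

lemma ydeg_x_mon: "ydeg (x_mon f) = 0"
  by (rule additive_ext_zero) (auto simp: keys_x_mon y_count_def)

lemma vmon_x_mon: "vmon (x_mon f) = f"
proof (rule poly_mapping_eqI)
  fix v
  show "lookup (vmon (x_mon f)) v = lookup f v"
    unfolding lookup_additive_ext
    by (subst additive_ext_cong[of _ _ "\<lambda>y. if y = Inl v then 1 else 0"])
      (auto simp: keys_x_mon vertex_exp_def lookup_single additive_ext_delta when_def split: if_splits)
qed

lemma ydeg_y_mon: "keys w \<subseteq> range Inr \<Longrightarrow> ydeg w = mdeg w"
  unfolding mdeg_additive_ext by (rule additive_ext_cong) (auto simp: y_count_def)

lemma keys_y_part: "keys (y_part t) \<subseteq> range Inr"
  by (auto simp: y_part_def keys_restrict_mon)

lemma ydeg_y_part: "ydeg t = mdeg (y_part t)"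
proof -
  have "ydeg t = ydeg (x_mon (x_part t) + y_part t)" by (simp only: xy_decomp)
  also have "\<dots> = mdeg (y_part t)"
    by (simp add: additive_ext_add ydeg_x_mon ydeg_y_mon keys_y_part)
  finally show ?thesis .
qed

lemma mdeg_x_mon: "mdeg (x_mon f) = mdeg f"
proof -
  have "mdeg (x_mon f) = (\<Sum>y\<in>Inl ` keys f. lookup (x_mon f) y)"
    by (simp add: mdeg_def keys_x_mon)
  also have "\<dots> = mdeg f" by (subst sum.reindex) (auto simp: mdeg_def)
  finally show ?thesis .
qed

lemma mdeg_xy: "mdeg t = mdeg (x_part t) + ydeg t"
  by (metis xy_decomp mdeg_add mdeg_x_mon ydeg_y_part)

lemma vmon_xy: "vmon t = x_part t + vmon (y_part t)"
  by (metis xy_decomp additive_ext_add vmon_x_mon)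

lemma x_part_mons: "t \<in> mons (T_vars H) \<Longrightarrow> x_part t \<in> mons (verts H)"
proof -
  assume "t \<in> mons (T_vars H)"
  moreover have "Inl z \<in> keys t" if "z \<in> keys (x_part t)" for z
    using that by (simp add: in_keys_iff)
  ultimately show ?thesis by (fastforce simp: mons_def T_vars_def)
qed

lemma x_mon_mons: "x_mon f \<in> mons (T_vars H) \<longleftrightarrow> f \<in> mons (verts H)"
  by (auto simp: mons_def T_vars_def keys_x_mon)

lemma y_part_y_mons:
  assumes "t \<in> mons (T_vars H)"
  shows "y_part t \<in> y_mons H (ydeg t)"
proof -
  have "keys (y_part t) \<subseteq> Inr ` minimal_vertex_covers H"
    using assms by (auto simp: y_part_def keys_restrict_mon mons_def T_vars_def)
  then show ?thesis by (simp add: y_mons_def ydeg_y_part)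
qed

lemma y_mons_mons: "w \<in> y_mons H c \<Longrightarrow> w \<in> mons (T_vars H)"
  by (auto simp: y_mons_def mons_def T_vars_def)

lemma y_monsD:
  assumes "w \<in> y_mons H c"
  shows "ydeg w = c" "x_part w = 0" "y_part w = w"
proof -
  have k: "keys w \<subseteq> range Inr" using assms by (auto simp: y_mons_def)
  then show "ydeg w = c" using assms by (simp add: ydeg_y_mon y_mons_def)
  have 0: "lookup w (Inl v) = 0" for v using k by (auto simp: in_keys_iff)
  show "x_part w = 0" by (rule poly_mapping_eqI) (simp add: 0)
  show "y_part w = w" by (rule sum_mon_eqI) (simp_all add: 0)
qed

lemma y_part_x_add: "w \<in> y_mons H c \<Longrightarrow> y_part (x_mon f + w) = w"
  using y_monsD(3)[of w H c] by (intro sum_mon_eqI) (simp_all add: lookup_add, metis lookup_y_part(1))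

lemma y_mons_1: "w \<in> y_mons H 1 \<longleftrightarrow> (\<exists>C\<in>minimal_vertex_covers H. w = single (Inr C) 1)"
proof
  assume w: "w \<in> y_mons H 1"
  then have "w \<noteq> 0" by (auto simp: y_mons_def)
  then obtain y where y: "y \<in> keys w" by (metis ex_in_conv keys_eq_empty)
  then obtain C where C: "C \<in> minimal_vertex_covers H" "y = Inr C" using w by (auto simp: y_mons_def)
  have "1 + mdeg (w - single y 1) = 1"
    using single_split[OF y] w by (metis (mono_tags, lifting) mdeg_add mdeg_single mem_Collect_eq y_mons_def)
  then have "w - single y 1 = 0" by (simp add: mdeg_eq_0_iff)
  then show "\<exists>C\<in>minimal_vertex_covers H. w = single (Inr C) 1"
    using single_split[OF y] C by auto
qed (auto simp: y_mons_def)

lemma y_mons_add: "a \<in> y_mons H c \<Longrightarrow> b \<in> y_mons H d \<Longrightarrow> a + b \<in> y_mons H (c + d)"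
  by (auto simp: y_mons_def keys_add_mon mdeg_add)

lemma y_mons_diff: "a + b \<in> y_mons H c \<Longrightarrow> a \<in> y_mons H (mdeg a)"
  by (auto simp: y_mons_def keys_add_mon)

lemma vmon_y_mons: "vmon ` y_mons H c = sums_of (set_mon ` minimal_vertex_covers H) c"
proof (induction c)
  case 0
  have "y_mons H 0 = {0}" by (auto simp: y_mons_def mdeg_eq_0_iff)
  then show ?case by simp
next
  case (Suc c)
  have "vmon (single (Inr C) 1) = set_mon C" for C :: "'a set"
    by (simp add: additive_ext_single[unfolded One_nat_def] vertex_exp_def)
  moreover have "y_mons H (Suc c) = {w + single (Inr C) 1 | w C. w \<in> y_mons H c \<and> C \<in> minimal_vertex_covers H}"
  proof (intro equalityI subsetI)
    fix w assume w: "w \<in> y_mons H (Suc c)"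
    then have "w \<noteq> 0" by (auto simp: y_mons_def)
    then obtain y where y: "y \<in> keys w" by (metis ex_in_conv keys_eq_empty)
    then obtain C where C: "C \<in> minimal_vertex_covers H" "y = Inr C" using w by (auto simp: y_mons_def)
    have s: "w = (w - single y 1) + single y 1" using single_split[OF y] by (simp add: add.commute)
    then have "Suc (mdeg (w - single y 1)) = Suc c"
      using w by (metis (mono_tags, lifting) add.commute mdeg_add mdeg_single mem_Collect_eq plus_1_eq_Suc y_mons_def)
    then have "w - single y 1 \<in> y_mons H c"
      using y_mons_diff[of "w - single y 1" "single y 1" H "Suc c"] s w by simp
    with s C show "w \<in> {w + single (Inr C) 1 | w C. w \<in> y_mons H c \<and> C \<in> minimal_vertex_covers H}"
      by blast
  qed (use y_mons_add[of _ H c _ 1] y_mons_1 in fastforce)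
  ultimately show ?case
    unfolding sums_of.simps Suc.IH[symmetric]
    by (force simp: additive_ext_add image_iff simp del: One_nat_def)
qed

lemma minimal_cover_subset: "C \<in> minimal_vertex_covers H \<Longrightarrow> C \<subseteq> verts H"
  by (auto simp: minimal_vertex_covers_def vertex_cover_def)

lemma cover_monomials_mons:
  assumes "finite (verts H)"
  shows "set_mon ` minimal_vertex_covers H \<subseteq> mons (verts H)"
proof safe
  fix C assume "C \<in> minimal_vertex_covers H"
  then have "C \<subseteq> verts H" by (rule minimal_cover_subset)
  then show "set_mon C \<in> mons (verts H)"
    using finite_subset[OF _ assms, of C] by (simp add: mons_def keys_set_mon)
qed

text \<open>If $g = 1$, then $z u_C = u_D$ is squarefree, so \<open>C\<close> is a proper subset of the minimal
  cover \<open>D\<close>.\<close>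

lemma cover_exchange_nontrivial:
  assumes fin: "finite (verts H)" and C: "C \<in> minimal_vertex_covers H" "D \<in> minimal_vertex_covers H"
    and eq: "single z 1 + set_mon C = g + set_mon D"
  shows "g \<noteq> 0"
proof
  assume "g = 0"
  have fC: "finite C" "finite D" using C minimal_cover_subset finite_subset fin by blast+
  have eq: "(if z = v then 1 else 0) + (if v \<in> C then 1 else 0) = (if v \<in> D then 1 else (0::nat))" for v
  proof -
    have "lookup (single z 1 + set_mon C) v = lookup (set_mon D) v" using eq \<open>g = 0\<close> by simp
    then show ?thesis
      by (simp only: lookup_add lookup_set_mon[OF fC(1)] lookup_set_mon[OF fC(2)] lookup_single when_def)
  qed
  have "C \<subset> D"
  proof
    show "C \<subseteq> D"
    proof
      fix v assume "v \<in> C"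
      then show "v \<in> D" using eq[of v] by (simp split: if_splits)
    qed
    show "C \<noteq> D"
      using eq[of z] by (auto split: if_splits)
  qed
  then show False using C by (auto simp: minimal_vertex_covers_def)
qed

text \<open>
  The indices are the standard monomials in the cover variables. Quadratic generation of the
  initial ideal enters twice. It implies that \<open>f w\<close> is standard as soon as \<open>z w\<close> is standard
  for every variable \<open>z\<close> of \<open>f\<close>, so that the pieces consist of standard monomials; and it
  reduces a nonstandard \<open>z w\<close> to the exchange of a single cover, where minimality applies.
\<close>

theorem cover_powers_lq_system:
  fixes H :: "'a ugraph"
  assumes H: "finite_simple_graph H"
    and ord: "monomial_order (T_vars H) r"
    and quad: "has_quadratic_groebner_basis (T_vars H) r (rees_ideal H :: ('a + 'a set, 'k::field) mpoly set)"
  shows "\<exists>N Q (\<rho> :: 'a mon \<Rightarrow> nat). lq_system (verts H) N (\<lambda>m. m) Q \<rho> \<and>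
    N \<subseteq> sums_of (set_mon ` minimal_vertex_covers H) c \<and>
    sums_of (set_mon ` minimal_vertex_covers H) c \<subseteq> multiples N"
proof -
  let ?V = "verts H" and ?T = "T_vars H"
  let ?ns = "nonstandard H r"
  have finV: "finite ?V" using H by (simp add: finite_simple_graph_def)
  have "minimal_vertex_covers H \<subseteq> Pow ?V" using minimal_cover_subset by blast
  then have finT: "finite ?T"
    using finV by (auto simp: T_vars_def intro: finite_subset)
  have tr: "trans r" and irr: "irrefl r" and tot: "total_on (mons ?T) r"
    using ord by (auto simp: monomial_order_def strict_linear_order_on_def)
  have ord_add: "(a + d, b + d) \<in> r" if "(a, b) \<in> r" "a \<in> mons ?T" "b \<in> mons ?T" "d \<in> mons ?T" for a b d
    using ord that by (auto simp: monomial_order_def)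
  have std_unique: "s = t" if "s \<in> mons ?T" "t \<in> mons ?T" "vmon s = vmon t" "ydeg s = ydeg t" "\<not> ?ns s" "\<not> ?ns t" for s t
    using that tot unfolding nonstandard_def total_on_def by metis
  have std_exists: "\<exists>s\<in>mons ?T. vmon s = vmon t \<and> ydeg s = ydeg t \<and> \<not> ?ns s \<and> (s = t \<or> (s, t) \<in> r)"
    if t: "t \<in> mons ?T" for t
  proof -
    \<comment> \<open>The fibre is finite since the image bounds the degree.\<close>
    define F where "F = {s \<in> mons ?T. vmon s = vmon t \<and> ydeg s = ydeg t}"
    have "mdeg s \<le> mdeg (vmon t) + ydeg t" if "s \<in> F" for s
      using that mdeg_xy[of s] arg_cong[OF vmon_xy[of s], of mdeg] by (simp add: F_def mdeg_add)
    then have "lookup s v \<le> mdeg (vmon t) + ydeg t" if "s \<in> F" for s v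
      using that lookup_le_mdeg[of s v] by (meson order_trans)
    then have "F \<subseteq> {s \<in> mons ?T. \<forall>v. lookup s v \<le> mdeg (vmon t) + ydeg t}"
      by (auto simp: F_def)
    then have finF: "finite F" using finite_bounded_mons[OF finT] finite_subset by blast
    have tF: "t \<in> F" using t by (simp add: F_def)
    have "strict_linear_order_on (mons ?T) (r\<inverse>)"
      using tr irr tot by (auto simp: strict_linear_order_on_def irrefl_def total_on_def)
    then have "\<exists>!m. m \<in> F \<and> (\<forall>m'\<in>F. m' \<noteq> m \<longrightarrow> (m', m) \<in> r\<inverse>)"
      by (rule finite_linear_order_max) (use finF tF in \<open>auto simp: F_def\<close>)
    then obtain m where m: "m \<in> F" "\<And>m'. m' \<in> F \<Longrightarrow> m' \<noteq> m \<Longrightarrow> (m, m') \<in> r" by auto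
    have "\<not> ?ns m"
    proof
      assume "?ns m"
      then obtain s where s: "s \<in> F" "(s, m) \<in> r"
        using m(1) by (auto simp: nonstandard_def F_def)
      then have "s \<noteq> m" using irr by (auto simp: irrefl_def)
      then show False using m(2)[OF s(1)] s(2) tr irr by (meson irreflD transD)
    qed
    moreover have "m = t \<or> (m, t) \<in> r" using m(2)[OF tF] by auto
    ultimately show ?thesis using m(1) by (auto simp: F_def)
  qed
  have ns_mult: "?ns (s + t)" if "?ns t" "s \<in> mons ?T" for s t
    using nonstandard_add[OF ord that] .
  define W where "W = {w \<in> y_mons H c. \<not> ?ns w}"
  define Q where "Q w = {z \<in> ?V. ?ns (single (Inl z) 1 + w)}" for w
  have WD: "w \<in> y_mons H c" "w \<in> mons ?T" "\<not> ?ns w" if "w \<in> W" for w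
    using that y_mons_mons by (auto simp: W_def)
  (* The quadratic divisor m of f w is neither in the vertices alone (its fibre is a single
     monomial) nor in the cover variables alone (it would divide w), so it is some z y_C. *)
  have quad_case: "\<exists>z C. z \<in> keys f \<and> C \<in> minimal_vertex_covers H \<and> Inr C \<in> keys w \<and> ?ns (single (Inl z) 1 + single (Inr C) 1)"
    if w: "w \<in> W" and ns: "?ns (x_mon f + w)" for f w
  proof -
    obtain s m where m: "x_mon f + w = s + m" "mdeg m = 2" "?ns m"
      using quadratic_nonstandard[OF ord quad ns] by blast
    have smT: "s \<in> mons ?T" "m \<in> mons ?T"
      using ns m(1) by (auto simp: nonstandard_def mons_add_iff)
    have deg: "mdeg (x_part m) + ydeg m = 2" using mdeg_xy[of m] m(2) by simp
    have "ydeg m \<noteq> 0"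
    proof
      assume y0: "ydeg m = 0"
      obtain t where t: "vmon t = vmon m" "ydeg t = ydeg m" "(t, m) \<in> r"
        using m(3) by (auto simp: nonstandard_def)
      have "y_part m = 0" "y_part t = 0" using y0 t(2) by (auto simp: ydeg_y_part mdeg_eq_0_iff)
      then have "x_part t = x_part m" using t(1) vmon_xy[of t] vmon_xy[of m] by simp
      then have "t = m" using xy_decomp[of t] xy_decomp[of m] \<open>y_part m = 0\<close> \<open>y_part t = 0\<close> by simp
      then show False using t(3) irr by (auto simp: irrefl_def)
    qed
    moreover have y_le: "w = y_part s + y_part m"
    proof -
      have "w = y_part (s + m)" using y_part_x_add[OF WD(1)[OF w], of f] m(1) by simp
      also have "\<dots> = y_part s + y_part m" by (rule sum_mon_eqI) (simp_all add: lookup_add)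
      finally show ?thesis .
    qed
    have "ydeg m \<noteq> 2"
    proof
      assume "ydeg m = 2"
      then have "x_part m = 0" using deg by (simp add: mdeg_eq_0_iff)
      then have "y_part m = m" using xy_decomp[of m] by (simp add: x_mon_def)
      moreover have "y_part s \<in> mons ?T" using y_part_y_mons[OF smT(1)] y_mons_mons by blast
      ultimately have "?ns w" using y_le ns_mult[OF m(3)] by simp
      then show False using WD(3)[OF w] by simp
    qed
    ultimately have 1: "ydeg m = 1" "mdeg (x_part m) = 1" using deg by auto
    obtain C where C: "C \<in> minimal_vertex_covers H" "y_part m = single (Inr C) 1"
      using y_part_y_mons[OF smT(2)] 1(1) y_mons_1 by fastforce
    have "x_part m \<noteq> 0" using 1(2) by auto
    then obtain z where z: "z \<in> keys (x_part m)" by (metis ex_in_conv keys_eq_empty)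
    have "1 + mdeg (x_part m - single z 1) = 1"
      using single_split[OF z] 1(2) by (metis mdeg_add mdeg_single)
    then have "x_part m = single z 1"
      using single_split[OF z] by (simp add: mdeg_eq_0_iff)
    then have m_eq: "m = single (Inl z) 1 + single (Inr C) 1"
      using xy_decomp[of m] C(2) x_mon_single[of z] by simp
    have "lookup (x_mon f + w) (Inl z) = lookup f z"
      using y_monsD(2)[OF WD(1)[OF w]] by (simp add: lookup_add) (metis lookup_x_part lookup_zero)
    then have "lookup f z \<noteq> 0" unfolding m(1) by (simp add: m_eq lookup_add)
    moreover have "Inr C \<in> keys w" unfolding y_le C(2) by (simp add: keys_add_mon)
    ultimately show ?thesis using C(1) m(3) m_eq by (auto simp: in_keys_iff)
  qed
  define R where "R w2 w \<longleftrightarrow> (\<exists>f\<in>mons ?V. \<exists>g\<in>mons ?V.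
    f + vmon w = g + vmon w2 \<and> (x_mon g + w2, x_mon f + w) \<in> r)" for w2 w
  have R_irr: "\<not> R w w" for w using irr by (auto simp: R_def irrefl_def)
  have R_trans: "R w3 w1" if R32: "R w3 w2" and R21: "R w2 w1" and W: "w1 \<in> W" "w2 \<in> W" "w3 \<in> W" for w1 w2 w3
  proof -
    obtain f2 g2 where 2: "f2 \<in> mons ?V" "g2 \<in> mons ?V" "f2 + vmon w2 = g2 + vmon w3"
      "(x_mon g2 + w3, x_mon f2 + w2) \<in> r" using R32 by (auto simp: R_def)
    obtain f1 g1 where 1: "f1 \<in> mons ?V" "g1 \<in> mons ?V" "f1 + vmon w1 = g1 + vmon w2"
      "(x_mon g1 + w2, x_mon f1 + w1) \<in> r" using R21 by (auto simp: R_def)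
    have T: "x_mon f1 \<in> mons ?T" "x_mon f2 \<in> mons ?T" "x_mon g1 \<in> mons ?T" "x_mon g2 \<in> mons ?T"
      using 1 2 by (auto simp: x_mon_mons)
    have "((x_mon g2 + w3) + x_mon g1, (x_mon f2 + w2) + x_mon g1) \<in> r"
      using 2 T WD(2) W by (intro ord_add) (auto simp: mons_add)
    moreover have "((x_mon g1 + w2) + x_mon f2, (x_mon f1 + w1) + x_mon f2) \<in> r"
      using 1 T WD(2) W by (intro ord_add) (auto simp: mons_add)
    moreover have "(x_mon f2 + w2) + x_mon g1 = (x_mon g1 + w2) + x_mon f2"
      by (simp add: ac_simps)
    ultimately have "((x_mon g2 + w3) + x_mon g1, (x_mon f1 + w1) + x_mon f2) \<in> r"
      using transD[OF tr] by simp
    then have "(x_mon (g1 + g2) + w3, x_mon (f1 + f2) + w1) \<in> r"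
      by (simp add: x_mon_add ac_simps)
    moreover have "(f1 + f2) + vmon w1 = (g1 + g2) + vmon w3"
    proof -
      have "(f1 + f2) + vmon w1 = (f1 + vmon w1) + f2" by (simp add: ac_simps)
      also have "\<dots> = g1 + (f2 + vmon w2)" unfolding 1(3) by (simp add: ac_simps)
      also have "\<dots> = (g1 + g2) + vmon w3" unfolding 2(3) by (simp add: ac_simps)
      finally show ?thesis .
    qed
    moreover have "f1 + f2 \<in> mons ?V" "g1 + g2 \<in> mons ?V"
      using 1(1,2) 2(1,2) by (simp_all add: mons_add)
    ultimately show ?thesis unfolding R_def by blast
  qed
  \<comment> \<open>A finite strict order is turned into a rank by counting predecessors.\<close>
  define \<rho> where "\<rho> w = card {w' \<in> W. R w' w}" for w
  have finW: "finite W"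
    by (rule finite_subset[OF _ finite_mons_of_mdeg[OF finT, of c]])
      (use WD(2) in \<open>auto simp: W_def y_mons_def\<close>)
  have \<rho>_less: "\<rho> w2 < \<rho> w" if "R w2 w" "w2 \<in> W" "w \<in> W" for w2 w
    unfolding \<rho>_def
  proof (rule psubset_card_mono)
    show "{w' \<in> W. R w' w2} \<subset> {w' \<in> W. R w' w}"
      using that R_trans R_irr by blast
  qed (use finW in simp)
  have lq: "lq_system ?V W vmon Q \<rho>"
  proof (rule lq_systemI)
    fix w assume "w \<in> W"
    then have "vmon w \<in> sums_of (set_mon ` minimal_vertex_covers H) c"
      using WD(1) vmon_y_mons[of H c] by blast
    then show "vmon w \<in> mons ?V" using sums_of_mons[OF cover_monomials_mons[OF finV]] by blast
  next
    fix w z assume w: "w \<in> W" and z: "z \<in> Q w"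
    then have "?ns (x_mon (single z 1) + w)" and zV: "z \<in> ?V"
      by (auto simp: Q_def x_mon_single simp del: One_nat_def)
    from quad_case[OF w this(1)] obtain C where C: "C \<in> minimal_vertex_covers H" "Inr C \<in> keys w"
      "?ns (single (Inl z) 1 + single (Inr C) 1)" by auto
    let ?m = "single (Inl z) 1 + single (Inr C) 1"
    have vm: "vmon ?m = single z 1 + set_mon C"
      unfolding additive_ext_add additive_ext_single by (simp add: vertex_exp_def)
    have ym: "ydeg ?m = 1"
      unfolding additive_ext_add additive_ext_single by (simp add: y_count_def)
    obtain t where t: "t \<in> mons ?T" "vmon t = vmon ?m" "ydeg t = 1" "(t, ?m) \<in> r" "?m \<in> mons ?T"
      using C(3) ym by (auto simp: nonstandard_def simp del: One_nat_def)
    obtain D where D: "D \<in> minimal_vertex_covers H" "y_part t = single (Inr D) 1"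
      using y_part_y_mons[OF t(1)] t(3) y_mons_1 by fastforce
    define g where "g = x_part t"
    have gV: "g \<in> mons ?V" using x_part_mons[OF t(1)] by (simp add: g_def)
    have t_eq: "t = x_mon g + single (Inr D) 1"
      using xy_decomp[of t] D(2) by (simp add: g_def)
    have vt: "vmon t = g + set_mon D"
      unfolding t_eq additive_ext_add additive_ext_single by (simp add: vmon_x_mon vertex_exp_def)
    have g0: "g \<noteq> 0"
      using cover_exchange_nontrivial[OF finV C(1) D(1), of z g] t(2) vm vt by simp
    define w0 where "w0 = w - single (Inr C) 1"
    have w_eq: "w = single (Inr C) 1 + w0" using single_split[OF C(2)] by (simp add: w0_def)
    have w0: "w0 \<in> y_mons H (mdeg w0)"
      using y_mons_diff[of w0 "single (Inr C) 1" H c] WD(1)[OF w] w_eq by (simp add: add.commute)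
    have "Suc (mdeg w0) = c"
      using WD(1)[OF w] unfolding w_eq by (auto simp: y_mons_def mdeg_add)
    then have w1: "single (Inr D) 1 + w0 \<in> y_mons H c"
      using y_mons_add[OF _ w0, of "single (Inr D) 1" 1] y_mons_1 D(1) by auto
    let ?w1 = "single (Inr D) 1 + w0"
    \<comment> \<open>After the exchange of C for D the product of covers may be nonstandard, so it is reduced once more.\<close>
    obtain t2 where t2: "t2 \<in> mons ?T" "vmon t2 = vmon ?w1" "ydeg t2 = c" "\<not> ?ns t2"
      "t2 = ?w1 \<or> (t2, ?w1) \<in> r"
      using std_exists[OF y_mons_mons[OF w1]] y_monsD(1)[OF w1] by auto
    define h where "h = x_part t2"
    define w2 where "w2 = y_part t2"
    have hV: "h \<in> mons ?V" using x_part_mons[OF t2(1)] by (simp add: h_def)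
    have t2_eq: "t2 = x_mon h + w2" by (simp add: h_def w2_def xy_decomp)
    have "\<not> ?ns w2"
    proof
      assume "?ns w2"
      then have "?ns (x_mon h + w2)" by (rule ns_mult) (simp add: x_mon_mons hV)
      with t2(4) show False by (simp flip: t2_eq)
    qed
    moreover have "w2 \<in> y_mons H c"
      using y_part_y_mons[OF t2(1)] unfolding w2_def t2(3) .
    ultimately have w2W: "w2 \<in> W" by (simp add: W_def)
    have w0T: "w0 \<in> mons ?T" by (rule y_mons_mons[OF w0])
    have xgT: "x_mon g \<in> mons ?T" using gV by (simp add: x_mon_mons)
    have "(t + w0, ?m + w0) \<in> r" by (rule ord_add[OF t(4,1,5) w0T])
    then have r1: "(x_mon g + ?w1, x_mon (single z 1) + w) \<in> r"
      unfolding t_eq w_eq x_mon_single by (simp add: add.assoc)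
    have r2: "(x_mon (g + h) + w2, x_mon (single z 1) + w) \<in> r"
    proof (cases "t2 = ?w1")
      case True
      then show ?thesis using r1 t2_eq by (simp add: x_mon_add add.assoc)
    next
      case False
      then have "(t2 + x_mon g, ?w1 + x_mon g) \<in> r"
        using t2(1,5) y_mons_mons[OF w1] xgT by (intro ord_add) auto
      then have "(x_mon (g + h) + w2, x_mon g + ?w1) \<in> r"
        unfolding t2_eq x_mon_add by (simp add: ac_simps)
      then show ?thesis using r1 tr by (metis transD)
    qed
    have "single z 1 + vmon w = (single z 1 + set_mon C) + vmon w0"
      unfolding w_eq additive_ext_add additive_ext_single by (simp add: vertex_exp_def add.assoc)
    also have "\<dots> = g + (set_mon D + vmon w0)"
      using t(2) unfolding vm vt by (simp flip: add.assoc)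
    also have "set_mon D + vmon w0 = vmon ?w1"
      unfolding additive_ext_add additive_ext_single by (simp add: vertex_exp_def)
    also have "vmon ?w1 = h + vmon w2"
      using t2(2) unfolding t2_eq additive_ext_add vmon_x_mon by simp
    finally have eq: "single z 1 + vmon w = (g + h) + vmon w2" by (simp add: add.assoc)
    have "R w2 w"
      unfolding R_def using eq r2 gV hV zV
      by (intro bexI[of _ "single z 1"] bexI[of _ "g + h"]) (auto simp: mons_add mons_single)
    with \<rho>_less w w2W eq g0
    show "\<exists>j\<in>W. \<exists>g. g \<noteq> 0 \<and> single z 1 + vmon w = g + vmon j \<and> \<rho> j < \<rho> w"
      by (intro bexI[of _ w2] exI[of _ "g + h"]) (auto simp: add_eq_0_mon)
  next
    fix w w' f h
    assume w: "w \<in> W" "w' \<in> W" and fh: "f \<in> mons ?V" "h \<in> mons ?V" "f + vmon w = h + vmon w'"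
      "keys f \<inter> Q w = {}" "keys h \<inter> Q w' = {}"
    have std: "\<not> ?ns (x_mon f + w)" if "w \<in> W" "f \<in> mons ?V" "keys f \<inter> Q w = {}" for f w
    proof
      assume "?ns (x_mon f + w)"
      from quad_case[OF that(1) this] obtain z C where zC: "z \<in> keys f" "Inr C \<in> keys w"
        "?ns (single (Inl z) 1 + single (Inr C) 1)" by blast
      have "w - single (Inr C) 1 \<in> mons ?T"
        using WD(2)[OF that(1)] single_split[OF zC(2)] by (metis mons_add_iff)
      then have "?ns ((w - single (Inr C) 1) + (single (Inl z) 1 + single (Inr C) 1))"
        by (rule ns_mult[OF zC(3)])
      then have "?ns (single (Inl z) 1 + w)"
        using single_split[OF zC(2)] by (metis add.assoc add.commute)
      moreover have "z \<in> ?V" using zC(1) that(2) by (auto simp: mons_def)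
      ultimately show False using that(3) zC(1) by (auto simp: Q_def)
    qed
    have "x_mon f + w = x_mon h + w'"
    proof (rule std_unique)
      show "x_mon f + w \<in> mons ?T" "x_mon h + w' \<in> mons ?T"
        using fh w WD(2) by (auto simp: mons_add x_mon_mons)
      show "vmon (x_mon f + w) = vmon (x_mon h + w')"
        using fh(3) by (simp add: additive_ext_add vmon_x_mon)
      show "ydeg (x_mon f + w) = ydeg (x_mon h + w')"
        using y_monsD(1)[OF WD(1)] w by (simp add: additive_ext_add ydeg_x_mon)
    qed (use std w fh in auto)
    then show "w = w'"
      using y_part_x_add[OF WD(1)[OF w(1)], of f] y_part_x_add[OF WD(1)[OF w(2)], of h] by simp
  qed (use finW in \<open>auto simp: Q_def\<close>)
  have "vmon ` W \<subseteq> sums_of (set_mon ` minimal_vertex_covers H) c"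
    unfolding vmon_y_mons[symmetric] W_def by blast
  moreover have "sums_of (set_mon ` minimal_vertex_covers H) c \<subseteq> multiples (vmon ` W)"
    unfolding vmon_y_mons[symmetric]
  proof safe
    fix w assume w: "w \<in> y_mons H c"
    obtain t where t: "t \<in> mons ?T" "vmon t = vmon w" "ydeg t = c" "\<not> ?ns t"
      using std_exists[OF y_mons_mons[OF w]] y_monsD(1)[OF w] by auto
    have "\<not> ?ns (y_part t)"
      using ns_mult[of "y_part t" "x_mon (x_part t)"] x_part_mons[OF t(1)] t(4)
      by (auto simp: x_mon_mons xy_decomp)
    then have "y_part t \<in> W" using y_part_y_mons[OF t(1)] t(3) by (simp add: W_def)
    then show "vmon w \<in> multiples (vmon ` W)"
      using vmon_xy[of t] t(2) multiples_I[of "vmon (y_part t)" "vmon ` W" "x_part t"] by auto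
  qed
  ultimately show ?thesis
    using lq_system_reindex[OF lq] by blast
qed

section \<open>Vertex covers of the composed graph\<close>

lemma cover_ideal_eq:
  assumes "finite (verts G)"
  shows "cover_ideal G = mon_ideal (verts G) (set_mon ` minimal_vertex_covers G)"
  using Idl_mon_ideal[OF cover_monomials_mons[OF assms]]
  by (simp add: cover_ideal_def prod_var set_mon_def image_image)

lemma set_mon_Un: "finite A \<Longrightarrow> finite B \<Longrightarrow> A \<inter> B = {} \<Longrightarrow> set_mon (A \<union> B) = set_mon A + set_mon B"
  unfolding set_mon_def by (rule sum.union_disjoint)

definition fill :: "nat \<Rightarrow> 'v set \<Rightarrow> 'v mon" where
  "fill c X = (\<Sum>z\<in>X. single z c)"

lemma lookup_fill: "finite X \<Longrightarrow> lookup (fill c X) z = (if z \<in> X then c else 0)"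
  by (auto simp: fill_def lookup_sum lookup_single when_def)

lemma fill_Suc: "fill (Suc c) X = fill c X + set_mon X"
proof -
  have "single z (Suc c) = single z c + single z 1" for z :: 'a
    by (simp flip: single_add)
  then show ?thesis by (simp only: fill_def set_mon_def sum.distrib)
qed

text \<open>Omitting one vertex from the set of all vertices leaves a cover, because edges have two ends.\<close>

lemma minimal_cover_proper:
  assumes H: "finite_simple_graph H" and ne: "verts H \<noteq> {}" and C: "C \<in> minimal_vertex_covers H"
  shows "C \<subset> verts H"
proof
  show "C \<subseteq> verts H" using C by (rule minimal_cover_subset)
  show "C \<noteq> verts H"
  proof
    assume CV: "C = verts H"
    obtain v where v: "v \<in> verts H" using ne by auto
    have "vertex_cover H (verts H - {v})"
      unfolding vertex_cover_def
    proof (intro conjI ballI)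
      fix e assume "e \<in> edges H"
      then have e: "e \<subseteq> verts H" "card e = 2" using H by (auto simp: finite_simple_graph_def)
      then have "\<not> e \<subseteq> {v}" using card_mono[of "{v}" e] by auto
      with e(1) show "e \<inter> (verts H - {v}) \<noteq> {}" by auto
    qed auto
    then show False using C v CV by (auto simp: minimal_vertex_covers_def)
  qed
qed

lemma minimal_cover_exists:
  assumes fin: "finite (verts H)" and "vertex_cover H D"
  shows "\<exists>C \<subseteq> D. C \<in> minimal_vertex_covers H"
proof -
  have "finite D" using assms finite_subset by (auto simp: vertex_cover_def)
  then show ?thesis using assms(2)
  proof (induction rule: finite_psubset_induct)
    case (psubset D)
    show ?case
    proof (cases "D \<in> minimal_vertex_covers H")
      case False
      then obtain E where "E \<subset> D" "vertex_cover H E"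
        using psubset.prems by (auto simp: minimal_vertex_covers_def)
      with psubset.IH[of E] show ?thesis by blast
    qed blast
  qed
qed

locale attached_graphs =
  fixes n :: nat and x :: "nat \<Rightarrow> 'a" and G :: "'a ugraph" and H :: "nat \<Rightarrow> 'a ugraph"
  assumes graph_G: "finite_simple_graph G"
    and bij: "bij_betw x {1..n} (verts G)"
    and graph_H: "\<And>i. i \<in> {1..n} \<Longrightarrow> finite_simple_graph (H i)"
    and nonempty: "\<And>i. i \<in> {1..n} \<Longrightarrow> verts (H i) \<noteq> {}"
    and disj_G: "\<And>i. i \<in> {1..n} \<Longrightarrow> verts G \<inter> verts (H i) = {}"
    and disj_H: "\<And>i j. i \<in> {1..n} \<Longrightarrow> j \<in> {1..n} \<Longrightarrow> i \<noteq> j \<Longrightarrow> verts (H i) \<inter> verts (H j) = {}"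
begin

abbreviation "GH \<equiv> attach n x G H"

lemma finite_G: "finite (verts G)" and finite_H: "i \<in> {1..n} \<Longrightarrow> finite (verts (H i))"
  using graph_G graph_H by (auto simp: finite_simple_graph_def)

lemma x_in: "i \<in> {1..n} \<Longrightarrow> x i \<in> verts G"
  using bij by (auto simp: bij_betw_def)

lemma x_inj: "i \<in> {1..n} \<Longrightarrow> j \<in> {1..n} \<Longrightarrow> x i = x j \<longleftrightarrow> i = j"
  by (rule inj_on_eq_iff[OF bij_betw_imp_inj_on[OF bij]])

lemma x_notin_H: "i \<in> {1..n} \<Longrightarrow> j \<in> {1..n} \<Longrightarrow> x i \<notin> verts (H j)"
  using x_in[of i] disj_G[of j] by auto

lemma verts_GH: "verts GH = verts G \<union> (\<Union>i\<in>{1..n}. verts (H i))"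
  by (simp add: attach_def)

lemma finite_GH: "finite (verts GH)"
  using finite_G finite_H by (auto simp: verts_GH)

lemma edges_GH: "edges GH = edges G \<union> (\<Union>i\<in>{1..n}. edges (H i)) \<union>
    {{x i, z} | i z. i \<in> {1..n} \<and> z \<in> verts (H i)}"
  by (simp add: attach_def)

lemma edge_G: "e \<in> edges G \<Longrightarrow> e \<subseteq> verts G"
  using graph_G by (auto simp: finite_simple_graph_def)

lemma edge_H: "i \<in> {1..n} \<Longrightarrow> e \<in> edges (H i) \<Longrightarrow> e \<subseteq> verts (H i)"
  using graph_H by (auto simp: finite_simple_graph_def)

lemma vertex_cover_GH_iff:
  "vertex_cover GH C \<longleftrightarrow> C \<subseteq> verts GH \<and> vertex_cover G (C \<inter> verts G) \<and>
    (\<forall>i\<in>{1..n}. vertex_cover (H i) (C \<inter> verts (H i)) \<and> (x i \<notin> C \<longrightarrow> verts (H i) \<subseteq> C))"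
  (is "_ \<longleftrightarrow> ?R")
proof
  assume C: "vertex_cover GH C"
  then have e: "\<And>e. e \<in> edges GH \<Longrightarrow> e \<inter> C \<noteq> {}" by (auto simp: vertex_cover_def)
  have "e \<inter> (C \<inter> verts G) \<noteq> {}" if "e \<in> edges G" for e
    using e[of e] edge_G[OF that] that by (auto simp: edges_GH)
  moreover have "e \<inter> (C \<inter> verts (H i)) \<noteq> {}" if "i \<in> {1..n}" "e \<in> edges (H i)" for e i
    using e[of e] edge_H[OF that] that unfolding edges_GH by blast
  moreover have "z \<in> C" if "i \<in> {1..n}" "x i \<notin> C" "z \<in> verts (H i)" for i z
    using e[of "{x i, z}"] that unfolding edges_GH by blast
  ultimately show ?R using C by (auto simp: vertex_cover_def)
next
  assume R: ?R
  have "e \<inter> C \<noteq> {}" if e: "e \<in> edges GH" for e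
  proof -
    consider "e \<in> edges G" | i where "i \<in> {1..n}" "e \<in> edges (H i)"
      | i z where "i \<in> {1..n}" "z \<in> verts (H i)" "e = {x i, z}"
      using e unfolding edges_GH by blast
    then show ?thesis
    proof cases
      case 1
      then show ?thesis using R by (auto simp: vertex_cover_def)
    next
      case 2
      then have "e \<inter> (C \<inter> verts (H i)) \<noteq> {}" using R unfolding vertex_cover_def by blast
      then show ?thesis by auto
    next
      case 3
      then show ?thesis using R by auto
    qed
  qed
  with R show "vertex_cover GH C" by (auto simp: vertex_cover_def)
qed

definition big_cover :: "'a set \<Rightarrow> (nat \<Rightarrow> 'a set) \<Rightarrow> 'a set" where
  "big_cover W D = W \<union> (\<Union>i\<in>{1..n}. if x i \<in> W then D i else verts (H i))"

lemma big_cover_Int_G: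
  assumes "W \<subseteq> verts G" "\<And>i. i \<in> {1..n} \<Longrightarrow> x i \<in> W \<Longrightarrow> D i \<subseteq> verts (H i)"
  shows "big_cover W D \<inter> verts G = W"
proof -
  have X: "v \<notin> verts G" if "i \<in> {1..n}" "v \<in> (if x i \<in> W then D i else verts (H i))" for i v
    using assms(2)[OF that(1)] disj_G[OF that(1)] that(2) by (auto split: if_splits)
  show ?thesis
  proof (intro equalityI subsetI)
    fix v assume v: "v \<in> big_cover W D \<inter> verts G"
    then consider "v \<in> W" | i where "i \<in> {1..n}" "v \<in> (if x i \<in> W then D i else verts (H i))"
      unfolding big_cover_def by blast
    then show "v \<in> W" using v X by cases auto
  qed (use assms(1) in \<open>auto simp: big_cover_def\<close>)
qed

lemma big_cover_Int_H:
  assumes "W \<subseteq> verts G" "\<And>i. i \<in> {1..n} \<Longrightarrow> x i \<in> W \<Longrightarrow> D i \<subseteq> verts (H i)" "j \<in> {1..n}"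
  shows "big_cover W D \<inter> verts (H j) = (if x j \<in> W then D j else verts (H j))"
proof -
  let ?X = "\<lambda>i. if x i \<in> W then D i else verts (H i)"
  have "W \<inter> verts (H j) = {}" using assms(1) disj_G[OF assms(3)] by auto
  moreover have "?X i \<inter> verts (H j) = {}" if "i \<in> {1..n}" "i \<noteq> j" for i
    using assms(2)[OF that(1)] disj_H[OF that(1) assms(3) that(2)] by auto
  moreover have "?X j \<subseteq> verts (H j)"
    using assms(2)[OF assms(3)] by auto
  moreover have "(W \<union> (\<Union>i\<in>I. X i)) \<inter> S = X j"
    if "W \<inter> S = {}" "\<And>i. i \<in> I \<Longrightarrow> i \<noteq> j \<Longrightarrow> X i \<inter> S = {}" "X j \<subseteq> S" "j \<in> I"
    for X :: "nat \<Rightarrow> 'a set" and S I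
    using that by blast
  ultimately show ?thesis unfolding big_cover_def using assms(3) by blast
qed

text \<open>
  If $x_i \notin C$, the edges at $x_i$ force $V(H_i) \subseteq C$. If $x_i \in C$, they are covered
  anyway, and \<open>C\<close> meets $H_i$ in a minimal cover. No condition of minimality remains for the
  part in \<open>G\<close>: the minimal cover of $H_i$ misses some vertex of $H_i$, and $x_i$ cannot be
  removed on account of the edge joining them.
\<close>

lemma minimal_vertex_covers_GH:
  "minimal_vertex_covers GH = {big_cover W D | W D. vertex_cover G W \<and>
     (\<forall>i\<in>{1..n}. x i \<in> W \<longrightarrow> D i \<in> minimal_vertex_covers (H i))}" (is "_ = ?R")
proof (intro equalityI subsetI)
  fix C assume C: "C \<in> minimal_vertex_covers GH"
  then have cov: "vertex_cover GH C" and min: "\<And>D. D \<subset> C \<Longrightarrow> \<not> vertex_cover GH D"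
    by (auto simp: minimal_vertex_covers_def)
  note covD = cov[unfolded vertex_cover_GH_iff]
  let ?W = "C \<inter> verts G" and ?D = "\<lambda>i. C \<inter> verts (H i)"
  have "?D i \<in> minimal_vertex_covers (H i)" if i: "i \<in> {1..n}" "x i \<in> C" for i
  proof -
    obtain E where E: "E \<subseteq> ?D i" "E \<in> minimal_vertex_covers (H i)"
      using minimal_cover_exists[OF finite_H[OF i(1)], of "?D i"] covD i(1) by auto
    let ?C = "C - (verts (H i) - E)"
    have "vertex_cover GH ?C"
      unfolding vertex_cover_GH_iff
    proof (intro conjI ballI impI)
      show "?C \<subseteq> verts GH" using covD by auto
      have "?C \<inter> verts G = C \<inter> verts G" using disj_G[OF i(1)] by auto
      then show "vertex_cover G (?C \<inter> verts G)" using covD by simp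
    next
      fix j assume j: "j \<in> {1..n}"
      show "vertex_cover (H j) (?C \<inter> verts (H j))"
      proof (cases "j = i")
        case True
        then have "?C \<inter> verts (H j) = E" using E(1) by auto
        then show ?thesis using E(2) True by (simp add: minimal_vertex_covers_def)
      next
        case False
        then have "?C \<inter> verts (H j) = C \<inter> verts (H j)" using disj_H[OF i(1) j] by auto
        then show ?thesis using covD j by simp
      qed
    next
      fix j assume j: "j \<in> {1..n}" "x j \<notin> ?C"
      then have xj: "x j \<notin> C" using x_notin_H[OF j(1) i(1)] by auto
      then have "j \<noteq> i" using i(2) by auto
      then show "verts (H j) \<subseteq> ?C" using disj_H[OF i(1) j(1)] covD j(1) xj by auto
    qed
    then have "?C = C" using min[of ?C] by auto
    then have "E = ?D i" using E(1) by auto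
    then show ?thesis using E(2) by simp
  qed
  then have "\<forall>i\<in>{1..n}. x i \<in> ?W \<longrightarrow> ?D i \<in> minimal_vertex_covers (H i)" by simp
  moreover have "C = big_cover ?W ?D"
  proof (intro equalityI subsetI)
    fix v assume "v \<in> C"
    then consider "v \<in> verts G" | i where "i \<in> {1..n}" "v \<in> verts (H i)"
      using covD by (auto simp: verts_GH)
    then show "v \<in> big_cover ?W ?D"
    proof cases
      case 2
      then have "v \<in> (if x i \<in> ?W then ?D i else verts (H i))" using \<open>v \<in> C\<close> by simp
      with 2(1) show ?thesis unfolding big_cover_def by blast
    qed (simp add: big_cover_def \<open>v \<in> C\<close>)
  next
    fix v assume "v \<in> big_cover ?W ?D"
    then show "v \<in> C" using covD x_in by (auto simp: big_cover_def split: if_splits)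
  qed
  ultimately show "C \<in> ?R" using covD by blast
next
  fix C assume "C \<in> ?R"
  then obtain W D where C: "C = big_cover W D" and W: "vertex_cover G W"
    and D: "\<And>i. i \<in> {1..n} \<Longrightarrow> x i \<in> W \<Longrightarrow> D i \<in> minimal_vertex_covers (H i)" by blast
  have WG: "W \<subseteq> verts G" using W by (simp add: vertex_cover_def)
  have DH: "D i \<subseteq> verts (H i)" if "i \<in> {1..n}" "x i \<in> W" for i
    using D[OF that] by (rule minimal_cover_subset)
  have CG: "C \<inter> verts G = W" unfolding C by (rule big_cover_Int_G[OF WG DH])
  have CH: "C \<inter> verts (H i) = (if x i \<in> W then D i else verts (H i))" if "i \<in> {1..n}" for i
    unfolding C by (rule big_cover_Int_H[OF WG DH that])
  have xC: "x i \<in> C \<longleftrightarrow> x i \<in> W" if "i \<in> {1..n}" for i using CG x_in[OF that] by auto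
  have full: "vertex_cover (H i) (verts (H i))" if "i \<in> {1..n}" for i
    using graph_H[OF that] unfolding vertex_cover_def finite_simple_graph_def
    by (metis Int_absorb2 card.empty order_refl zero_neq_numeral)
  have CA: "C \<subseteq> verts GH"
  proof -
    have "(if x i \<in> W then D i else verts (H i)) \<subseteq> verts (H i)" if "i \<in> {1..n}" for i
      using DH[OF that] by auto
    then show ?thesis unfolding C big_cover_def verts_GH using WG by blast
  qed
  have "vertex_cover GH C"
    unfolding vertex_cover_GH_iff CG
  proof (intro conjI ballI impI W CA)
    fix i assume i: "i \<in> {1..n}"
    show "vertex_cover (H i) (C \<inter> verts (H i))"
      using D[OF i] full[OF i] by (auto simp: CH[OF i] minimal_vertex_covers_def)
    show "verts (H i) \<subseteq> C" if "x i \<notin> C" using that CH[OF i] xC[OF i] by auto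
  qed
  moreover have "\<not> vertex_cover GH E" if E: "E \<subset> C" for E
  proof
    assume "vertex_cover GH E"
    note ED = this[unfolded vertex_cover_GH_iff]
    obtain v where v: "v \<in> C" "v \<notin> E" using E by auto
    consider "v \<in> verts G" | i where "i \<in> {1..n}" "v \<in> verts (H i)"
      using v(1) CA by (auto simp: verts_GH)
    then show False
    proof cases
      case 1
      then obtain i where i: "i \<in> {1..n}" "v = x i"
        unfolding bij_betw_imp_surj_on[OF bij, symmetric] by blast
      then have "verts (H i) \<subseteq> E" using ED v(2) by blast
      then have "verts (H i) \<subseteq> C" using E by blast
      moreover have "x i \<in> W" using v(1) i xC by simp
      ultimately have "D i = verts (H i)" using CH[OF i(1)] by auto
      then show False
        using minimal_cover_proper[OF graph_H[OF i(1)] nonempty[OF i(1)] D[OF i(1) \<open>x i \<in> W\<close>]] by auto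
    next
      case 2
      then have xE: "x i \<in> E" using ED v(2) by auto
      then have "x i \<in> W" using E xC[OF 2(1)] by auto
      moreover from this have "E \<inter> verts (H i) \<subset> D i" using CH[OF 2(1)] E v 2 by auto
      moreover have "vertex_cover (H i) (E \<inter> verts (H i))" using ED 2(1) by blast
      ultimately show False using D[OF 2(1)] by (auto simp: minimal_vertex_covers_def)
    qed
  qed
  ultimately show "C \<in> minimal_vertex_covers GH" by (simp add: minimal_vertex_covers_def)
qed


section \<open>Products of covers of the composed graph\<close>

definition ind :: "'a set \<Rightarrow> nat \<Rightarrow> nat" where
  "ind W i = (if i \<in> {1..n} \<and> x i \<in> W then 1 else 0)"

text \<open>The vectors that count, for each $i$, how many among $k$ vertex covers of \<open>G\<close> contain $x_i$.\<close>

fun counts :: "nat \<Rightarrow> (nat \<Rightarrow> nat) set" where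
  "counts 0 = {\<lambda>_. 0}"
| "counts (Suc k) = {\<lambda>i. a i + ind W i | a W. a \<in> counts k \<and> vertex_cover G W}"

lemma counts_le: "a \<in> counts k \<Longrightarrow> a i \<le> k"
proof (induction k arbitrary: a)
  case (Suc k)
  then obtain b W where "b \<in> counts k" "a = (\<lambda>i. b i + ind W i)" by auto
  then show ?case using Suc.IH[of b] by (simp add: ind_def)
qed simp

lemma finite_counts: "finite (counts k)"
proof (induction k)
  case (Suc k)
  have "finite {W. vertex_cover G W}"
    by (rule finite_subset[of _ "Pow (verts G)"]) (auto simp: vertex_cover_def finite_G)
  with Suc show ?case by (simp add: finite_image_set2)
qed simp

text \<open>Some cover does not contain $x_j$, and adding $x_j$ to it gives another cover.\<close>

lemma counts_upward: "a \<in> counts k \<Longrightarrow> j \<in> {1..n} \<Longrightarrow> a j < k \<Longrightarrow> a(j := Suc (a j)) \<in> counts k"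
proof (induction k arbitrary: a)
  case (Suc k)
  then obtain b W where b: "b \<in> counts k" "vertex_cover G W" "a = (\<lambda>i. b i + ind W i)" by auto
  show ?case
  proof (cases "x j \<in> W")
    case True
    then have "b j < k" using Suc.prems b(3) by (simp add: ind_def)
    then have "b(j := Suc (b j)) \<in> counts k" using Suc.IH b(1) Suc.prems by blast
    moreover have "a(j := Suc (a j)) = (\<lambda>i. (b(j := Suc (b j))) i + ind W i)" by (auto simp: b(3))
    ultimately show ?thesis using b(2) unfolding counts.simps by blast
  next
    case False
    have "vertex_cover G (insert (x j) W)"
      using b(2) x_in[OF Suc.prems(2)] by (auto simp: vertex_cover_def)
    moreover have "a(j := Suc (a j)) = (\<lambda>i. b i + ind (insert (x j) W) i)"
      using False Suc.prems(2) x_inj[of _ j] by (auto simp: b(3) ind_def fun_eq_iff)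
    ultimately show ?thesis using b(1) by auto
  qed
qed simp

text \<open>The contribution $x_i^c \, w \, u_{V(H_i)}^{k-c}$ of $x_i$ and $H_i$ to a product of $k$ covers.\<close>

definition part :: "nat \<Rightarrow> nat \<Rightarrow> nat \<Rightarrow> 'a mon \<Rightarrow> 'a mon" where
  "part k i c w = single (x i) c + w + fill (k - c) (verts (H i))"

definition glue :: "nat \<Rightarrow> (nat \<Rightarrow> nat) \<Rightarrow> (nat \<Rightarrow> 'a mon) \<Rightarrow> 'a mon" where
  "glue k a us = (\<Sum>i\<in>{1..n}. part k i (a i) (us i))"

lemma glue_cong: "(\<And>i. i \<in> {1..n} \<Longrightarrow> us i = us' i) \<Longrightarrow> glue k a us = glue k a us'"
  by (simp add: glue_def)

lemma glue_update:
  assumes "j \<in> {1..n}" "m + part k j (a j) (us j) = g + part k j c w"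
  shows "m + glue k a us = g + glue k (a(j := c)) (us(j := w))"
proof -
  let ?rest = "\<Sum>i\<in>{1..n} - {j}. part k i (a i) (us i)"
  have "glue k a us = part k j (a j) (us j) + ?rest"
    unfolding glue_def by (rule sum.remove) (use assms in auto)
  moreover have "glue k (a(j := c)) (us(j := w)) = part k j c w + ?rest"
    unfolding glue_def by (subst sum.remove[of _ j]) (use assms in \<open>auto intro!: sum.cong\<close>)
  ultimately show ?thesis using assms(2) by (simp flip: add.assoc)
qed

lemma set_mon_big_cover:
  assumes W: "W \<subseteq> verts G" and D: "\<And>i. i \<in> {1..n} \<Longrightarrow> x i \<in> W \<Longrightarrow> D i \<subseteq> verts (H i)"
  shows "set_mon (big_cover W D) = (\<Sum>i\<in>{1..n}. single (x i) (ind W i) +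
    set_mon (if x i \<in> W then D i else verts (H i)))"
proof -
  let ?X = "\<lambda>i. if x i \<in> W then D i else verts (H i)"
  have X: "?X i \<subseteq> verts (H i)" if "i \<in> {1..n}" for i using D[OF that] by auto
  have finX: "finite (?X i)" if "i \<in> {1..n}" for i
    using X[OF that] finite_H[OF that] finite_subset by blast
  have "W \<inter> (\<Union>i\<in>{1..n}. ?X i) = {}"
    using W X disj_G by blast
  then have "set_mon (big_cover W D) = set_mon W + set_mon (\<Union>i\<in>{1..n}. ?X i)"
    unfolding big_cover_def
    by (intro set_mon_Un) (use finX W finite_G finite_subset in blast)+
  also have "set_mon (\<Union>i\<in>{1..n}. ?X i) = (\<Sum>i\<in>{1..n}. set_mon (?X i))"
    unfolding set_mon_def
  proof (rule sum.UNION_disjoint)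
    show "\<forall>i\<in>{1..n}. \<forall>j\<in>{1..n}. i \<noteq> j \<longrightarrow> ?X i \<inter> ?X j = {}"
      using X disj_H by blast
  qed (use finX in auto)
  also have "set_mon W = (\<Sum>i\<in>{1..n}. single (x i) (ind W i))"
  proof -
    have "W = x ` {i \<in> {1..n}. x i \<in> W}"
    proof (intro equalityI subsetI)
      fix v assume v: "v \<in> W"
      then have "v \<in> x ` {1..n}" using W bij_betw_imp_surj_on[OF bij] by blast
      with v show "v \<in> x ` {i \<in> {1..n}. x i \<in> W}" by blast
    qed blast
    moreover have "inj_on x {i \<in> {1..n}. x i \<in> W}"
      by (rule inj_on_subset[OF bij_betw_imp_inj_on[OF bij]]) auto
    ultimately have "set_mon W = (\<Sum>i\<in>{i \<in> {1..n}. x i \<in> W}. single (x i) 1)"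
      unfolding set_mon_def by (metis (no_types, lifting) sum.reindex_cong)
    also have "\<dots> = (\<Sum>i\<in>{1..n}. single (x i) (ind W i))"
      by (rule sum.mono_neutral_cong_left) (auto simp: ind_def)
    finally show ?thesis .
  qed
  finally show ?thesis by (simp add: sum.distrib)
qed

lemma glue_Suc:
  assumes a: "a \<in> counts k" and W: "W \<subseteq> verts G"
    and D: "\<And>i. i \<in> {1..n} \<Longrightarrow> x i \<in> W \<Longrightarrow> D i \<subseteq> verts (H i)"
  shows "glue (Suc k) (\<lambda>i. a i + ind W i) (\<lambda>i. us i + (if x i \<in> W then set_mon (D i) else 0))
    = glue k a us + set_mon (big_cover W D)"
proof -
  have "part (Suc k) i (a i + ind W i) (us i + (if x i \<in> W then set_mon (D i) else 0)) =
      part k i (a i) (us i) +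
      (single (x i) (ind W i) + set_mon (if x i \<in> W then D i else verts (H i)))"
    if i: "i \<in> {1..n}" for i
  proof -
    have "Suc k - a i = Suc (k - a i)" using counts_le[OF a, of i] by simp
    then show ?thesis
      using i by (simp add: part_def single_add fill_Suc ind_def ac_simps)
  qed
  moreover have "set_mon (big_cover W D) = (\<Sum>i\<in>{1..n}. single (x i) (ind W i) +
      set_mon (if x i \<in> W then D i else verts (H i)))"
    by (rule set_mon_big_cover[OF W D])
  ultimately show ?thesis
    unfolding glue_def by (simp add: sum.distrib)
qed

abbreviation "U i \<equiv> set_mon ` minimal_vertex_covers (H i)"

text \<open>For a given vector of counts, the products of covers of the $H_i$ can be chosen independently
  of each other, since only the number of factors that contain $x_i$ matters for $H_i$.\<close>

theorem sums_of_covers_GH: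
  "sums_of (set_mon ` minimal_vertex_covers GH) k
    = {glue k a us | a us. a \<in> counts k \<and> (\<forall>i\<in>{1..n}. us i \<in> sums_of (U i) (a i))}"
proof (induction k)
  case 0
  have "glue 0 (\<lambda>_. 0) us = 0" if "\<forall>i\<in>{1..n}. us i = 0" for us
    using that by (simp add: glue_def part_def fill_def)
  then show ?case by (auto intro!: exI[of _ "\<lambda>_. 0"])
next
  case (Suc k)
  show ?case
  proof (intro equalityI subsetI)
    fix m assume "m \<in> sums_of (set_mon ` minimal_vertex_covers GH) (Suc k)"
    then obtain p C where m: "m = p + set_mon C" "p \<in> sums_of (set_mon ` minimal_vertex_covers GH) k"
      "C \<in> minimal_vertex_covers GH" by auto
    obtain a us where p: "p = glue k a us" "a \<in> counts k" "\<forall>i\<in>{1..n}. us i \<in> sums_of (U i) (a i)"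
      using m(2) unfolding Suc by auto
    obtain W D where C: "C = big_cover W D" "vertex_cover G W"
      "\<forall>i\<in>{1..n}. x i \<in> W \<longrightarrow> D i \<in> minimal_vertex_covers (H i)"
      using m(3) unfolding minimal_vertex_covers_GH by auto
    let ?a = "\<lambda>i. a i + ind W i" and ?us = "\<lambda>i. us i + (if x i \<in> W then set_mon (D i) else 0)"
    have "m = glue (Suc k) ?a ?us"
      unfolding m(1) p(1) C(1)
    proof (rule glue_Suc[OF p(2), symmetric])
      show "W \<subseteq> verts G" using C(2) by (simp add: vertex_cover_def)
      show "D i \<subseteq> verts (H i)" if "i \<in> {1..n}" "x i \<in> W" for i
        using C(3) that minimal_cover_subset[of "D i"] by blast
    qed
    moreover have "?a \<in> counts (Suc k)" using p(2) C(2) by auto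
    moreover have "?us i \<in> sums_of (U i) (?a i)" if i: "i \<in> {1..n}" for i
    proof -
      have "us i \<in> sums_of (U i) (a i)" using p(3) i by blast
      moreover have "set_mon (D i) \<in> U i" if "x i \<in> W" using C(3) i that by blast
      ultimately show ?thesis using i by (auto simp: ind_def simp del: image_eqI)
    qed
    ultimately show "m \<in> {glue (Suc k) a us | a us. a \<in> counts (Suc k) \<and>
        (\<forall>i\<in>{1..n}. us i \<in> sums_of (U i) (a i))}" by blast
  next
    fix m assume "m \<in> {glue (Suc k) a us | a us. a \<in> counts (Suc k) \<and>
        (\<forall>i\<in>{1..n}. us i \<in> sums_of (U i) (a i))}"
    then obtain a W us where m: "m = glue (Suc k) (\<lambda>i. a i + ind W i) us" "a \<in> counts k"
      "vertex_cover G W" "\<forall>i\<in>{1..n}. us i \<in> sums_of (U i) (a i + ind W i)" by auto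
    have "\<exists>b D. (x i \<in> W \<longrightarrow> D \<in> minimal_vertex_covers (H i)) \<and> b \<in> sums_of (U i) (a i) \<and>
        us i = b + (if x i \<in> W then set_mon D else 0)" if i: "i \<in> {1..n}" for i
    proof (cases "x i \<in> W")
      case True
      then have "ind W i = 1" using i by (simp add: ind_def)
      moreover have "us i \<in> sums_of (U i) (a i + ind W i)" using m(4) i by blast
      ultimately have "us i \<in> sums_of (U i) (Suc (a i))" by (simp only: add.commute plus_1_eq_Suc)
      then obtain b E where "b \<in> sums_of (U i) (a i)" "E \<in> minimal_vertex_covers (H i)"
        "us i = b + set_mon E" unfolding sums_of.simps by blast
      then show ?thesis using True by auto
    next
      case False
      then have "ind W i = 0" by (simp add: ind_def)
      moreover have "us i \<in> sums_of (U i) (a i + ind W i)" using m(4) i by blast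
      ultimately have "us i \<in> sums_of (U i) (a i)" by simp
      then show ?thesis using False by auto
    qed
    then obtain b D where bD: "\<And>i. i \<in> {1..n} \<Longrightarrow> (x i \<in> W \<longrightarrow> D i \<in> minimal_vertex_covers (H i)) \<and>
        b i \<in> sums_of (U i) (a i) \<and> us i = b i + (if x i \<in> W then set_mon (D i) else 0)" by metis
    have "m = glue (Suc k) (\<lambda>i. a i + ind W i) (\<lambda>i. b i + (if x i \<in> W then set_mon (D i) else 0))"
      unfolding m(1) by (rule glue_cong) (use bD in blast)
    also have "\<dots> = glue k a b + set_mon (big_cover W D)"
    proof (rule glue_Suc[OF m(2)])
      show "W \<subseteq> verts G" using m(3) by (simp add: vertex_cover_def)
      show "D i \<subseteq> verts (H i)" if "i \<in> {1..n}" "x i \<in> W" for i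
        using bD that minimal_cover_subset[of "D i"] by blast
    qed
    finally have "m = glue k a b + set_mon (big_cover W D)" .
    moreover have "glue k a b \<in> sums_of (set_mon ` minimal_vertex_covers GH) k"
      unfolding Suc using m(2) bD by blast
    moreover have "big_cover W D \<in> minimal_vertex_covers GH"
      unfolding minimal_vertex_covers_GH using m(3) bD by blast
    ultimately show "m \<in> sums_of (set_mon ` minimal_vertex_covers GH) (Suc k)" by auto
  qed
qed

lemma part_mons:
  assumes i: "i \<in> {1..n}" and w: "w \<in> mons (verts (H i))"
  shows "part k i c w \<in> mons (insert (x i) (verts (H i)))"
proof -
  have "v \<in> insert (x i) (verts (H i))" if "lookup (part k i c w) v \<noteq> 0" for v
  proof (rule ccontr)
    assume v: "v \<notin> insert (x i) (verts (H i))"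
    then have "v \<notin> keys w" using w by (auto simp: mons_def)
    then show False
      using v that finite_H[OF i]
      by (auto simp: part_def in_keys_iff lookup_add lookup_fill lookup_single when_def)
  qed
  then show ?thesis by (auto simp: mons_def in_keys_iff simp del: insert_iff)
qed

lemma part_outside:
  assumes "i \<in> {1..n}" "w \<in> mons (verts (H i))" "v \<noteq> x i" "v \<notin> verts (H i)"
  shows "lookup (part k i c w) v = 0"
  using part_mons[OF assms(1,2), of k c] assms(3,4) by (auto simp: mons_def in_keys_iff)

lemma lookup_glue_eq_part:
  assumes us: "\<And>i. i \<in> {1..n} \<Longrightarrow> us i \<in> mons (verts (H i))" and j: "j \<in> {1..n}"
    and v: "v = x j \<or> v \<in> verts (H j)"
  shows "lookup (glue k a us) v = lookup (part k j (a j) (us j)) v"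
proof -
  have 0: "lookup (part k i (a i) (us i)) v = 0" if "i \<in> {1..n}" "i \<noteq> j" for i
  proof (rule part_outside[OF that(1) us[OF that(1)]])
    show "v \<noteq> x i" using v x_inj[OF that(1) j] that(2) x_notin_H[OF that(1) j] by auto
    show "v \<notin> verts (H i)" using v x_notin_H[OF j that(1)] disj_H[OF that(1) j that(2)] by auto
  qed
  have "lookup (glue k a us) v = (\<Sum>i\<in>{1..n}. lookup (part k i (a i) (us i)) v)"
    by (simp add: glue_def lookup_sum)
  also have "\<dots> = (\<Sum>i\<in>{1..n}. if i = j then lookup (part k j (a j) (us j)) v else 0)"
    by (rule sum.cong) (use 0 in auto)
  finally show ?thesis using j by simp
qed

lemma lookup_glue_x:
  assumes "\<And>i. i \<in> {1..n} \<Longrightarrow> us i \<in> mons (verts (H i))" "j \<in> {1..n}"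
  shows "lookup (glue k a us) (x j) = a j"
proof -
  have "x j \<notin> verts (H j)" by (rule x_notin_H) (use assms in auto)
  moreover from this have "lookup (us j) (x j) = 0"
    using assms(1)[OF assms(2)] by (auto simp: mons_def in_keys_iff)
  ultimately show ?thesis
    using assms lookup_glue_eq_part[OF assms, of "x j" k a]
    by (simp add: part_def lookup_add lookup_fill finite_H)
qed

lemma lookup_glue_H:
  assumes "\<And>i. i \<in> {1..n} \<Longrightarrow> us i \<in> mons (verts (H i))" "j \<in> {1..n}" "v \<in> verts (H j)"
  shows "lookup (glue k a us) v = lookup (us j) v + (k - a j)"
proof -
  have "x j \<noteq> v" using x_notin_H[OF assms(2,2)] assms(3) by auto
  then show ?thesis
    using lookup_glue_eq_part[OF assms(1,2), of v k a] assms
    by (simp add: part_def lookup_add lookup_fill finite_H lookup_single)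
qed

lemma glue_mons:
  assumes "\<And>i. i \<in> {1..n} \<Longrightarrow> us i \<in> mons (verts (H i))"
  shows "glue k a us \<in> mons (verts GH)"
proof -
  have "v \<in> verts GH" if "v \<in> keys (glue k a us)" for v
  proof (rule ccontr)
    assume v: "v \<notin> verts GH"
    have "lookup (part k i (a i) (us i)) v = 0" if "i \<in> {1..n}" for i
      by (rule part_outside[OF that assms[OF that]]) (use v x_in that in \<open>auto simp: verts_GH\<close>)
    then have "lookup (glue k a us) v = 0" by (simp add: glue_def lookup_sum)
    with that show False by (simp add: in_keys_iff)
  qed
  then show ?thesis by (auto simp: mons_def)
qed

text \<open>
  An index is a vector of counts with a generator of $I_{H_i}^{a_i}$ for each $i$. The first
  component of the rank makes larger counts come earlier, the second one adds up the ranks of the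
  systems of the $H_i$. For disjointness, the exponent of $x_i$ in a monomial of a piece determines
  $a_i$: it equals $a_i$ if $a_i < k$, and is at least $k$ otherwise. The variables of $H_i$ then
  determine the generator of $I_{H_i}^{a_i}$.
\<close>

theorem cover_powers_GH_lq_system:
  fixes N :: "nat \<Rightarrow> nat \<Rightarrow> 'a mon set" and \<rho> :: "nat \<Rightarrow> nat \<Rightarrow> 'a mon \<Rightarrow> nat"
  assumes lq: "\<And>i c. i \<in> {1..n} \<Longrightarrow> lq_system (verts (H i)) (N i c) (\<lambda>m. m) (Q i c) (\<rho> i c)"
    and sub: "\<And>i c. i \<in> {1..n} \<Longrightarrow> N i c \<subseteq> sums_of (U i) c"
    and gen: "\<And>i c. i \<in> {1..n} \<Longrightarrow> sums_of (U i) c \<subseteq> multiples (N i c)"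
  shows "\<exists>(I :: ((nat \<Rightarrow> nat) \<times> (nat \<Rightarrow> 'a mon)) set) u Q' (\<rho>' :: _ \<Rightarrow> nat \<times> nat).
    lq_system (verts GH) I u Q' \<rho>' \<and>
    multiples (u ` I) = multiples (sums_of (set_mon ` minimal_vertex_covers GH) k)"
proof -
  define I where "I = {(a, us). a \<in> counts k \<and> (\<forall>i\<in>{1..n}. us i \<in> N i (a i)) \<and> (\<forall>i. i \<notin> {1..n} \<longrightarrow> us i = 0)}"
  define u where "u = (\<lambda>(a, us). glue k a us)"
  define Q' where "Q' = (\<lambda>(a, us). {x i | i. i \<in> {1..n} \<and> a i < k} \<union> (\<Union>i\<in>{1..n}. Q i (a i) (us i)))"
  define \<rho>' where "\<rho>' = (\<lambda>(a, us). (\<Sum>i\<in>{1..n}. k - a i, \<Sum>i\<in>{1..n}. \<rho> i (a i) (us i)))"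
  have I_mons: "us i \<in> mons (verts (H i))" if "(a, us) \<in> I" "i \<in> {1..n}" for a us i
    using that lq_systemD(2)[OF lq[OF that(2)], of "us i" "a i"] by (auto simp: I_def)
  have "lq_system (verts GH) I u Q' \<rho>'"
  proof (rule lq_systemI)
    let ?B = "\<Union>i\<in>{1..n}. \<Union>c\<in>{..k}. N i c"
    have "finite ?B" using lq_systemD(1)[OF lq] by auto
    then have "finite {f. \<forall>i. (i \<in> {1..n} \<longrightarrow> f i \<in> ?B) \<and> (i \<notin> {1..n} \<longrightarrow> f i = 0)}"
      by (intro finite_set_of_finite_funs) auto
    then have "finite (counts k \<times> {f. \<forall>i. (i \<in> {1..n} \<longrightarrow> f i \<in> ?B) \<and> (i \<notin> {1..n} \<longrightarrow> f i = 0)})"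
      using finite_counts by blast
    moreover have "I \<subseteq> counts k \<times> {f. \<forall>i. (i \<in> {1..n} \<longrightarrow> f i \<in> ?B) \<and> (i \<notin> {1..n} \<longrightarrow> f i = 0)}"
      using counts_le by (fastforce simp: I_def)
    ultimately show "finite I" by (rule rev_finite_subset)
  next
    fix p assume "p \<in> I"
    then obtain a us where p: "p = (a, us)" "(a, us) \<in> I" by (cases p) auto
    show "u p \<in> mons (verts GH)" using glue_mons I_mons[OF p(2)] by (simp add: u_def p(1))
    have "Q i (a i) (us i) \<subseteq> verts (H i)" if "i \<in> {1..n}" for i
      using lq_systemD(3)[OF lq[OF that], of "us i" "a i"] p(2) that by (auto simp: I_def)
    then have "(\<Union>i\<in>{1..n}. Q i (a i) (us i)) \<subseteq> (\<Union>i\<in>{1..n}. verts (H i))" by (rule UN_mono[OF subset_refl])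
    then show "Q' p \<subseteq> verts GH" using x_in unfolding Q'_def p(1) verts_GH by blast
  next
    fix p z assume pI: "p \<in> I" and zQ: "z \<in> Q' p"
    obtain a us where p: "p = (a, us)" by (cases p)
    have a: "a \<in> counts k" and us: "\<And>i. i \<in> {1..n} \<Longrightarrow> us i \<in> N i (a i)" and
      us0: "\<And>i. i \<notin> {1..n} \<Longrightarrow> us i = 0"
      using pI by (auto simp: I_def p)
    consider j where "j \<in> {1..n}" "z = x j" "a j < k" | j where "j \<in> {1..n}" "z \<in> Q j (a j) (us j)"
      using zQ by (auto simp: Q'_def p)
    then show "\<exists>q\<in>I. \<exists>g. g \<noteq> 0 \<and> single z 1 + u p = g + u q \<and> \<rho>' q < \<rho>' p"
    proof cases
      case 1
      let ?V = "verts (H j)"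
      have finV: "finite ?V" by (rule finite_H[OF 1(1)])
      have "vertex_cover (H j) ?V"
        using graph_H[OF 1(1)] unfolding vertex_cover_def finite_simple_graph_def
        by (metis Int_absorb2 card.empty order_refl zero_neq_numeral)
      then obtain C where C: "C \<in> minimal_vertex_covers (H j)"
        using minimal_cover_exists[OF finV] by blast
      have CV: "C \<subset> ?V" by (rule minimal_cover_proper[OF graph_H[OF 1(1)] nonempty[OF 1(1)] C])
      \<comment> \<open>One factor V(H j) is exchanged for x j and C; the rest d of V(H j) is the nontrivial cofactor.\<close>
      have "us j \<in> sums_of (U j) (a j)" using us sub 1(1) by blast
      then have "us j + set_mon C \<in> sums_of (U j) (Suc (a j))" using C by auto
      then have "us j + set_mon C \<in> multiples (N j (Suc (a j)))" using gen[OF 1(1)] by blast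
      then obtain h w where w: "w \<in> N j (Suc (a j))" "us j + set_mon C = h + w"
        by (auto simp: multiples_def)
      let ?d = "set_mon (?V - C)"
      have d0: "?d \<noteq> 0"
        using CV keys_set_mon[of "?V - C"] finV by auto
      have fill: "fill (k - a j) ?V = fill (k - Suc (a j)) ?V + (set_mon C + ?d)"
      proof -
        have "k - a j = Suc (k - Suc (a j))" using 1(3) by simp
        moreover have "set_mon ?V = set_mon C + ?d"
          using set_mon_Un[of C "?V - C"] CV finV finite_subset[of C ?V] by (simp add: Un_absorb1 psubset_imp_subset)
        ultimately show ?thesis by (simp add: fill_Suc)
      qed
      have "single z 1 + part k j (a j) (us j)
        = single (x j) (Suc (a j)) + (us j + set_mon C) + ?d + fill (k - Suc (a j)) ?V"
        unfolding part_def fill 1(2) using single_add[of "x j" "1::nat" "a j"] by (simp add: ac_simps)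
      also have "\<dots> = (?d + h) + part k j (Suc (a j)) w"
        unfolding part_def w(2) by (simp add: ac_simps)
      finally have eq: "single z 1 + glue k a us = (?d + h) + glue k (a(j := Suc (a j))) (us(j := w))"
        by (rule glue_update[where us = us, OF 1(1)])
      have qI: "(a(j := Suc (a j)), us(j := w)) \<in> I"
        using counts_upward[OF a 1(1,3)] us us0 w(1) 1(1) by (auto simp: I_def)
      have "(\<Sum>i\<in>{1..n}. k - (a(j := Suc (a j))) i) < (\<Sum>i\<in>{1..n}. k - a i)"
        by (rule sum_strict_mono_ex1) (use 1 in \<open>auto intro!: bexI[of _ j]\<close>)
      then have "\<rho>' (a(j := Suc (a j)), us(j := w)) < \<rho>' p"
        unfolding \<rho>'_def p less_prod_def by simp
      with eq qI d0 show ?thesis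
        by (intro bexI[of _ "(a(j := Suc (a j)), us(j := w))"] exI[of _ "?d + h"])
          (auto simp: u_def p add_eq_0_mon)
    next
      case 2
      obtain w g where w: "w \<in> N j (a j)" "g \<noteq> 0" "single z 1 + us j = g + w"
        "\<rho> j (a j) w < \<rho> j (a j) (us j)"
        using lq_system_move[OF lq[OF 2(1)] us[OF 2(1)] 2(2)] by metis
      have "single z 1 + part k j (a j) (us j)
        = single (x j) (a j) + (single z 1 + us j) + fill (k - a j) (verts (H j))"
        unfolding part_def by (simp add: ac_simps)
      also have "\<dots> = g + part k j (a j) w"
        unfolding part_def w(3) by (simp add: ac_simps)
      finally have eq: "single z 1 + glue k a us = g + glue k (a(j := a j)) (us(j := w))"
        by (rule glue_update[where us = us, OF 2(1)])
      have qI: "(a, us(j := w)) \<in> I" using a us us0 w(1) 2(1) by (auto simp: I_def)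
      have "(\<Sum>i\<in>{1..n}. \<rho> i (a i) ((us(j := w)) i)) < (\<Sum>i\<in>{1..n}. \<rho> i (a i) (us i))"
        by (rule sum_strict_mono_ex1) (use 2(1) w(4) in \<open>auto intro!: bexI[of _ j]\<close>)
      then have "\<rho>' (a, us(j := w)) < \<rho>' p"
        unfolding \<rho>'_def p less_prod_def by simp
      with eq qI w(2) show ?thesis
        by (intro bexI[of _ "(a, us(j := w))"] exI[of _ g]) (auto simp: u_def p)
    qed
  next
    fix p q f h
    assume pq: "p \<in> I" "q \<in> I" and fh: "f \<in> mons (verts GH)" "h \<in> mons (verts GH)" "f + u p = h + u q"
      "keys f \<inter> Q' p = {}" "keys h \<inter> Q' q = {}"
    obtain a us where p: "p = (a, us)" by (cases p)
    obtain b vs where q: "q = (b, vs)" by (cases q)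
    have pI: "(a, us) \<in> I" and qI: "(b, vs) \<in> I" using pq p q by auto
    have lk: "lookup f v + lookup (glue k a us) v = lookup h v + lookup (glue k b vs) v" for v
      using arg_cong[OF fh(3), of "\<lambda>m. lookup m v"] by (simp add: u_def p q lookup_add)
    have ab: "a i = b i" for i
    proof (cases "i \<in> {1..n}")
      case True
      have "lookup f (x i) + a i = lookup h (x i) + b i"
        using lk[of "x i"] lookup_glue_x[OF I_mons[OF pI] True] lookup_glue_x[OF I_mons[OF qI] True] by simp
      moreover have "lookup f (x i) = 0" if "a i < k"
        using that fh(4) True by (auto simp: Q'_def p in_keys_iff)
      moreover have "lookup h (x i) = 0" if "b i < k"
        using that fh(5) True by (auto simp: Q'_def q in_keys_iff)
      moreover have "a i \<le> k" "b i \<le> k" using pI qI counts_le by (auto simp: I_def)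
      ultimately show ?thesis by linarith
    next
      case False
      have "c i = 0" if "c \<in> counts l" for c l
        using that
      proof (induction l arbitrary: c)
        case (Suc l)
        then obtain d W where "d \<in> counts l" "c = (\<lambda>i. d i + ind W i)" by auto
        with Suc.IH[of d] False show ?case by (simp add: ind_def) linarith
      qed simp
      from this[of a k] this[of b k] show ?thesis using pI qI by (simp add: I_def)
    qed
    have "us i = vs i" for i
    proof (cases "i \<in> {1..n}")
      case True
      have "us i \<in> N i (a i)" "vs i \<in> N i (a i)"
        using pI qI ab True by (auto simp: I_def)
      then show ?thesis
      proof (rule lq_systemD(4)[OF lq[OF True]])
        show "restrict_mon (verts (H i)) f + us i = restrict_mon (verts (H i)) h + vs i"
        proof (rule poly_mapping_eqI)
          fix v
          show "lookup (restrict_mon (verts (H i)) f + us i) v = lookup (restrict_mon (verts (H i)) h + vs i) v"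
          proof (cases "v \<in> verts (H i)")
            case v: True
            show ?thesis
              using lk[of v] lookup_glue_H[OF I_mons[OF pI] True v] lookup_glue_H[OF I_mons[OF qI] True v] ab v
              by (simp add: lookup_add lookup_restrict_mon)
          next
            case False
            then have "v \<notin> keys (us i)" "v \<notin> keys (vs i)"
              using I_mons[OF pI True] I_mons[OF qI True] by (auto simp: mons_def)
            then show ?thesis using False by (simp add: lookup_add lookup_restrict_mon in_keys_iff)
          qed
        qed
        show "keys (restrict_mon (verts (H i)) f) \<inter> Q i (a i) (us i) = {}"
          using fh(4) True by (auto simp: Q'_def p keys_restrict_mon)
        show "keys (restrict_mon (verts (H i)) h) \<inter> Q i (a i) (vs i) = {}"
          using fh(5) True ab by (auto simp: Q'_def q keys_restrict_mon)
      qed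
    next
      case False
      then show ?thesis using pI qI by (auto simp: I_def)
    qed
    then show "p = q" using ab p q by (simp add: fun_eq_iff)
  qed
  moreover have "multiples (u ` I) = multiples (sums_of (set_mon ` minimal_vertex_covers GH) k)"
  proof
    have "u ` I \<subseteq> sums_of (set_mon ` minimal_vertex_covers GH) k"
    proof
      fix m assume "m \<in> u ` I"
      then obtain a us where m: "m = glue k a us" "(a, us) \<in> I" by (auto simp: u_def)
      have "us i \<in> sums_of (U i) (a i)" if "i \<in> {1..n}" for i
        using m(2) that sub[OF that, of "a i"] unfolding I_def by blast
      moreover have "a \<in> counts k" using m(2) by (simp add: I_def)
      ultimately show "m \<in> sums_of (set_mon ` minimal_vertex_covers GH) k"
        unfolding sums_of_covers_GH m(1) by blast
    qed
    then show "multiples (u ` I) \<subseteq> multiples (sums_of (set_mon ` minimal_vertex_covers GH) k)"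
      using multiples_subsetI subset_multiples by blast
    have "glue k a us \<in> multiples (u ` I)"
      if a: "a \<in> counts k" and us: "\<forall>i\<in>{1..n}. us i \<in> sums_of (U i) (a i)" for a us
    proof -
      have "\<exists>w h. w \<in> N i (a i) \<and> us i = h + w" if "i \<in> {1..n}" for i
        using us gen[OF that, of "a i"] that by (fastforce simp: multiples_def)
      then obtain w h where w: "\<And>i. i \<in> {1..n} \<Longrightarrow> w i \<in> N i (a i) \<and> us i = h i + w i" by metis
      \<comment> \<open>Indices are functions on nat, normalised to 0 outside of 1..n to keep the index set finite.\<close>
      let ?w = "\<lambda>i. if i \<in> {1..n} then w i else 0"
      have "glue k a us = (\<Sum>i\<in>{1..n}. h i) + glue k a ?w"
        unfolding glue_def sum.distrib[symmetric]
        by (rule sum.cong) (use w in \<open>auto simp: part_def ac_simps\<close>)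
      moreover have "(a, ?w) \<in> I" using a w by (simp add: I_def)
      then have "glue k a ?w \<in> u ` I" unfolding u_def by force
      ultimately show ?thesis by (simp add: multiples_I)
    qed
    then show "multiples (sums_of (set_mon ` minimal_vertex_covers GH) k) \<subseteq> multiples (u ` I)"
      by (intro multiples_subsetI) (auto simp: sums_of_covers_GH)
  qed
  ultimately show ?thesis by blast
qed

end

theorem theorem2p2:
  fixes n :: nat
    and x :: "nat \<Rightarrow> 'a"
    and G :: "'a ugraph"
    and H :: "nat \<Rightarrow> 'a ugraph"
  assumes "finite_simple_graph G"
    and "bij_betw x {1..n} (verts G)"
    and "\<forall>i\<in>{1..n}. finite_simple_graph (H i) \<and> verts (H i) \<noteq> {}"
    and "\<forall>i\<in>{1..n}. verts G \<inter> verts (H i) = {}"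
    and "\<forall>i\<in>{1..n}. \<forall>j\<in>{1..n}. i \<noteq> j \<longrightarrow> verts (H i) \<inter> verts (H j) = {}"
    and "\<forall>i\<in>{1..n}. \<exists>r. monomial_order (T_vars (H i)) r \<and>
           has_quadratic_groebner_basis (T_vars (H i)) r
             (rees_ideal (H i) :: ('a + 'a set, 'k::field) mpoly set)"
  shows "\<forall>k::nat.
    has_linear_quotients (verts (attach n x G H))
      ((cover_ideal (attach n x G H) :: ('a, 'k) mpoly set)
         [^]\<^bsub>ideals_set (mpoly_ring (verts (attach n x G H)))\<^esub> k) \<and>
    componentwise_linear (verts (attach n x G H))
      ((cover_ideal (attach n x G H) :: ('a, 'k) mpoly set)
         [^]\<^bsub>ideals_set (mpoly_ring (verts (attach n x G H)))\<^esub> k)"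
proof
  fix k :: nat
  interpret attached_graphs n x G H
    by unfold_locales (use assms in blast)+
  have "\<forall>i c. \<exists>N Q (\<rho> :: 'a mon \<Rightarrow> nat). i \<in> {1..n} \<longrightarrow> lq_system (verts (H i)) N (\<lambda>m. m) Q \<rho> \<and>
      N \<subseteq> sums_of (U i) c \<and> sums_of (U i) c \<subseteq> multiples N"
  proof (intro allI)
    fix i c
    show "\<exists>N Q (\<rho> :: 'a mon \<Rightarrow> nat). i \<in> {1..n} \<longrightarrow> lq_system (verts (H i)) N (\<lambda>m. m) Q \<rho> \<and>
      N \<subseteq> sums_of (U i) c \<and> sums_of (U i) c \<subseteq> multiples N"
    proof (cases "i \<in> {1..n}")
      case True
      then obtain r where "monomial_order (T_vars (H i)) r"
        "has_quadratic_groebner_basis (T_vars (H i)) r (rees_ideal (H i) :: ('a + 'a set, 'k) mpoly set)"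
        using assms(6) by blast
      from cover_powers_lq_system[OF graph_H[OF True] this, of c] show ?thesis by blast
    qed blast
  qed
  then obtain N Q and \<rho> :: "nat \<Rightarrow> nat \<Rightarrow> 'a mon \<Rightarrow> nat" where
    *: "\<And>i c. i \<in> {1..n} \<Longrightarrow> lq_system (verts (H i)) (N i c) (\<lambda>m. m) (Q i c) (\<rho> i c) \<and>
      N i c \<subseteq> sums_of (U i) c \<and> sums_of (U i) c \<subseteq> multiples (N i c)"
    by metis
  obtain I :: "((nat \<Rightarrow> nat) \<times> (nat \<Rightarrow> 'a mon)) set" and u Q' and \<rho>' :: "_ \<Rightarrow> nat \<times> nat" where
    lq: "lq_system (verts GH) I u Q' \<rho>'" and
    gen: "multiples (u ` I) = multiples (sums_of (set_mon ` minimal_vertex_covers GH) k)"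
    using cover_powers_GH_lq_system[of N Q \<rho> k] * by blast
  from mon_ideal_power[OF cover_monomials_mons[OF finite_GH], of k] have power:
    "(cover_ideal GH :: ('a, 'k) mpoly set) [^]\<^bsub>ideals_set (mpoly_ring (verts GH))\<^esub> k
      = mon_ideal (verts GH) (u ` I)"
    unfolding cover_ideal_eq[OF finite_GH] using mon_ideal_cong[OF gen, of "verts GH"] by metis
  show "has_linear_quotients (verts GH)
      ((cover_ideal GH :: ('a, 'k) mpoly set) [^]\<^bsub>ideals_set (mpoly_ring (verts GH))\<^esub> k) \<and>
    componentwise_linear (verts GH)
      ((cover_ideal GH :: ('a, 'k) mpoly set) [^]\<^bsub>ideals_set (mpoly_ring (verts GH))\<^esub> k)"
    unfolding power
    using lq_system_linear_quotients[OF lq] lq_system_componentwise_linear[OF lq finite_GH] by blast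
qed

end
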